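(* There is a universal constant $C>0$ such that for every $n\ge1$ and every centrally symmetric convex body $K\subset\mathbb{R}^n$ in isotropic position with $\mathrm{Vol}(K)=\mathrm{Vol}(D_n)$, $$L_K\le C\,\inf\left\{\sqrt{p_0}\;M_p^*(T(L))\;:\;K\subset L,\ L\in QL_q^n,\ T\in SL(n),\ 1\le q\le\infty,\ \tfrac1p+\tfrac1q=1\right\},$$ where $p_0=\max(1,\min(p,n))$.
   Context: $D_n$ is the Euclidean unit ball of $\mathbb{R}^n$, $\sigma$ is the Haar probability measure on $S^{n-1}$, and $SL(n)$ is the group of volume preserving linear transformations of $\mathbb{R}^n$. A convex body is a compact convex set with non-empty interior; it is centrally symmetric if $K=-K$. A centrally symmetric convex body $K\subset\mathbb{R}^n$ is in isotropic position if $\int_K\langle x,\theta\rangle^2dx$ is the same for all $\theta\in S^{n-1}$. Every such body has an invertible linear image of volume 1 in isotropic position, unique up to rotation; $L_K$ is the number with $\int_{K'}\langle x,\theta\rangle^2dx=L_K^2$ for all $\theta\in S^{n-1}$, where $K'$ is such an image of $K$. $QL_q^n$ is the class of all unit balls of $n$-dimensional quotients of $L_q=L_q([0,1],dx)$, i.e. centrally symmetric convex bodies $L\subset\mathbb{R}^n$ such that $(\mathbb{R}^n,\|\cdot\|_L)$ is linearly isometric to a quotient space of $L_q$, where $\|\cdot\|_L$ is the norm with unit ball $L$. For a convex body $G$ with polar $G^\circ=\{y:|\langle x,y\rangle|\le1\ \forall x\in G\}$, $M_p(G)=\left(\int_{S^{n-1}}\|x\|_G^p\,d\sigma(x)\right)^{1/p}$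 for $0<p<\infty$, $M_\infty(G)=\max_{x\in S^{n-1}}\|x\|_G$, and $M_p^*(G)=M_p(G^\circ)$. *)

theory Defs
  imports "HOL-Probability.Probability" "HOL-Library.Function_Algebras"
begin

text \<open>
  The dimension \<open>n\<close> is quantified below a universal constant, so it has to be a term rather than a
  type: \<open>\<real>\<^sup>n\<close> is the library's \<open>Euclidean_space n\<close>, the sequences vanishing from index \<open>n\<close> on.
  Pointwise scalar multiplication turns functions into a real vector space, which makes
  \<open>linear\<close>, \<open>subspace\<close> and \<open>convex\<close> available both for \<open>nat \<Rightarrow> real\<close> and for the functions in \<open>L\<^sub>q\<close>.
\<close>

instantiation "fun" :: (type, real_vector) real_vector
begin

definition scaleR_fun_def: "c *\<^sub>R f = (\<lambda>x. c *\<^sub>R f x)"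

instance
  by standard (simp_all add: scaleR_fun_def plus_fun_def scaleR_add_right scaleR_add_left)

end

definition Rn :: "nat \<Rightarrow> (nat \<Rightarrow> real) set" where
  "Rn n = topspace (Euclidean_space n)"

definition dot :: "nat \<Rightarrow> (nat \<Rightarrow> real) \<Rightarrow> (nat \<Rightarrow> real) \<Rightarrow> real" where
  "dot n x y = (\<Sum>i<n. x i * y i)"

definition unit_ball :: "nat \<Rightarrow> (nat \<Rightarrow> real) set" where
  "unit_ball n = {x \<in> Rn n. dot n x x \<le> 1}"

definition unit_sphere :: "nat \<Rightarrow> (nat \<Rightarrow> real) set" where
  "unit_sphere n = {x \<in> Rn n. dot n x x = 1}"

text \<open>
  Lebesgue measure on the Borel sets of \<open>\<real>\<^sup>n\<close>. Points of the product measure space are \<open>undefined\<close>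
  outside \<open>{..<n}\<close>; the map replaces this by \<open>0\<close>.
\<close>

definition leb :: "nat \<Rightarrow> (nat \<Rightarrow> real) measure" where
  "leb n = distr (\<Pi>\<^sub>M i\<in>{..<n}. lborel) (restrict_space borel (Rn n))
             (\<lambda>x i. if i < n then x i else 0)"

definition vol :: "nat \<Rightarrow> (nat \<Rightarrow> real) set \<Rightarrow> real" where
  "vol n A = measure (leb n) A"

definition sym_convex_body :: "nat \<Rightarrow> (nat \<Rightarrow> real) set \<Rightarrow> bool" where
  "sym_convex_body n K \<longleftrightarrow>
     compactin (Euclidean_space n) K \<and> convex K \<and> Euclidean_space n interior_of K \<noteq> {} \<and>
     uminus ` K = K"

text \<open>
  A linear map of \<open>\<real>\<^sup>n\<close> is represented by any linear extension to \<open>nat \<Rightarrow> real\<close>; only its values on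
  \<open>Rn n\<close> matter.
\<close>

definition GL :: "nat \<Rightarrow> ((nat \<Rightarrow> real) \<Rightarrow> nat \<Rightarrow> real) set" where
  "GL n = {T. linear T \<and> bij_betw T (Rn n) (Rn n)}"

text \<open>Volume preserving: both signs of the determinant are admitted.\<close>

definition SL :: "nat \<Rightarrow> ((nat \<Rightarrow> real) \<Rightarrow> nat \<Rightarrow> real) set" where
  "SL n = {T \<in> GL n. \<forall>A \<in> sets (leb n). emeasure (leb n) (T ` A) = emeasure (leb n) A}"

definition isotropic :: "nat \<Rightarrow> (nat \<Rightarrow> real) set \<Rightarrow> bool" where
  "isotropic n K \<longleftrightarrow> (\<exists>c. \<forall>\<theta> \<in> unit_sphere n. (LINT x:K|leb n. (dot n x \<theta>)\<^sup>2) = c)"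

definition isotropic_constant :: "nat \<Rightarrow> (nat \<Rightarrow> real) set \<Rightarrow> real" where
  "isotropic_constant n K =
     (THE l. 0 \<le> l \<and>
        (\<exists>T \<in> GL n. vol n (T ` K) = 1 \<and>
           (\<forall>\<theta> \<in> unit_sphere n. (LINT x:T ` K|leb n. (dot n x \<theta>)\<^sup>2) = l\<^sup>2)))"

definition body_norm :: "(nat \<Rightarrow> real) set \<Rightarrow> (nat \<Rightarrow> real) \<Rightarrow> real" where
  "body_norm G x = Inf {t. 0 < t \<and> x \<in> (\<lambda>y. t *\<^sub>R y) ` G}"

definition polar :: "nat \<Rightarrow> (nat \<Rightarrow> real) set \<Rightarrow> (nat \<Rightarrow> real) set" where
  "polar n G = {y \<in> Rn n. \<forall>x \<in> G. \<bar>dot n x y\<bar> \<le> 1}"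

text \<open>
  The Haar probability measure on the sphere is the only Borel probability measure invariant under
  the full orthogonal group (the special orthogonal group does not suffice for \<open>n = 1\<close>).
\<close>

definition haar_sphere :: "nat \<Rightarrow> (nat \<Rightarrow> real) measure \<Rightarrow> bool" where
  "haar_sphere n \<sigma> \<longleftrightarrow>
     prob_space \<sigma> \<and> sets \<sigma> = sets (restrict_space borel (unit_sphere n)) \<and>
     (\<forall>U. linear U \<and> U ` Rn n \<subseteq> Rn n \<and> (\<forall>x \<in> Rn n. \<forall>y \<in> Rn n. dot n (U x) (U y) = dot n x y) \<longrightarrow>
        (\<forall>A \<in> sets \<sigma>. emeasure \<sigma> (U ` A) = emeasure \<sigma> A))"

definition M_mean :: "nat \<Rightarrow> (nat \<Rightarrow> real) measure \<Rightarrow> ennreal \<Rightarrow> (nat \<Rightarrow> real) set \<Rightarrow> real" where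
  "M_mean n \<sigma> p G =
     (if p = \<infinity> then SUP x \<in> unit_sphere n. body_norm G x
      else (LINT x|\<sigma>. body_norm G x powr enn2real p) powr (1 / enn2real p))"

definition M_star :: "nat \<Rightarrow> (nat \<Rightarrow> real) measure \<Rightarrow> ennreal \<Rightarrow> (nat \<Rightarrow> real) set \<Rightarrow> real" where
  "M_star n \<sigma> p G = M_mean n \<sigma> p (polar n G)"

text \<open>
  \<open>L\<^sub>q([0,1])\<close> is represented by functions, without identifying those equal almost everywhere;
  accordingly \<open>Lq_norm\<close> is only a seminorm. A subspace closed for the seminorm contains all functions
  of seminorm \<open>0\<close>, so the closed subspaces, quotient spaces and quotient norms are those of \<open>L\<^sub>q\<close>.
\<close>

definition Lq_space :: "ennreal \<Rightarrow> (real \<Rightarrow> real) set" where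
  "Lq_space q = {f \<in> borel_measurable (lebesgue_on {0..1}).
     if q = \<infinity> then esssup (lebesgue_on {0..1}) (\<lambda>x. ereal \<bar>f x\<bar>) < \<infinity>
     else integrable (lebesgue_on {0..1}) (\<lambda>x. \<bar>f x\<bar> powr enn2real q)}"

definition Lq_norm :: "ennreal \<Rightarrow> (real \<Rightarrow> real) \<Rightarrow> real" where
  "Lq_norm q f =
     (if q = \<infinity> then real_of_ereal (esssup (lebesgue_on {0..1}) (\<lambda>x. ereal \<bar>f x\<bar>))
      else (LINT x|lebesgue_on {0..1}. \<bar>f x\<bar> powr enn2real q) powr (1 / enn2real q))"

definition closed_subspace_Lq :: "ennreal \<Rightarrow> (real \<Rightarrow> real) set \<Rightarrow> bool" where
  "closed_subspace_Lq q Y \<longleftrightarrow> subspace Y \<and> Y \<subseteq> Lq_space q \<and>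
     (\<forall>f \<in> Lq_space q. (\<forall>e>0. \<exists>g \<in> Y. Lq_norm q (f - g) < e) \<longrightarrow> f \<in> Y)"

definition quotient_norm_Lq :: "ennreal \<Rightarrow> (real \<Rightarrow> real) set \<Rightarrow> (real \<Rightarrow> real) \<Rightarrow> real" where
  "quotient_norm_Lq q Y f = (INF g \<in> Y. Lq_norm q (f - g))"

text \<open>
  A linear isometry from \<open>L\<^sub>q / Y\<close> onto \<open>\<real>\<^sup>n\<close> with norm \<open>\<parallel>\<cdot>\<parallel>\<^sub>L\<close> is given by its composition \<open>\<pi>\<close> with the
  quotient map, a linear map on \<open>L\<^sub>q\<close> with kernel \<open>Y\<close> (extended linearly to all functions, which is
  always possible).
\<close>

definition QL :: "nat \<Rightarrow> ennreal \<Rightarrow> (nat \<Rightarrow> real) set set" where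
  "QL n q = {L. sym_convex_body n L \<and>
     (\<exists>Y \<pi>. closed_subspace_Lq q Y \<and> linear \<pi> \<and> \<pi> ` Lq_space q = Rn n \<and>
        {f \<in> Lq_space q. \<pi> f = 0} = Y \<and>
        (\<forall>f \<in> Lq_space q. body_norm L (\<pi> f) = quotient_norm_Lq q Y f))}"

definition p0 :: "nat \<Rightarrow> ennreal \<Rightarrow> real" where
  "p0 n p = enn2real (max 1 (min p (of_nat n)))"

end

theory Submission
  imports Defs
begin

text \<open>
  Since \<open>\<parallel>\<cdot>\<parallel>\<^sub>L\<close> is a quotient norm of \<open>L\<^sub>q\<close>, the support function of \<open>T L\<close> is, up to a constant, of the form
  \<open>h(x) = (\<Sum>\<^sub>j \<bar>\<langle>x, w\<^sub>j\<rangle>\<bar>\<^sup>p)\<^bsup>1/p\<^esup>\<close>; averaging over the sphere gives \<open>M\<^sub>p\<^sup>* (T L) \<ge> c (p\<^sub>0/n)\<^bsup>1/2\<^esup> (\<Sum>\<^sub>j \<bar>w\<^sub>j\<bar>\<^sup>p)\<^bsup>1/p\<^esup>\<close>.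
  On the other hand \<open>T\<close> is an orthogonal map \<open>V\<close> times a triangular map with positive diagonal of product \<open>1\<close>,
  so if \<open>s\<^sup>2\<close> is the common variance of the directions of \<open>K\<close>, then \<open>s\<^sup>2 n\<close> is at most the mean over \<open>K\<close> of
  \<open>\<langle>V x, T x\<rangle> \<le> h(V x)\<close>. Khinchine's inequality for convex bodies (Prekopa-Leindler and Borell) bounds this
  mean by \<open>C p s (\<Sum>\<^sub>j \<bar>w\<^sub>j\<bar>\<^sup>p)\<^bsup>1/p\<^esup>\<close>, which settles \<open>p < n\<close>. For \<open>p \<ge> n\<close> the mean \<open>M\<^sub>p\<^sup>*\<close> is comparable to the
  circumradius of \<open>T L\<close> and \<open>\<langle>V x, T x\<rangle> \<le> \<bar>x\<bar> \<bar>T x\<bar>\<close> suffices.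
\<close>

section \<open>The Prekopa-Leindler inequality on the line\<close>

text \<open>The factor \<open>sqrt (p0 n p)\<close> is a mismatch of growth rates. On a convex body
  linear functionals are only exponentially integrable and their p-th moments grow like p; on the
  sphere they are subgaussian and grow like sqrt p. Dividing s n <= C p W by M >= c sqrt(p/n) W,
  where W = (\<Sum> |w_j|^p)^(1/p), leaves s sqrt n <= C sqrt p M. Beyond p = n the sphere moments
  stop growing while the loss p does not, so the circumradius takes over there. Only the trace of
  V^t T counts, so a triangular factor with positive diagonal serves as well as the positive factor
  of a polar decomposition. The Jacobian of a linear map is the constant given by uniqueness of Haar
  measure; it is evaluated for triangular maps and similarities. \<open>haar_sphere\<close> offers
  invariance and no formula. Sphere moments are therefore averaged over the unit ball, where Fubini
  turns them into Lebesgue integrals that are bounded by shifting a large piece of the ball. The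
  dual of L_q is the wrong space at q = \<infinity>. Over a finite partition it is \<ell>_p for
  every q, which is why the support function is discretized, at the price of a constant.\<close>

lemma lborel_inner_compact:
  fixes A :: "real set"
  assumes A: "A \<in> sets borel" and c: "c < emeasure lborel A"
  obtains K where "compact K" "K \<subseteq> A" "c < emeasure lborel K"
proof -
  define S where "S m = A \<inter> {- real m..real m}" for m :: nat
  have S: "S m \<in> sets borel" for m using A by (simp add: S_def)
  have "incseq S" by (force simp: incseq_def S_def)
  have "(\<Union>m. S m) = A"
  proof -
    have "x \<in> (\<Union>m. S m)" if "x \<in> A" for x
    proof -
      obtain m :: nat where "\<bar>x\<bar> \<le> real m" using real_arch_simple by blast
      then show ?thesis using that by (auto simp: S_def intro!: exI[of _ m])
    qed
    then show ?thesis by (auto simp: S_def)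
  qed
  then have "(SUP m. emeasure lborel (S m)) = emeasure lborel A"
    using SUP_emeasure_incseq[of S lborel] S \<open>incseq S\<close> by (auto simp: image_subset_iff)
  then obtain m where m: "c < emeasure lborel (S m)"
    using c by (metis less_SUP_iff)
  have fin: "emeasure lborel (S m) < \<infinity>"
    by (rule le_less_trans[OF emeasure_mono[of _ "{- real m..real m}"]]) (auto simp: S_def)
  then have cfin: "c < \<infinity>" using m by (auto intro: less_trans)
  \<comment> \<open>The margin by which \<open>S m\<close> exceeds c: a closed subset that misses
    less than e still has measure above c.\<close>
  define e where "e = enn2real (emeasure lborel (S m) - c)"
  have sub: "emeasure lborel (S m) - c < \<infinity>" using fin
    by (metis diff_le_self_ennreal infinity_ennreal_def le_less_trans)
  have e: "ennreal e = emeasure lborel (S m) - c" unfolding e_def using sub by simp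
  have "e > 0" using m e
    by (metis diff_gt_0_iff_gt_ennreal ennreal_eq_0_iff not_less less_irrefl)
  obtain T where T: "closed T" "T \<subseteq> S m" "S m - T \<in> lmeasurable" "emeasure lebesgue (S m - T) < ennreal e"
    using sets_lebesgue_inner_closed[of "S m" e] S \<open>e > 0\<close> by auto
  have TB: "T \<in> sets borel" using T by auto
  have lt: "emeasure lborel (S m - T) < ennreal e" using T(4) S TB by simp
  have "compact T" using T(1,2) by (auto simp: compact_eq_bounded_closed S_def intro: bounded_subset[of "{- real m..real m}"])
  moreover have "c < emeasure lborel T"
  proof (rule ccontr)
    assume "\<not> ?thesis"
    then have le: "emeasure lborel T \<le> c" by simp
    have "emeasure lborel (S m) = emeasure lborel T + emeasure lborel (S m - T)"
      using plus_emeasure[of T lborel "S m - T"] TB S T(2) by (auto simp: Un_absorb1)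
    also have "\<dots> < c + ennreal e"
    proof -
      have "emeasure lborel T + emeasure lborel (S m - T) \<le> c + emeasure lborel (S m - T)"
        using le by (rule add_right_mono)
      also have "\<dots> < c + ennreal e" using lt cfin by (simp add: ennreal_add_left_cancel_less)
      finally show ?thesis .
    qed
    also have "\<dots> = emeasure lborel (S m)" unfolding e using diff_add_cancel_ennreal[of c "emeasure lborel (S m)"] m by (simp add: add.commute)
    finally show False by simp
  qed
  ultimately show ?thesis using that T(2) S_def by blast
qed

text \<open>The set is (A + b)/2, written as a preimage so that its measurability is
  immediate.\<close>

lemma emeasure_lborel_half_translate:
  fixes A :: "real set"
  assumes "A \<in> sets borel"
  shows "2 * emeasure lborel {z. 2 * z - b \<in> A} = emeasure lborel A"
proof -
  have "emeasure lborel A = (\<integral>\<^sup>+x. indicator A x \<partial>lborel)" using assms by simp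
  also have "\<dots> = \<bar>2\<bar> * (\<integral>\<^sup>+x. indicator A (-b + 2 * x) \<partial>lborel)"
    using nn_integral_real_affine[of "indicator A" 2 "-b"] assms by simp
  also have "(\<integral>\<^sup>+x. indicator A (-b + 2 * x) \<partial>lborel) = (\<integral>\<^sup>+x. indicator {z. 2 * z - b \<in> A} x \<partial>lborel)"
    by (intro nn_integral_cong) (auto simp: indicator_def)
  also have "\<dots> = emeasure lborel {z. 2 * z - b \<in> A}"
  proof (intro nn_integral_indicator)
    have "(\<lambda>z::real. 2 * z - b) -` A \<inter> space borel \<in> sets borel"
      using assms by (intro measurable_sets[where A=borel]) auto
    then show "{z. 2 * z - b \<in> A} \<in> sets lborel" by (simp add: vimage_def)
  qed
  finally show ?thesis by simp
qed

text \<open>With a the maximum of A and b the minimum of B, the sets (A + b)/2 and (a + B)/2 lie in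
  M and on opposite sides of (a + b)/2. Apart from that one point they are disjoint, so their
  measures add up.\<close>

lemma brunn_minkowski_1_compact:
  fixes A B M :: "real set"
  assumes "compact A" "compact B" "A \<noteq> {}" "B \<noteq> {}" and M: "M \<in> sets borel"
    and mid: "\<And>x y. x \<in> A \<Longrightarrow> y \<in> B \<Longrightarrow> (x + y) / 2 \<in> M"
  shows "emeasure lborel A + emeasure lborel B \<le> 2 * emeasure lborel M"
proof -
  obtain a where a: "a \<in> A" "\<And>x. x \<in> A \<Longrightarrow> x \<le> a" using compact_attains_sup[OF assms(1,3)] by blast
  obtain b where b: "b \<in> B" "\<And>x. x \<in> B \<Longrightarrow> b \<le> x" using compact_attains_inf[OF assms(2,4)] by blast
  have AB: "A \<in> sets borel" "B \<in> sets borel" using assms by (auto intro: borel_compact)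
  define A' where "A' = {z. 2 * z - b \<in> A}"
  define B' where "B' = {z. 2 * z - a \<in> B} - {(a+b)/2}"
  have mA: "A' \<in> sets borel"
  proof -
    have "(\<lambda>z::real. 2 * z - b) -` A \<inter> space borel \<in> sets borel"
      using AB by (intro measurable_sets[where A=borel]) auto
    then show ?thesis by (simp add: vimage_def A'_def)
  qed
  have mB0: "{z. 2 * z - a \<in> B} \<in> sets borel"
  proof -
    have "(\<lambda>z::real. 2 * z - a) -` B \<inter> space borel \<in> sets borel"
      using AB by (intro measurable_sets[where A=borel]) auto
    then show ?thesis by (simp add: vimage_def)
  qed
  have disj: "A' \<inter> B' = {}"
    using a b by (force simp: A'_def B'_def)
  have "z \<in> M" if "z \<in> A' \<union> B'" for z
    using that mid[of "2*z-b" b] mid[of a "2*z-a"] a b by (auto simp: A'_def B'_def)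
  then have sub: "A' \<union> B' \<subseteq> M" by blast
  have B'm: "emeasure lborel B' = emeasure lborel {z. 2 * z - a \<in> B}"
    unfolding B'_def using mB0 by (intro emeasure_Diff_null_set) auto
  have "emeasure lborel A + emeasure lborel B = 2 * (emeasure lborel A' + emeasure lborel B')"
    using emeasure_lborel_half_translate[OF AB(1), of b] emeasure_lborel_half_translate[OF AB(2), of a]
    unfolding B'm A'_def by (simp add: distrib_left)
  also have "emeasure lborel A' + emeasure lborel B' = emeasure lborel (A' \<union> B')"
    using plus_emeasure[of A' lborel B'] mA mB0 disj by (auto simp: B'_def)
  also have "2 * \<dots> \<le> 2 * emeasure lborel M"
    using sub M by (intro mult_left_mono emeasure_mono) auto
  finally show ?thesis .
qed

text \<open>The sum of two Borel sets need not be Borel, so the midpoints are only asked to lie in a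
  given Borel set M. Inner regularity is applied to A with a compact part of B fixed, and then to
  B.\<close>

lemma brunn_minkowski_1:
  fixes A B M :: "real set"
  assumes A: "A \<in> sets borel" "A \<noteq> {}" and B: "B \<in> sets borel" "B \<noteq> {}" and M: "M \<in> sets borel"
    and mid: "\<And>x y. x \<in> A \<Longrightarrow> y \<in> B \<Longrightarrow> (x + y) / 2 \<in> M"
  shows "emeasure lborel A + emeasure lborel B \<le> 2 * emeasure lborel M"
proof -
  have fin: "emeasure lborel K < \<infinity>" if "compact K" for K :: "real set"
    using emeasure_compact_finite[OF that] by simp
  have approx: "emeasure lborel A \<le> Z - W"
    if A: "A \<in> sets borel" "A \<noteq> {}" and W: "W < \<infinity>"
      and le: "\<And>K. compact K \<Longrightarrow> K \<subseteq> A \<Longrightarrow> K \<noteq> {} \<Longrightarrow> emeasure lborel K + W \<le> Z" for A :: "real set" and W Z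
  proof (rule dense_le)
    fix c assume "c < emeasure lborel A"
    then obtain K where K: "compact K" "K \<subseteq> A" "c < emeasure lborel K"
      using lborel_inner_compact[OF A(1)] by blast
    then have "K \<noteq> {}" by auto
    then have "emeasure lborel K \<le> Z - W" using le[OF K(1,2)] by (simp add: ennreal_le_minus_iff)
    then show "c \<le> Z - W" using K(3) by simp
  qed
  have cancel: "X + W \<le> Z" if "X \<le> Z - W" "W \<le> Z" for X W Z :: ennreal
    using add_right_mono[OF that(1), of W] diff_add_cancel_ennreal[OF that(2)] by simp
  have nonneg: "W \<le> Z" if A: "A \<noteq> {}"
      and le: "\<And>K. compact K \<Longrightarrow> K \<subseteq> A \<Longrightarrow> K \<noteq> {} \<Longrightarrow> emeasure lborel K + W \<le> Z" for A :: "real set" and W Z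
  proof -
    obtain a where "a \<in> A" using A by blast
    then show ?thesis using le[of "{a}"] by simp
  qed
  have 1: "emeasure lborel A + emeasure lborel L \<le> 2 * emeasure lborel M" if L: "compact L" "L \<subseteq> B" "L \<noteq> {}" for L
  proof -
    have *: "emeasure lborel K + emeasure lborel L \<le> 2 * emeasure lborel M" if "compact K" "K \<subseteq> A" "K \<noteq> {}" for K
      using that L mid by (intro brunn_minkowski_1_compact M) auto
    show ?thesis by (rule cancel[OF approx[OF A fin[OF L(1)]] nonneg[OF A(2)]]; rule *)
  qed
  \<comment> \<open>Taking a single point as the compact part of B shows that an infinite measure of
    A makes the right-hand side infinite. Otherwise it is finite and may be subtracted, as
    \<open>approx\<close> demands.\<close>
  have Afin: "emeasure lborel A < \<infinity> \<or> 2 * emeasure lborel M = \<infinity>"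
  proof -
    obtain b where "b \<in> B" using B by blast
    then show ?thesis using 1[of "{b}"] by (auto simp: top_unique less_top)
  qed
  show ?thesis
  proof (cases "2 * emeasure lborel M = \<infinity>")
    case False
    then have "emeasure lborel A < \<infinity>" using Afin by simp
    then have "emeasure lborel B + emeasure lborel A \<le> 2 * emeasure lborel M"
      using 1 by (intro cancel[OF approx[OF B] nonneg[OF B(2)]]) (simp_all add: add.commute)
    then show ?thesis by (simp add: add.commute)
  qed simp
qed

text \<open>Fubini for the region under the graph. The level sets are strict so that every level
  below the supremum is nonempty even when the supremum is not attained, as Brunn-Minkowski
  requires.\<close>

lemma layer_cake:
  fixes f :: "real \<Rightarrow> real"
  assumes f [measurable]: "f \<in> borel_measurable borel" and nn: "\<And>x. 0 \<le> f x"
  shows "(\<integral>\<^sup>+x. f x \<partial>lborel) = (\<integral>\<^sup>+t. emeasure lborel {x. t < f x} * indicator {0..} t \<partial>lborel)"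
proof -
  have "(\<integral>\<^sup>+x. f x \<partial>lborel) = (\<integral>\<^sup>+x. \<integral>\<^sup>+t. indicator {(x,t). 0 \<le> t \<and> t < f x} (x,t) \<partial>lborel \<partial>lborel)"
  proof (intro nn_integral_cong)
    fix x
    have "ennreal (f x) = emeasure lborel {0..<f x}" using nn[of x] by simp
    also have "\<dots> = (\<integral>\<^sup>+t. indicator {0..<f x} t \<partial>lborel)" by simp
    also have "\<dots> = (\<integral>\<^sup>+t. indicator {(x,t). 0 \<le> t \<and> t < f x} (x,t) \<partial>lborel)"
      by (intro nn_integral_cong) (auto simp: indicator_def)
    finally show "ennreal (f x) = \<dots>" .
  qed
  also have "\<dots> = (\<integral>\<^sup>+t. \<integral>\<^sup>+x. indicator {(x,t). 0 \<le> t \<and> t < f x} (x,t) \<partial>lborel \<partial>lborel)"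
  proof (rule lborel_pair.Fubini'[symmetric])
    have "{z \<in> space (borel \<Otimes>\<^sub>M borel). 0 \<le> snd z \<and> snd z < f (fst z)} \<in> sets (borel \<Otimes>\<^sub>M borel)"
      by measurable
    moreover have "{z \<in> space (borel \<Otimes>\<^sub>M borel). 0 \<le> snd z \<and> snd z < f (fst z)} = {(x,t). 0 \<le> t \<and> t < f x}"
      by (auto simp: space_pair_measure)
    ultimately have "{(x,t). 0 \<le> t \<and> t < f x} \<in> sets (borel \<Otimes>\<^sub>M borel)"
      by simp
    then show "(\<lambda>(x,t). indicator {(x,t). 0 \<le> t \<and> t < f x} (x,t)) \<in> borel_measurable (lborel \<Otimes>\<^sub>M lborel)"
      by (simp add: case_prod_beta)
  qed
  also have "\<dots> = (\<integral>\<^sup>+t. emeasure lborel {x. t < f x} * indicator {0..} t \<partial>lborel)"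
  proof (intro nn_integral_cong)
    fix t :: real
    have "(\<integral>\<^sup>+x. indicator {(x,t). 0 \<le> t \<and> t < f x} (x,t) \<partial>lborel) = (\<integral>\<^sup>+x. indicator {x. t < f x} x * indicator {0..} t \<partial>lborel)"
      by (intro nn_integral_cong) (auto simp: indicator_def)
    also have "\<dots> = (\<integral>\<^sup>+x. indicator {x. t < f x} x \<partial>lborel) * indicator {0..} t"
      by (intro nn_integral_multc) auto
    finally show "(\<integral>\<^sup>+x. indicator {(x,t). 0 \<le> t \<and> t < f x} (x,t) \<partial>lborel) = emeasure lborel {x. t < f x} * indicator {0..} t"
      by simp
  qed
  finally show ?thesis .
qed

text \<open>With both suprema equal to 1, the level sets of f and g are nonempty for the same t < 1,
  and Brunn-Minkowski applies level by level; from t = 1 on both are empty. Integration in t gives a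
  sum, which is stronger than the product.\<close>

lemma prekopa_leindler_1_normalized:
  fixes f g h :: "real \<Rightarrow> real"
  assumes f [measurable]: "f \<in> borel_measurable borel" and g [measurable]: "g \<in> borel_measurable borel"
    and h [measurable]: "h \<in> borel_measurable borel"
    and nn: "\<And>x. 0 \<le> f x" "\<And>x. 0 \<le> g x" "\<And>x. 0 \<le> h x"
    and le1: "\<And>x. f x \<le> 1" "\<And>x. g x \<le> 1"
    and sup: "\<And>t. t < 1 \<Longrightarrow> \<exists>x. t < f x" "\<And>t. t < 1 \<Longrightarrow> \<exists>x. t < g x"
    and mid: "\<And>x y. f x * g y \<le> (h ((x + y) / 2))\<^sup>2"
  shows "(\<integral>\<^sup>+x. f x \<partial>lborel) + (\<integral>\<^sup>+x. g x \<partial>lborel) \<le> 2 * (\<integral>\<^sup>+x. h x \<partial>lborel)"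
proof -
  have "(\<integral>\<^sup>+x. f x \<partial>lborel) + (\<integral>\<^sup>+x. g x \<partial>lborel)
     = (\<integral>\<^sup>+t. (emeasure lborel {x. t < f x} + emeasure lborel {x. t < g x}) * indicator {0..} t \<partial>lborel)"
    unfolding layer_cake[OF f nn(1)] layer_cake[OF g nn(2)] distrib_right
    by (rule nn_integral_add[symmetric]) measurable
  also have "\<dots> \<le> (\<integral>\<^sup>+t. 2 * (emeasure lborel {x. t < h x} * indicator {0..} t) \<partial>lborel)"
  proof (intro nn_integral_mono)
    fix t :: real
    show "(emeasure lborel {x. t < f x} + emeasure lborel {x. t < g x}) * indicator {0..} t
      \<le> 2 * (emeasure lborel {x. t < h x} * indicator {0..} t)"
    proof (cases "0 \<le> t \<and> t < 1")
      case True
      have "emeasure lborel {x. t < f x} + emeasure lborel {x. t < g x} \<le> 2 * emeasure lborel {x. t < h x}"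
      proof (rule brunn_minkowski_1)
        fix x y assume "x \<in> {x. t < f x}" "y \<in> {x. t < g x}"
        then have "t * t < f x * g y" using True by (intro mult_strict_mono) auto
        then have "t\<^sup>2 < (h ((x + y) / 2))\<^sup>2" using mid[of x y] by (simp add: power2_eq_square)
        then show "(x + y) / 2 \<in> {x. t < h x}" using power2_less_imp_less nn(3) by blast
      qed (use sup True in auto)
      then show ?thesis using True by simp
    next
      case False
      have "{x. t < f x} = {}" "{x. t < g x} = {}" if "t \<ge> 1"
        using that le1 by (force simp: not_less intro: order_trans)+
      then show ?thesis using False by (cases "t < 0") auto
    qed
  qed
  also have "\<dots> = 2 * (\<integral>\<^sup>+x. h x \<partial>lborel)"
    unfolding layer_cake[OF h nn(3)] by (rule nn_integral_cmult) measurable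
  finally show ?thesis .
qed

lemma ennreal_am_gm:
  fixes x y z :: ennreal
  assumes "x + y \<le> 2 * z" shows "x * y \<le> z\<^sup>2"
proof (cases "z = \<infinity>")
  case False
  then obtain c where c: "z = ennreal c" "c \<ge> 0" by (cases z) auto
  have "2 * z < \<infinity>" using c by (simp add: ennreal_mult_less_top)
  then have fin: "x + y < \<infinity>" using assms by (rule le_less_trans[rotated])
  then obtain a b where ab: "x = ennreal a" "y = ennreal b" "a \<ge> 0" "b \<ge> 0"
    by (cases x; cases y) auto
  have "x + y = ennreal (a + b)" "2 * z = ennreal (2 * c)" using ab c by (simp_all add: ennreal_mult')
  then have "a + b \<le> 2 * c" using assms c by (simp add: ennreal_le_iff)
  then have "(a + b)\<^sup>2 \<le> (2 * c)\<^sup>2" using ab by (intro power_mono) auto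
  then have "a * b \<le> c\<^sup>2" using sum_squares_bound[of a b] by (simp add: power2_sum power_mult_distrib)
  then show ?thesis using ab c by (simp add: ennreal_mult' [symmetric] ennreal_power ennreal_leI)
qed (simp add: power2_eq_square)

text \<open>f and g are divided by their suprema a and b, and h by sqrt (a b), which preserves the
  hypothesis. The arithmetic-geometric mean inequality turns the sum into a product, from which the
  scaling cancels.\<close>

lemma prekopa_leindler_1_bounded:
  fixes f g h :: "real \<Rightarrow> real"
  assumes f [measurable]: "f \<in> borel_measurable borel" and g [measurable]: "g \<in> borel_measurable borel"
    and h [measurable]: "h \<in> borel_measurable borel"
    and nn: "\<And>x. 0 \<le> f x" "\<And>x. 0 \<le> g x" "\<And>x. 0 \<le> h x"
    and bd: "\<And>x. f x \<le> m" "\<And>x. g x \<le> m"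
    and mid: "\<And>x y. f x * g y \<le> (h ((x + y) / 2))\<^sup>2"
  shows "(\<integral>\<^sup>+x. f x \<partial>lborel) * (\<integral>\<^sup>+x. g x \<partial>lborel) \<le> (\<integral>\<^sup>+x. h x \<partial>lborel)\<^sup>2"
proof (cases "(\<forall>x. f x = 0) \<or> (\<forall>x. g x = 0)")
  case True
  then show ?thesis by auto
next
  case False
  define a where "a = (SUP x. f x)"
  define b where "b = (SUP x. g x)"
  have bdd: "bdd_above (range f)" "bdd_above (range g)" using bd by (auto intro!: bdd_aboveI2[where M=m])
  have fa: "f x \<le> a" for x unfolding a_def by (intro cSUP_upper bdd) auto
  have gb: "g x \<le> b" for x unfolding b_def by (intro cSUP_upper bdd) auto
  have a: "a > 0" using False nn fa by (metis less_eq_real_def order_less_le_trans)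
  have b: "b > 0" using False nn gb by (metis less_eq_real_def order_less_le_trans)
  define c where "c = sqrt (a * b)"
  have c: "c > 0" "c\<^sup>2 = a * b" using a b by (auto simp: c_def)
  have "(\<integral>\<^sup>+x. (1/a) * f x \<partial>lborel) + (\<integral>\<^sup>+x. (1/b) * g x \<partial>lborel) \<le> 2 * (\<integral>\<^sup>+x. (1/c) * h x \<partial>lborel)"
  proof (rule prekopa_leindler_1_normalized)
    show "\<exists>x. t < (1/a) * f x" if "t < 1" for t
    proof -
      have "t * a < a" using that a by simp
      then obtain x where "t * a < f x" unfolding a_def using less_cSUP_iff[OF _ bdd(1)] by blast
      then show ?thesis using a by (auto simp: field_simps intro!: exI[of _ x])
    qed
    show "\<exists>x. t < (1/b) * g x" if "t < 1" for t
    proof -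
      have "t * b < b" using that b by simp
      then obtain x where "t * b < g x" unfolding b_def using less_cSUP_iff[OF _ bdd(2)] by blast
      then show ?thesis using b by (auto simp: field_simps intro!: exI[of _ x])
    qed
    show "(1/a) * f x * ((1/b) * g y) \<le> ((1/c) * h ((x + y) / 2))\<^sup>2" for x y
    proof -
      have "(1/a) * f x * ((1/b) * g y) = (f x * g y) / (a * b)" by simp
      also have "\<dots> \<le> (h ((x + y) / 2))\<^sup>2 / (a * b)" using mid a b by (intro divide_right_mono) auto
      finally show ?thesis using c by (simp add: power_divide)
    qed
  qed (use a b c nn fa gb in auto)
  then have "(\<integral>\<^sup>+x. (1/a) * f x \<partial>lborel) * (\<integral>\<^sup>+x. (1/b) * g x \<partial>lborel) \<le> (\<integral>\<^sup>+x. (1/c) * h x \<partial>lborel)\<^sup>2"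
    by (rule ennreal_am_gm)
  moreover have cm: "(\<integral>\<^sup>+x. r * u x \<partial>lborel) = ennreal r * (\<integral>\<^sup>+x. u x \<partial>lborel)"
    if "r > 0" "u \<in> borel_measurable borel" for r and u :: "real \<Rightarrow> real"
    using that by (simp add: ennreal_mult' nn_integral_cmult)
  ultimately have "ennreal (1/a) * (\<integral>\<^sup>+x. f x \<partial>lborel) * (ennreal (1/b) * (\<integral>\<^sup>+x. g x \<partial>lborel))
      \<le> (ennreal (1/c) * (\<integral>\<^sup>+x. h x \<partial>lborel))\<^sup>2"
    using a b c f g h by (simp only: cm zero_less_divide_1_iff)
  then have "ennreal (a * b) * (ennreal (1/a) * (\<integral>\<^sup>+x. f x \<partial>lborel) * (ennreal (1/b) * (\<integral>\<^sup>+x. g x \<partial>lborel)))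
      \<le> ennreal (a * b) * (ennreal (1/c) * (\<integral>\<^sup>+x. h x \<partial>lborel))\<^sup>2"
    by (intro mult_left_mono) auto
  moreover have "ennreal (a * b) * (ennreal (1/a) * F * (ennreal (1/b) * G)) = F * G" for F G
  proof -
    have "ennreal (a * b) * (ennreal (1/a) * F * (ennreal (1/b) * G)) = (ennreal (a*b) * ennreal (1/a) * ennreal (1/b)) * (F * G)"
      by (simp add: ac_simps)
    also have "ennreal (a*b) * ennreal (1/a) * ennreal (1/b) = 1"
      using a b by (simp add: ennreal_mult'[symmetric])
    finally show ?thesis by simp
  qed
  moreover have "ennreal (a * b) * (ennreal (1/c) * H)\<^sup>2 = H\<^sup>2" for H
  proof -
    have "ennreal (a * b) * (ennreal (1/c) * H)\<^sup>2 = (ennreal (c\<^sup>2) * (ennreal (1/c))\<^sup>2) * H\<^sup>2"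
      by (simp add: c(2) power_mult_distrib ac_simps)
    also have "ennreal (c\<^sup>2) * (ennreal (1/c))\<^sup>2 = 1"
      using c(1) by (simp add: ennreal_power ennreal_mult'[symmetric] power_divide)
    finally show ?thesis by simp
  qed
  ultimately show ?thesis by simp
qed

text \<open>Truncating all three functions at the same height m preserves the hypothesis, because
  the truncated product is also at most m^2. Monotone convergence removes the truncation.\<close>

lemma prekopa_leindler_1:
  fixes f g h :: "real \<Rightarrow> ennreal"
  assumes f [measurable]: "f \<in> borel_measurable borel" and g [measurable]: "g \<in> borel_measurable borel"
    and h [measurable]: "h \<in> borel_measurable borel"
    and mid: "\<And>x y. f x * g y \<le> (h ((x + y) / 2))\<^sup>2"
  shows "(\<integral>\<^sup>+x. f x \<partial>lborel) * (\<integral>\<^sup>+x. g x \<partial>lborel) \<le> (\<integral>\<^sup>+x. h x \<partial>lborel)\<^sup>2"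
proof -
  define tr where "tr m u x = min (u x) (of_nat m)" for m :: nat and u :: "real \<Rightarrow> ennreal" and x
  have trm [measurable]: "tr m u \<in> borel_measurable borel" if "u \<in> borel_measurable borel" for m u
    using that unfolding tr_def by measurable
  have fin: "tr m u x < \<infinity>" for m u x unfolding tr_def
    by (simp add: min_less_iff_disj of_nat_less_top)
  have E: "ennreal (enn2real (tr m u x)) = tr m u x" for m u x using fin[of m u x] by simp
  have step: "(\<integral>\<^sup>+x. tr m f x \<partial>lborel) * (\<integral>\<^sup>+x. tr m g x \<partial>lborel) \<le> (\<integral>\<^sup>+x. h x \<partial>lborel)\<^sup>2" for m
  proof -
    have "(\<integral>\<^sup>+x. ennreal (enn2real (tr m f x)) \<partial>lborel) * (\<integral>\<^sup>+x. ennreal (enn2real (tr m g x)) \<partial>lborel)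
      \<le> (\<integral>\<^sup>+x. ennreal (enn2real (tr m h x)) \<partial>lborel)\<^sup>2"
    proof (rule prekopa_leindler_1_bounded)
      show "enn2real (tr m f x) \<le> real m" for x
        using enn2real_mono[of "tr m f x" "of_nat m"] by (simp add: tr_def of_nat_less_top)
      show "enn2real (tr m g x) \<le> real m" for x
        using enn2real_mono[of "tr m g x" "of_nat m"] by (simp add: tr_def of_nat_less_top)
      fix x y
      have "tr m f x * tr m g y \<le> f x * g y" by (intro mult_mono) (auto simp: tr_def)
      then have 1: "tr m f x * tr m g y \<le> (h ((x + y) / 2))\<^sup>2" using mid[of x y] by (rule order_trans)
      have 2: "tr m f x * tr m g y \<le> (of_nat m)\<^sup>2" unfolding power2_eq_square
        by (intro mult_mono) (auto simp: tr_def)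
      have "tr m f x * tr m g y \<le> (tr m h ((x + y) / 2))\<^sup>2"
        using 1 2 by (auto simp: tr_def min_def)
      then have "enn2real (tr m f x * tr m g y) \<le> enn2real ((tr m h ((x + y) / 2))\<^sup>2)"
        by (intro enn2real_mono) (use fin[of m h "(x+y)/2"] in \<open>auto simp: power_less_top_ennreal\<close>)
      then show "enn2real (tr m f x) * enn2real (tr m g y) \<le> (enn2real (tr m h ((x + y) / 2)))\<^sup>2"
        by (simp add: enn2real_mult power2_eq_square)
    qed auto
    then have "(\<integral>\<^sup>+x. tr m f x \<partial>lborel) * (\<integral>\<^sup>+x. tr m g x \<partial>lborel) \<le> (\<integral>\<^sup>+x. tr m h x \<partial>lborel)\<^sup>2"
      by (simp only: E)
    also have "\<dots> \<le> (\<integral>\<^sup>+x. h x \<partial>lborel)\<^sup>2"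
      by (intro power_mono nn_integral_mono) (auto simp: tr_def)
    finally show ?thesis .
  qed
  have inc: "incseq (\<lambda>m x. tr m u x)" for u
    by (auto simp: incseq_def le_fun_def tr_def min_def intro: order_trans)
  have lim: "(SUP m. tr m u x) = u x" for u x
  proof (rule antisym)
    show "(SUP m. tr m u x) \<le> u x" by (rule SUP_least) (simp add: tr_def)
    show "u x \<le> (SUP m. tr m u x)"
    proof (cases "u x = \<infinity>")
      case True
      then have "tr m u x = of_nat m" for m by (simp add: tr_def)
      then show ?thesis by (simp add: ennreal_SUP_of_nat_eq_top)
    next
      case False
      then obtain m :: nat where "u x < of_nat m" using ennreal_Ex_less_of_nat[of "u x"] less_top by auto
      then have "tr m u x = u x" by (simp add: tr_def)
      then show ?thesis by (metis SUP_upper UNIV_I)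
    qed
  qed
  have S: "(SUP m. \<integral>\<^sup>+x. tr m u x \<partial>lborel) = (\<integral>\<^sup>+x. u x \<partial>lborel)" if "u \<in> borel_measurable borel" for u
    using nn_integral_monotone_convergence_SUP[OF inc[of u], of lborel] that trm by (simp add: lim)
  have mono: "(\<integral>\<^sup>+x. tr m u x \<partial>lborel) \<le> (\<integral>\<^sup>+x. tr m' u x \<partial>lborel)" if "m \<le> m'" for m m' u
    using inc[of u] that by (intro nn_integral_mono) (auto simp: incseq_def le_fun_def)
  \<comment> \<open>A product of two suprema ranges over independent levels m and k; both are
    dominated by their maximum.\<close>
  have all: "(\<integral>\<^sup>+x. tr m f x \<partial>lborel) * (\<integral>\<^sup>+x. tr k g x \<partial>lborel) \<le> (\<integral>\<^sup>+x. h x \<partial>lborel)\<^sup>2" for m k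
    by (rule order_trans[OF mult_mono step[of "max m k"]]) (auto intro: mono)
  show ?thesis
    unfolding S[OF f, symmetric] S[OF g, symmetric]
    by (simp add: SUP_mult_left_ennreal SUP_mult_right_ennreal) (intro SUP_least all)
qed

section \<open>Lebesgue measure on sequence space\<close>

lemma Rn_iff: "x \<in> Rn n \<longleftrightarrow> (\<forall>i\<ge>n. x i = 0)"
  by (simp add: Rn_def topspace_Euclidean_space)

lemma Rn_zero [simp]: "0 \<in> Rn n"
  by (simp add: Rn_iff)

lemma Rn_add [simp]: "x \<in> Rn n \<Longrightarrow> y \<in> Rn n \<Longrightarrow> x + y \<in> Rn n"
  by (simp add: Rn_iff)

lemma Rn_diff [simp]: "x \<in> Rn n \<Longrightarrow> y \<in> Rn n \<Longrightarrow> x - y \<in> Rn n"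
  by (simp add: Rn_iff)

lemma Rn_scaleR [simp]: "x \<in> Rn n \<Longrightarrow> c *\<^sub>R x \<in> Rn n"
  by (simp add: Rn_iff scaleR_fun_def)

lemma sum_fun_apply: "(\<Sum>i\<in>A. f i) x = (\<Sum>i\<in>A. f i x)"
  by (induction A rule: infinite_finite_induct) auto

lemma Rn_sum: "(\<And>i. i \<in> A \<Longrightarrow> f i \<in> Rn n) \<Longrightarrow> (\<Sum>i\<in>A. f i) \<in> Rn n"
  by (simp add: Rn_iff sum_fun_apply)

lemma Rn_borel [measurable]: "Rn n \<in> sets borel"
  using closedin_Euclidean_imp_closed[of n "Rn n"] by (simp add: Rn_def)

definition basis :: "nat \<Rightarrow> nat \<Rightarrow> real" where
  "basis i = (\<lambda>j. if j = i then 1 else 0)"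

lemma basis_Rn: "i < n \<Longrightarrow> basis i \<in> Rn n"
  by (auto simp: Rn_iff basis_def)

lemma basis_sum: "x \<in> Rn n \<Longrightarrow> (\<Sum>i<n. x i *\<^sub>R basis i) = x"
  by (rule ext) (auto simp: sum_fun_apply scaleR_fun_def basis_def Rn_iff if_distrib[of "(*) _"] not_less cong: if_cong)

lemma linear_eq_sum:
  assumes "linear T" "x \<in> Rn n" shows "T x = (\<Sum>i<n. x i *\<^sub>R T (basis i))"
  using linear_sum[OF assms(1), of "\<lambda>i. x i *\<^sub>R basis i" "{..<n}"] basis_sum[OF assms(2)]
  by (simp add: linear_scale[OF assms(1)])

lemma linear_apply:
  assumes "linear T" "x \<in> Rn n" shows "T x j = (\<Sum>i<n. x i * T (basis i) j)"
  by (subst linear_eq_sum[OF assms]) (simp add: sum_fun_apply scaleR_fun_def)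

lemma linear_sum_scaleR: "linear (\<lambda>x. \<Sum>i<n. (x i :: real) *\<^sub>R (a i :: nat \<Rightarrow> real))"
  by (rule linearI) (simp_all add: fun_eq_iff sum_fun_apply scaleR_fun_def distrib_right sum.distrib sum_distrib_left mult.assoc)

lemma space_leb [simp]: "space (leb n) = Rn n"
  by (simp add: leb_def space_restrict_space)

lemma sets_leb: "sets (leb n) = sets (restrict_space borel (Rn n))"
  by (simp add: leb_def)

lemma measurable_lebI:
  assumes "\<And>i. (\<lambda>z. g z i) \<in> borel_measurable M" "\<And>z. z \<in> space M \<Longrightarrow> g z \<in> Rn n"
  shows "g \<in> M \<rightarrow>\<^sub>M leb n"
proof -
  have "g \<in> borel_measurable M" by (rule measurable_coordinatewise_then_product) (rule assms(1))
  then have "g \<in> M \<rightarrow>\<^sub>M restrict_space borel (Rn n)" using assms(2) by (intro measurable_restrict_space2) auto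
  then show ?thesis using measurable_cong_sets[OF refl sets_leb] by blast
qed

lemma measurable_leb_borel: "f \<in> borel_measurable borel \<Longrightarrow> f \<in> borel_measurable (leb n)"
  using measurable_restrict_space1[of f borel borel "Rn n"] measurable_cong_sets[OF sets_leb refl, of n] by blast

lemma measurable_leb_coord [measurable]: "(\<lambda>x. x i) \<in> borel_measurable (leb n)"
  by (rule measurable_leb_borel) (rule measurable_product_coordinates)

lemma sets_lebI: "A \<in> sets borel \<Longrightarrow> A \<subseteq> Rn n \<Longrightarrow> A \<in> sets (leb n)"
  by (simp add: sets_leb sets_restrict_space_iff)

lemma product_sigma_finite_lborel: "product_sigma_finite (\<lambda>_. lborel :: real measure)"
  by standard

definition pad :: "nat \<Rightarrow> (nat \<Rightarrow> real) \<Rightarrow> nat \<Rightarrow> real" where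
  "pad n x = (\<lambda>i. if i < n then x i else 0)"

lemma pad_Rn [simp]: "pad n x \<in> Rn n"
  by (simp add: pad_def Rn_iff)

lemma measurable_pad: "pad n \<in> (\<Pi>\<^sub>M i\<in>{..<n}. lborel) \<rightarrow>\<^sub>M leb n"
proof (rule measurable_lebI)
  show "(\<lambda>x. pad n x i) \<in> borel_measurable (\<Pi>\<^sub>M i\<in>{..<n}. lborel)" for i
    by (cases "i < n") (auto simp: pad_def intro: measurable_component_singleton[of i "{..<n}" "\<lambda>_. lborel", simplified])
qed simp

lemma leb_eq: "leb n = distr (\<Pi>\<^sub>M i\<in>{..<n}. lborel) (leb n) (pad n)"
  by (subst (1) leb_def, rule distr_cong) (auto simp: pad_def sets_leb)

lemma nn_integral_leb:
  assumes "f \<in> borel_measurable (leb n)"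
  shows "(\<integral>\<^sup>+x. f x \<partial>leb n) = (\<integral>\<^sup>+x. f (pad n x) \<partial>(\<Pi>\<^sub>M i\<in>{..<n}. lborel))"
  by (subst leb_eq, subst nn_integral_distr[OF measurable_pad]) (use assms in auto)

text \<open>The inner argument is a point update of a padded point, so that both the slicing in the
  induction on n and the row operations below are substitutions in a single real variable.\<close>

lemma nn_integral_leb_coord:
  assumes "f \<in> borel_measurable (leb n)" "k < n"
  shows "(\<integral>\<^sup>+x. f x \<partial>leb n) =
    (\<integral>\<^sup>+x. \<integral>\<^sup>+t. f ((pad n x)(k := t)) \<partial>lborel \<partial>(\<Pi>\<^sub>M i\<in>{..<n}-{k}. lborel))"
proof -
  interpret product_sigma_finite "\<lambda>_. lborel :: real measure" by (rule product_sigma_finite_lborel)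
  have I: "insert k ({..<n}-{k}) = {..<n}" using assms(2) by auto
  have m: "(\<lambda>x. f (pad n x)) \<in> borel_measurable (\<Pi>\<^sub>M i\<in>insert k ({..<n}-{k}). lborel)"
    unfolding I by (rule measurable_compose[OF measurable_pad assms(1)])
  have P: "pad n (x(k := t)) = (pad n x)(k := t)" for x t using assms(2) by (auto simp: pad_def)
  show ?thesis unfolding nn_integral_leb[OF assms(1)]
    using product_nn_integral_insert[OF _ _ m, unfolded I P] by simp
qed

lemma nn_integral_leb_0:
  assumes "f \<in> borel_measurable (leb 0)" shows "(\<integral>\<^sup>+x. f x \<partial>leb 0) = f 0"
proof -
  interpret product_sigma_finite "\<lambda>_. lborel :: real measure" by (rule product_sigma_finite_lborel)
  have "pad 0 x = 0" for x by (auto simp: pad_def)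
  then show ?thesis unfolding nn_integral_leb[OF assms] by (simp add: PiM_empty)
qed

lemma measurable_leb_update: "(\<lambda>(x, t). x(n := t)) \<in> leb n \<Otimes>\<^sub>M lborel \<rightarrow>\<^sub>M leb (Suc n)"
proof (rule measurable_lebI)
  fix i
  have "(\<lambda>z. (fst z) i) \<in> borel_measurable (leb n \<Otimes>\<^sub>M lborel)"
    by (rule measurable_compose[OF measurable_fst measurable_leb_coord])
  then show "(\<lambda>z. (case z of (x, t) \<Rightarrow> x(n := t)) i) \<in> borel_measurable (leb n \<Otimes>\<^sub>M lborel)"
    by (cases "i = n") (auto simp: case_prod_beta)
qed (auto simp: space_pair_measure Rn_iff)

lemma nn_integral_leb_Suc:
  assumes f: "f \<in> borel_measurable (leb (Suc n))"
  shows "(\<integral>\<^sup>+x. f x \<partial>leb (Suc n)) = (\<integral>\<^sup>+x. \<integral>\<^sup>+t. f (x(n := t)) \<partial>lborel \<partial>leb n)"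
    and "(\<lambda>x. \<integral>\<^sup>+t. f (x(n := t)) \<partial>lborel) \<in> borel_measurable (leb n)"
    and "x \<in> Rn n \<Longrightarrow> (\<lambda>t. f (x(n := t))) \<in> borel_measurable borel"
proof -
  have m: "(\<lambda>(x, t). f (x(n := t))) \<in> borel_measurable (leb n \<Otimes>\<^sub>M lborel)"
    using measurable_compose[OF measurable_leb_update f] by (simp add: case_prod_beta)
  then show m': "(\<lambda>x. \<integral>\<^sup>+t. f (x(n := t)) \<partial>lborel) \<in> borel_measurable (leb n)"
    by (intro lborel.borel_measurable_nn_integral) auto
  show "x \<in> Rn n \<Longrightarrow> (\<lambda>t. f (x(n := t))) \<in> borel_measurable borel"
    using measurable_Pair2[OF m, of x] by simp
  have I: "{..<Suc n} - {n} = {..<n}" by auto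
  have P: "(pad (Suc n) x)(n := t) = (pad n x)(n := t)" for x t by (auto simp: pad_def fun_eq_iff)
  show "(\<integral>\<^sup>+x. f x \<partial>leb (Suc n)) = (\<integral>\<^sup>+x. \<integral>\<^sup>+t. f (x(n := t)) \<partial>lborel \<partial>leb n)"
    unfolding nn_integral_leb[OF m'] using nn_integral_leb_coord[OF f, of n] by (simp add: I P)
qed

text \<open>Induction on the dimension: by the one-dimensional inequality, integrating out the last
  coordinate yields slice integrals that satisfy the hypothesis again.\<close>

theorem prekopa_leindler:
  assumes "f \<in> borel_measurable (leb n)" "g \<in> borel_measurable (leb n)" "h \<in> borel_measurable (leb n)"
    and "\<And>x y. x \<in> Rn n \<Longrightarrow> y \<in> Rn n \<Longrightarrow> f x * g y \<le> (h (\<lambda>i. (x i + y i) / 2))\<^sup>2"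
  shows "(\<integral>\<^sup>+x. f x \<partial>leb n) * (\<integral>\<^sup>+x. g x \<partial>leb n) \<le> (\<integral>\<^sup>+x. h x \<partial>leb n)\<^sup>2"
  using assms
proof (induction n arbitrary: f g h)
  case 0
  have "(\<lambda>i. (0 i + 0 i) / 2) = (0 :: nat \<Rightarrow> real)" by auto
  then show ?case using 0(4)[of 0 0] by (simp only: nn_integral_leb_0[OF 0(1)] nn_integral_leb_0[OF 0(2)] nn_integral_leb_0[OF 0(3)] Rn_zero)
next
  case (Suc n)
  note S = nn_integral_leb_Suc[OF Suc.prems(1)] nn_integral_leb_Suc[OF Suc.prems(2)] nn_integral_leb_Suc[OF Suc.prems(3)]
  show ?case unfolding S(1) S(4) S(7)
  proof (rule Suc.IH[OF S(2) S(5) S(8)])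
    fix x y assume x: "x \<in> Rn n" "y \<in> Rn n"
    have mid: "(\<lambda>i. (x i + y i) / 2) \<in> Rn n" using x by (auto simp: Rn_iff)
    show "(\<integral>\<^sup>+t. f (x(n := t)) \<partial>lborel) * (\<integral>\<^sup>+t. g (y(n := t)) \<partial>lborel) \<le> (\<integral>\<^sup>+t. h ((\<lambda>i. (x i + y i) / 2)(n := t)) \<partial>lborel)\<^sup>2"
    proof (rule prekopa_leindler_1)
      show "f (x(n := s)) * g (y(n := t)) \<le> (h ((\<lambda>i. (x i + y i) / 2)(n := (s + t) / 2)))\<^sup>2" for s t
      proof -
        have "(\<lambda>i. ((x(n := s)) i + (y(n := t)) i) / 2) = (\<lambda>i. (x i + y i) / 2)(n := (s + t) / 2)" by auto
        moreover have "x(n := s) \<in> Rn (Suc n)" "y(n := t) \<in> Rn (Suc n)" using x by (auto simp: Rn_iff)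
        ultimately show ?thesis using Suc.prems(4)[of "x(n := s)" "y(n := t)"] by metis
      qed
    qed (rule S(3)[OF x(1)] S(6)[OF x(2)] S(9)[OF mid])+
  qed
qed

lemma box_sets: "{x \<in> Rn n. \<forall>i<n. a i \<le> x i \<and> x i \<le> b i} \<in> sets (leb n)"
proof -
  have "{x \<in> space (leb n). \<forall>i\<in>{..<n}. a i \<le> x i \<and> x i \<le> b i} \<in> sets (leb n)" by measurable
  moreover have "{x \<in> space (leb n). \<forall>i\<in>{..<n}. a i \<le> x i \<and> x i \<le> b i} = {x \<in> Rn n. \<forall>i<n. a i \<le> x i \<and> x i \<le> b i}"
    by auto
  ultimately show ?thesis by metis
qed

lemma emeasure_box:
  assumes "\<And>i. i < n \<Longrightarrow> a i \<le> b i"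
  shows "emeasure (leb n) {x \<in> Rn n. \<forall>i<n. a i \<le> x i \<and> x i \<le> b i} = (\<Prod>i<n. ennreal (b i - a i))"
proof -
  interpret product_sigma_finite "\<lambda>_. lborel :: real measure" by (rule product_sigma_finite_lborel)
  have "emeasure (leb n) {x \<in> Rn n. \<forall>i<n. a i \<le> x i \<and> x i \<le> b i}
    = emeasure (\<Pi>\<^sub>M i\<in>{..<n}. lborel) (pad n -` {x \<in> Rn n. \<forall>i<n. a i \<le> x i \<and> x i \<le> b i} \<inter> space (\<Pi>\<^sub>M i\<in>{..<n}. lborel))"
    by (subst leb_eq, rule emeasure_distr[OF measurable_pad box_sets])
  also have "pad n -` {x \<in> Rn n. \<forall>i<n. a i \<le> x i \<and> x i \<le> b i} \<inter> space (\<Pi>\<^sub>M i\<in>{..<n}. lborel) = Pi\<^sub>E {..<n} (\<lambda>i. {a i..b i})"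
    using pad_Rn by (auto simp: space_PiM PiE_iff pad_def)
  also have "emeasure (\<Pi>\<^sub>M i\<in>{..<n}. lborel) \<dots> = (\<Prod>i<n. ennreal (b i - a i))"
    using assms by (subst emeasure_PiM) auto
  finally show ?thesis .
qed

definition cube :: "nat \<Rightarrow> real \<Rightarrow> (nat \<Rightarrow> real) set" where
  "cube n r = {x \<in> Rn n. \<forall>i<n. - r \<le> x i \<and> x i \<le> r}"

lemma cube_sets [measurable]: "cube n r \<in> sets (leb n)"
  unfolding cube_def by (rule box_sets)

lemma emeasure_cube: "r \<ge> 0 \<Longrightarrow> emeasure (leb n) (cube n r) = ennreal ((2 * r) ^ n)"
  unfolding cube_def by (subst emeasure_box) (auto simp: ennreal_power)

lemma sigma_finite_leb: "sigma_finite_measure (leb n)"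
proof (rule sigma_finite_measure.intro, intro exI conjI)
  show "countable (range (\<lambda>m::nat. cube n (real m)))" by simp
  show "range (\<lambda>m::nat. cube n (real m)) \<subseteq> sets (leb n)" by auto
  show "\<forall>a\<in>range (\<lambda>m::nat. cube n (real m)). emeasure (leb n) a \<noteq> \<infinity>" by (auto simp: emeasure_cube)
  have "\<exists>m::nat. x \<in> cube n (real m)" if "x \<in> Rn n" for x
  proof -
    obtain m :: nat where "(\<Sum>i<n. \<bar>x i\<bar>) \<le> real m" using real_arch_simple by blast
    then have "\<bar>x i\<bar> \<le> real m" if "i < n" for i
      using member_le_sum[of i "{..<n}" "\<lambda>i. \<bar>x i\<bar>"] that by auto
    then show ?thesis using that by (force simp: cube_def abs_le_iff)
  qed
  then show "\<Union> (range (\<lambda>m::nat. cube n (real m))) = space (leb n)" by (auto simp: cube_def)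
qed

text \<open>With the other coordinates fixed \<phi> is a constant, so this is a real affine
  substitution in coordinate k alone. It is the elementary row operation behind every explicit
  Jacobian below.\<close>

lemma nn_integral_leb_row:
  assumes f: "f \<in> borel_measurable (leb n)" and k: "k < n" and c: "c \<noteq> 0"
    and \<phi>: "\<phi> \<in> borel_measurable (leb n)" and ind: "\<And>x t. \<phi> (x(k := t)) = \<phi> x"
  shows "ennreal \<bar>c\<bar> * (\<integral>\<^sup>+x. f (x(k := c * x k + \<phi> x)) \<partial>leb n) = (\<integral>\<^sup>+x. f x \<partial>leb n)"
    and "(\<lambda>x. x(k := c * x k + \<phi> x)) \<in> leb n \<rightarrow>\<^sub>M leb n"
proof -
  show m: "(\<lambda>x. x(k := c * x k + \<phi> x)) \<in> leb n \<rightarrow>\<^sub>M leb n"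
  proof (rule measurable_lebI)
    fix i show "(\<lambda>x. (x(k := c * x k + \<phi> x)) i) \<in> borel_measurable (leb n)"
      using \<phi> by (cases "i = k") auto
  qed (use k in \<open>auto simp: Rn_iff\<close>)
  have fm: "(\<lambda>x. f (x(k := c * x k + \<phi> x))) \<in> borel_measurable (leb n)"
    by (rule measurable_compose[OF m f])
  have "ennreal \<bar>c\<bar> * (\<integral>\<^sup>+x. f (x(k := c * x k + \<phi> x)) \<partial>leb n) = (\<integral>\<^sup>+x. ennreal \<bar>c\<bar> * f (x(k := c * x k + \<phi> x)) \<partial>leb n)"
    by (rule nn_integral_cmult[symmetric]) (rule fm)
  also have "\<dots> = (\<integral>\<^sup>+x. \<integral>\<^sup>+t. ennreal \<bar>c\<bar> * f ((pad n x)(k := c * t + \<phi> (pad n x))) \<partial>lborel \<partial>(\<Pi>\<^sub>M i\<in>{..<n}-{k}. lborel))"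
    using fm by (subst nn_integral_leb_coord[OF _ k]) (auto simp: ind)
  also have "\<dots> = (\<integral>\<^sup>+x. \<integral>\<^sup>+t. f ((pad n x)(k := t)) \<partial>lborel \<partial>(\<Pi>\<^sub>M i\<in>{..<n}-{k}. lborel))"
  proof (rule nn_integral_cong)
    fix x
    have u: "(\<lambda>t. (pad n x)(k := t)) \<in> borel \<rightarrow>\<^sub>M leb n"
    proof (rule measurable_lebI)
      fix i show "(\<lambda>z. ((pad n x)(k := z)) i) \<in> borel_measurable borel" by (cases "i = k") auto
    qed (use k in \<open>auto simp: Rn_iff pad_def\<close>)
    have g: "(\<lambda>t. f ((pad n x)(k := t))) \<in> borel_measurable borel" by (rule measurable_compose[OF u f])
    have g': "(\<lambda>t. f ((pad n x)(k := c * t + \<phi> (pad n x)))) \<in> borel_measurable borel"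
      by (rule measurable_compose[OF _ g, of "\<lambda>t. c * t + \<phi> (pad n x)"]) simp
    show "(\<integral>\<^sup>+t. ennreal \<bar>c\<bar> * f ((pad n x)(k := c * t + \<phi> (pad n x))) \<partial>lborel) = (\<integral>\<^sup>+t. f ((pad n x)(k := t)) \<partial>lborel)"
      using nn_integral_real_affine[OF g c, of "\<phi> (pad n x)"] g' by (simp add: nn_integral_cmult add.commute)
  qed
  also have "\<dots> = (\<integral>\<^sup>+x. f x \<partial>leb n)" by (rule nn_integral_leb_coord[OF f k, symmetric])
  finally show "ennreal \<bar>c\<bar> * (\<integral>\<^sup>+x. f (x(k := c * x k + \<phi> x)) \<partial>leb n) = (\<integral>\<^sup>+x. f x \<partial>leb n)" .
qed

text \<open>Upper triangular affine maps are the family for which Fubini alone gives the Jacobian.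
  Translations, homotheties and point reflections are the scalar case; the triangular factor of a
  member of \<open>SL\<close> is the general one.\<close>

definition tri_map :: "nat \<Rightarrow> (nat \<Rightarrow> nat \<Rightarrow> real) \<Rightarrow> (nat \<Rightarrow> real) \<Rightarrow> (nat \<Rightarrow> real) \<Rightarrow> nat \<Rightarrow> real" where
  "tri_map n u b x = (\<lambda>j. if j < n then (\<Sum>i\<in>{j..<n}. u j i * x i) + b j else 0)"

text \<open>The rows are replaced one at a time, from the top: row \<open>k\<close> reads only the coordinates that are
  still unchanged.\<close>

lemma nn_integral_leb_tri:
  assumes f: "f \<in> borel_measurable (leb n)" and u: "\<And>j. j < n \<Longrightarrow> u j j \<noteq> 0"
  shows "(\<Prod>j<n. ennreal \<bar>u j j\<bar>) * (\<integral>\<^sup>+x. f (tri_map n u b x) \<partial>leb n) = (\<integral>\<^sup>+x. f x \<partial>leb n)"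
proof -
  define S where "S k x = (\<lambda>j. if j < k then (\<Sum>i\<in>{j..<n}. u j i * x i) + b j else x j)" for k and x :: "nat \<Rightarrow> real"
  have "(\<Prod>j<k. ennreal \<bar>u j j\<bar>) * (\<integral>\<^sup>+x. f (S k x) \<partial>leb n) = (\<integral>\<^sup>+x. f x \<partial>leb n)"
    if "k \<le> n" "f \<in> borel_measurable (leb n)" for k and f :: "(nat \<Rightarrow> real) \<Rightarrow> ennreal"
    using that
  proof (induction k arbitrary: f)
    case 0
    have "S 0 x = x" for x by (simp add: S_def)
    then show ?case by simp
  next
    case (Suc k)
    define \<phi> where "\<phi> x = (\<Sum>i\<in>{Suc k..<n}. u k i * x i) + b k" for x :: "nat \<Rightarrow> real"
    have \<phi>: "\<phi> \<in> borel_measurable (leb n)" unfolding \<phi>_def by measurable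
    have ind: "\<phi> (x(k := t)) = \<phi> x" for x t unfolding \<phi>_def by (auto intro!: sum.cong)
    have k: "k < n" "u k k \<noteq> 0" using Suc.prems u by auto
    note row = nn_integral_leb_row[OF Suc.prems(2) k(1,2) \<phi> ind]
    have m: "(\<lambda>x. f (x(k := u k k * x k + \<phi> x))) \<in> borel_measurable (leb n)"
      by (rule measurable_compose[OF row(2) Suc.prems(2)])
    have e: "(S k x)(k := u k k * S k x k + \<phi> (S k x)) = S (Suc k) x" for x
    proof -
      have "\<phi> (S k x) = (\<Sum>i\<in>{Suc k..<n}. u k i * x i) + b k" unfolding \<phi>_def by (auto simp: S_def intro!: sum.cong)
      moreover have "(\<Sum>i\<in>{k..<n}. u k i * x i) = u k k * x k + (\<Sum>i\<in>{Suc k..<n}. u k i * x i)"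
        using k by (simp add: sum.atLeast_Suc_lessThan)
      ultimately show ?thesis by (auto simp: S_def fun_eq_iff less_Suc_eq)
    qed
    have "(\<integral>\<^sup>+x. f x \<partial>leb n) = ennreal \<bar>u k k\<bar> * ((\<Prod>j<k. ennreal \<bar>u j j\<bar>) * (\<integral>\<^sup>+x. f ((S k x)(k := u k k * S k x k + \<phi> (S k x))) \<partial>leb n))"
    proof -
      have "(\<Prod>j<k. ennreal \<bar>u j j\<bar>) * (\<integral>\<^sup>+x. f ((S k x)(k := u k k * S k x k + \<phi> (S k x))) \<partial>leb n) = (\<integral>\<^sup>+x. f (x(k := u k k * x k + \<phi> x)) \<partial>leb n)"
        by (rule Suc.IH[OF _ m]) (use k in linarith)
      then show ?thesis using row(1) by metis
    qed
    then show ?case unfolding e by (simp add: ac_simps)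
  qed
  from this[OF order_refl f] have *: "(\<Prod>j<n. ennreal \<bar>u j j\<bar>) * (\<integral>\<^sup>+x. f (S n x) \<partial>leb n) = (\<integral>\<^sup>+x. f x \<partial>leb n)" .
  have "(\<integral>\<^sup>+x. f (S n x) \<partial>leb n) = (\<integral>\<^sup>+x. f (tri_map n u b x) \<partial>leb n)"
  proof (intro nn_integral_cong)
    fix x assume "x \<in> space (leb n)"
    then have "S n x = tri_map n u b x" by (auto simp: S_def tri_map_def Rn_iff fun_eq_iff)
    then show "f (S n x) = f (tri_map n u b x)" by simp
  qed
  then show ?thesis using * by simp
qed

lemma tri_map_scaled_identity:
  assumes "x \<in> Rn n" "a \<in> Rn n"
  shows "tri_map n (\<lambda>j i. if i = j then c else 0) a x = c *\<^sub>R x + a"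
proof
  fix j
  show "tri_map n (\<lambda>j i. if i = j then c else 0) a x j = (c *\<^sub>R x + a) j"
  proof (cases "j < n")
    case True
    have "(\<Sum>i\<in>{j..<n}. (if i = j then c else 0) * x i) = (\<Sum>i\<in>{j..<n}. if i = j then c * x i else 0)"
      by (intro sum.cong) auto
    then show ?thesis using True by (simp add: tri_map_def scaleR_fun_def)
  next
    case False then show ?thesis using assms by (simp add: tri_map_def scaleR_fun_def Rn_iff)
  qed
qed

lemma nn_integral_leb_affine:
  assumes f: "f \<in> borel_measurable (leb n)" and c: "c \<noteq> 0" and a: "a \<in> Rn n"
  shows "ennreal (\<bar>c\<bar> ^ n) * (\<integral>\<^sup>+x. f (c *\<^sub>R x + a) \<partial>leb n) = (\<integral>\<^sup>+x. f x \<partial>leb n)"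
proof -
  have "(\<integral>\<^sup>+x. f (c *\<^sub>R x + a) \<partial>leb n) = (\<integral>\<^sup>+x. f (tri_map n (\<lambda>j i. if i = j then c else 0) a x) \<partial>leb n)"
    by (intro nn_integral_cong) (simp add: tri_map_scaled_identity a)
  then show ?thesis
    using nn_integral_leb_tri[OF f, of "\<lambda>j i. if i = j then c else 0" a] c by (simp add: ennreal_power)
qed

lemma nn_integral_leb_translate:
  assumes f: "f \<in> borel_measurable (leb n)" and a: "a \<in> Rn n"
  shows "(\<integral>\<^sup>+x. f (x + a) \<partial>leb n) = (\<integral>\<^sup>+x. f x \<partial>leb n)"
  using nn_integral_leb_affine[OF f _ a, of 1] by simp

lemma nn_integral_leb_reflect:
  assumes f: "f \<in> borel_measurable (leb n)" and a: "a \<in> Rn n"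
  shows "(\<integral>\<^sup>+x. f (a - x) \<partial>leb n) = (\<integral>\<^sup>+x. f x \<partial>leb n)"
  using nn_integral_leb_affine[OF f _ a, of "-1"] by simp

section \<open>Invertible linear maps and their Jacobians\<close>

lemma GL_in_Rn: "T \<in> GL n \<Longrightarrow> x \<in> Rn n \<Longrightarrow> T x \<in> Rn n"
  by (auto simp: GL_def bij_betw_def)

text \<open>Members of \<open>GL\<close> are linear on all sequences but invertible only on
  \<open>Rn n\<close>. The inverse on \<open>Rn n\<close> therefore has to be extended, which is
  done linearly from its values at the basis vectors.\<close>

lemma GL_inverse:
  assumes "T \<in> GL n"
  obtains S where "S \<in> GL n" "\<And>x. x \<in> Rn n \<Longrightarrow> S (T x) = x" "\<And>x. x \<in> Rn n \<Longrightarrow> T (S x) = x"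
proof -
  have T: "linear T" "bij_betw T (Rn n) (Rn n)" using assms by (auto simp: GL_def)
  define V where "V = inv_into (Rn n) T"
  have V: "bij_betw V (Rn n) (Rn n)" unfolding V_def by (rule bij_betw_inv_into[OF T(2)])
  have VT: "V (T x) = x" "T (V x) = x" "V x \<in> Rn n" if "x \<in> Rn n" for x
    using that bij_betw_inv_into_left[OF T(2)] bij_betw_inv_into_right[OF T(2)] bij_betwE[OF V] unfolding V_def
    by auto
  define S where "S x = (\<Sum>i<n. x i *\<^sub>R V (basis i))" for x
  have "linear S" unfolding S_def by (rule linear_sum_scaleR)
  have SV: "S x = V x" if "x \<in> Rn n" for x
  proof -
    have S: "S x \<in> Rn n" unfolding S_def by (intro Rn_sum Rn_scaleR VT basis_Rn) auto
    have "T (S x) = (\<Sum>i<n. x i *\<^sub>R T (V (basis i)))"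
      unfolding S_def by (simp add: linear_sum[OF T(1)] linear_scale[OF T(1)])
    also have "\<dots> = (\<Sum>i<n. x i *\<^sub>R basis i)" using VT basis_Rn by (intro sum.cong) auto
    finally have "T (S x) = x" using basis_sum[OF that] by simp
    then show ?thesis using VT(1)[OF S] by simp
  qed
  then have "bij_betw S (Rn n) (Rn n)" using V bij_betw_cong[of "Rn n" S V] by blast
  then have SG: "S \<in> GL n" using \<open>linear S\<close> by (simp add: GL_def)
  show ?thesis
  proof (rule that[OF SG])
    fix x assume x: "x \<in> Rn n"
    show "S (T x) = x" using SV[OF GL_in_Rn[OF assms x]] VT(1)[OF x] by simp
    show "T (S x) = x" using SV[OF x] VT(2)[OF x] by simp
  qed
qed

lemma linear_measurable_leb:
  assumes "linear T" "\<And>x. x \<in> Rn n \<Longrightarrow> T x \<in> Rn n" shows "T \<in> leb n \<rightarrow>\<^sub>M leb n"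
proof (rule measurable_lebI)
  fix j
  have "(\<lambda>x. \<Sum>i<n. x i * T (basis i) j) \<in> borel_measurable (leb n)" by measurable
  moreover have "(\<lambda>x. T x j) \<in> borel_measurable (leb n) \<longleftrightarrow> (\<lambda>x. \<Sum>i<n. x i * T (basis i) j) \<in> borel_measurable (leb n)"
    by (rule measurable_cong) (simp add: linear_apply[OF assms(1)])
  ultimately show "(\<lambda>x. T x j) \<in> borel_measurable (leb n)" by blast
qed (use assms in auto)

lemma GL_measurable: "T \<in> GL n \<Longrightarrow> T \<in> leb n \<rightarrow>\<^sub>M leb n"
  by (rule linear_measurable_leb) (auto simp: GL_def bij_betw_def)

lemma GL_image_sets:
  assumes "T \<in> GL n" "A \<in> sets (leb n)" shows "T ` A \<in> sets (leb n)"
proof -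
  obtain S where S: "S \<in> GL n" "\<And>x. x \<in> Rn n \<Longrightarrow> S (T x) = x" "\<And>x. x \<in> Rn n \<Longrightarrow> T (S x) = x"
    using GL_inverse[OF assms(1)] by blast
  have "A \<subseteq> Rn n" using sets.sets_into_space[OF assms(2)] by simp
  then have "T ` A = S -` A \<inter> space (leb n)"
    using S GL_in_Rn[OF assms(1)] by (force simp: image_iff)
  then show ?thesis using measurable_sets[OF GL_measurable[OF S(1)] assms(2)] by simp
qed

lemma emeasure_unit_cube:
  "emeasure (leb n) (cube n (1/2)) = 1"
  by (simp add: emeasure_cube)

text \<open>Uniqueness of Haar measure: for a translation invariant functional \<open>N\<close> (here \<open>N f = \<integral> f \<circ> T\<close>) Fubini gives
  \<open>N f \<cdot> \<integral> g = N g \<cdot> \<integral> f\<close>.\<close>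

lemma nn_integral_linear_swap:
  assumes T: "T \<in> GL n" and f [measurable]: "f \<in> borel_measurable (leb n)" and g [measurable]: "g \<in> borel_measurable (leb n)"
  shows "(\<integral>\<^sup>+x. f (T x) \<partial>leb n) * (\<integral>\<^sup>+x. g x \<partial>leb n) = (\<integral>\<^sup>+x. g (T x) \<partial>leb n) * (\<integral>\<^sup>+x. f x \<partial>leb n)"
proof -
  interpret sigma_finite_measure "leb n" by (rule sigma_finite_leb)
  interpret pair_sigma_finite "leb n" "leb n" ..
  have Tm [measurable]: "T \<in> leb n \<rightarrow>\<^sub>M leb n" by (rule GL_measurable[OF T])
  obtain S where S: "S \<in> GL n" "\<And>x. x \<in> Rn n \<Longrightarrow> T (S x) = x" using GL_inverse[OF T] by metis
  have Tadd: "T (x + y) = T x + T y" for x y using T by (simp add: GL_def linear_add)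
  have TR: "T x \<in> Rn n" if "x \<in> Rn n" for x using GL_in_Rn[OF T that] .
  have coord [measurable]: "(\<lambda>z. fst z i) \<in> borel_measurable (leb n \<Otimes>\<^sub>M leb n)" "(\<lambda>z. snd z i) \<in> borel_measurable (leb n \<Otimes>\<^sub>M leb n)"
      "(\<lambda>z. T (fst z) i) \<in> borel_measurable (leb n \<Otimes>\<^sub>M leb n)" "(\<lambda>x. T x i) \<in> borel_measurable (leb n)" for i
    by (rule measurable_compose[OF _ measurable_leb_coord], measurable)+
  have p: "(\<lambda>z. snd z + T (fst z)) \<in> leb n \<Otimes>\<^sub>M leb n \<rightarrow>\<^sub>M leb n"
  proof (rule measurable_lebI)
    show "(\<lambda>z. (snd z + T (fst z)) i) \<in> borel_measurable (leb n \<Otimes>\<^sub>M leb n)" for i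
      unfolding plus_fun_apply by measurable
  qed (auto simp: space_pair_measure TR)
  have mn: "(\<lambda>z. T (fst z) - snd z) \<in> leb n \<Otimes>\<^sub>M leb n \<rightarrow>\<^sub>M leb n"
  proof (rule measurable_lebI)
    show "(\<lambda>z. (T (fst z) - snd z) i) \<in> borel_measurable (leb n \<Otimes>\<^sub>M leb n)" for i
      unfolding fun_diff_def by measurable
  qed (auto simp: space_pair_measure TR)
  have tp: "(\<lambda>y. y + a) \<in> leb n \<rightarrow>\<^sub>M leb n" if "a \<in> Rn n" for a
  proof (rule measurable_lebI)
    show "(\<lambda>z. (z + a) i) \<in> borel_measurable (leb n)" for i unfolding plus_fun_apply by measurable
  qed (use that in auto)
  have tm: "(\<lambda>y. a - y) \<in> leb n \<rightarrow>\<^sub>M leb n" if "a \<in> Rn n" for a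
  proof (rule measurable_lebI)
    show "(\<lambda>z. (a - z) i) \<in> borel_measurable (leb n)" for i unfolding fun_diff_def by measurable
  qed (use that in auto)
  have Tf: "(\<lambda>x. f (T x)) \<in> borel_measurable (leb n)" "(\<lambda>x. g (T x)) \<in> borel_measurable (leb n)" by measurable
  have Tf2: "(\<lambda>z. f (T (fst z))) \<in> borel_measurable (leb n \<Otimes>\<^sub>M leb n)" "(\<lambda>z. g (T (fst z))) \<in> borel_measurable (leb n \<Otimes>\<^sub>M leb n)" by measurable
  have m1: "(\<lambda>(x, y). f (T x) * g (y + T x)) \<in> borel_measurable (leb n \<Otimes>\<^sub>M leb n)"
    unfolding case_prod_beta by (intro borel_measurable_times_ennreal Tf2 measurable_compose[OF p g])
  have m2: "(\<lambda>(x, y). f (T x - y) * g (T x)) \<in> borel_measurable (leb n \<Otimes>\<^sub>M leb n)"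
    unfolding case_prod_beta by (intro borel_measurable_times_ennreal Tf2 measurable_compose[OF mn f])
  have "(\<integral>\<^sup>+x. f (T x) \<partial>leb n) * (\<integral>\<^sup>+x. g x \<partial>leb n) = (\<integral>\<^sup>+x. f (T x) * (\<integral>\<^sup>+y. g y \<partial>leb n) \<partial>leb n)"
    by (rule nn_integral_multc[symmetric]) (rule Tf)
  also have "\<dots> = (\<integral>\<^sup>+x. \<integral>\<^sup>+y. f (T x) * g (y + T x) \<partial>leb n \<partial>leb n)"
  proof (rule nn_integral_cong)
    fix x assume "x \<in> space (leb n)"
    then have a: "T x \<in> Rn n" using TR by simp
    have "(\<integral>\<^sup>+y. f (T x) * g (y + T x) \<partial>leb n) = f (T x) * (\<integral>\<^sup>+y. g (y + T x) \<partial>leb n)"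
      by (intro nn_integral_cmult measurable_compose[OF tp[OF a] g])
    then show "f (T x) * (\<integral>\<^sup>+y. g y \<partial>leb n) = (\<integral>\<^sup>+y. f (T x) * g (y + T x) \<partial>leb n)"
      by (simp add: nn_integral_leb_translate[OF g a])
  qed
  also have "\<dots> = (\<integral>\<^sup>+y. \<integral>\<^sup>+x. f (T x) * g (y + T x) \<partial>leb n \<partial>leb n)"
    by (rule Fubini'[symmetric, OF m1])
  also have "\<dots> = (\<integral>\<^sup>+y. \<integral>\<^sup>+x. f (T x - y) * g (T x) \<partial>leb n \<partial>leb n)"
  proof (rule nn_integral_cong)
    fix y assume "y \<in> space (leb n)"
    then have y: "y \<in> Rn n" by simp
    \<comment> \<open>Replacing x by x + S y moves T x by y; this shifts the translation from g over
      to f.\<close>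
    then have a: "S y \<in> Rn n" using GL_in_Rn[OF S(1)] by simp
    have "(\<lambda>x. T x - y) \<in> leb n \<rightarrow>\<^sub>M leb n"
    proof (rule measurable_lebI)
      show "(\<lambda>z. (T z - y) i) \<in> borel_measurable (leb n)" for i unfolding fun_diff_def by measurable
    qed (use y TR in auto)
    then have "(\<lambda>x. f (T x - y) * g (T x)) \<in> borel_measurable (leb n)"
      by (intro borel_measurable_times_ennreal Tf measurable_compose[OF _ f])
    then have "(\<integral>\<^sup>+x. f (T (x + S y) - y) * g (T (x + S y)) \<partial>leb n) = (\<integral>\<^sup>+x. f (T x - y) * g (T x) \<partial>leb n)"
      by (rule nn_integral_leb_translate[OF _ a])
    then show "(\<integral>\<^sup>+x. f (T x) * g (y + T x) \<partial>leb n) = (\<integral>\<^sup>+x. f (T x - y) * g (T x) \<partial>leb n)"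
      by (simp add: Tadd S(2)[OF y] add.commute)
  qed
  also have "\<dots> = (\<integral>\<^sup>+x. \<integral>\<^sup>+y. f (T x - y) * g (T x) \<partial>leb n \<partial>leb n)"
    by (rule Fubini'[OF m2])
  also have "\<dots> = (\<integral>\<^sup>+x. g (T x) * (\<integral>\<^sup>+y. f y \<partial>leb n) \<partial>leb n)"
  proof (rule nn_integral_cong)
    fix x assume "x \<in> space (leb n)"
    then have a: "T x \<in> Rn n" using TR by simp
    have "(\<integral>\<^sup>+y. f (T x - y) * g (T x) \<partial>leb n) = (\<integral>\<^sup>+y. f (T x - y) \<partial>leb n) * g (T x)"
      by (intro nn_integral_multc measurable_compose[OF tm[OF a] f])
    then show "(\<integral>\<^sup>+y. f (T x - y) * g (T x) \<partial>leb n) = g (T x) * (\<integral>\<^sup>+y. f y \<partial>leb n)"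
      by (simp add: nn_integral_leb_reflect[OF f a] mult.commute)
  qed
  also have "\<dots> = (\<integral>\<^sup>+x. g (T x) \<partial>leb n) * (\<integral>\<^sup>+x. f x \<partial>leb n)"
    by (rule nn_integral_multc) (rule Tf)
  finally show ?thesis .
qed

text \<open>By the swap lemma f \<mapsto> \<integral> f (T x) is a multiple D of the Lebesgue
  integral, D being its value at the unit cube Q. Testing with T Q gives D |T Q| = 1, so D is
  neither 0 nor \<infinity>, and d = 1/D plays the part of |det T|.\<close>

lemma GL_change_of_variables:
  assumes T: "T \<in> GL n"
  obtains d where "d > 0" "\<And>f. f \<in> borel_measurable (leb n) \<Longrightarrow> (\<integral>\<^sup>+x. f x \<partial>leb n) = ennreal d * (\<integral>\<^sup>+x. f (T x) \<partial>leb n)"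
proof -
  define Q where "Q = cube n (1/2)"
  have Q: "Q \<in> sets (leb n)" "emeasure (leb n) Q = 1" "Q \<subseteq> Rn n"
    unfolding Q_def by (rule cube_sets, rule emeasure_unit_cube) (auto simp: cube_def)
  define D where "D = (\<integral>\<^sup>+x. indicator Q (T x) \<partial>leb n)"
  have N: "(\<integral>\<^sup>+x. f (T x) \<partial>leb n) = D * (\<integral>\<^sup>+x. f x \<partial>leb n)" if "f \<in> borel_measurable (leb n)" for f
    using nn_integral_linear_swap[OF T that, of "indicator Q"] Q by (simp add: D_def)
  have TQ: "T ` Q \<in> sets (leb n)" by (rule GL_image_sets[OF T Q(1)])
  have inj: "inj_on T (Rn n)" using T by (simp add: GL_def bij_betw_def)
  have "(\<integral>\<^sup>+x. indicator (T ` Q) (T x) \<partial>leb n) = (\<integral>\<^sup>+x. indicator Q x \<partial>leb n)"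
  proof (rule nn_integral_cong)
    fix x assume "x \<in> space (leb n)"
    then have "T x \<in> T ` Q \<longleftrightarrow> x \<in> Q" using inj_on_image_mem_iff[OF inj _ Q(3)] by simp
    then show "indicator (T ` Q) (T x) = (indicator Q x :: ennreal)" by (simp add: indicator_def)
  qed
  then have 1: "D * emeasure (leb n) (T ` Q) = 1" using N[of "indicator (T ` Q)"] TQ Q by simp
  then have "D \<noteq> 0" "D \<noteq> \<infinity>" by (auto simp: ennreal_top_mult split: if_splits)
  then obtain e where e: "D = ennreal e" "e > 0" by (cases D) (auto simp: ennreal_eq_0_iff less_le)
  show ?thesis
  proof (rule that[of "1/e"])
    fix f :: "(nat \<Rightarrow> real) \<Rightarrow> ennreal" assume f: "f \<in> borel_measurable (leb n)"
    have "ennreal (1/e) * (ennreal e * X) = X" for X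
      using e by (simp add: mult.assoc[symmetric] ennreal_mult'[symmetric])
    then show "(\<integral>\<^sup>+x. f x \<partial>leb n) = ennreal (1/e) * (\<integral>\<^sup>+x. f (T x) \<partial>leb n)" using N[OF f] e by simp
  qed (use e in simp)
qed

lemma emeasure_GL_image:
  assumes T: "T \<in> GL n" and d: "\<And>f. f \<in> borel_measurable (leb n) \<Longrightarrow> (\<integral>\<^sup>+x. f x \<partial>leb n) = ennreal d * (\<integral>\<^sup>+x. f (T x) \<partial>leb n)"
    and A: "A \<in> sets (leb n)"
  shows "emeasure (leb n) (T ` A) = ennreal d * emeasure (leb n) A"
proof -
  have TA: "T ` A \<in> sets (leb n)" by (rule GL_image_sets[OF T A])
  have inj: "inj_on T (Rn n)" using T by (simp add: GL_def bij_betw_def)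
  have A': "A \<subseteq> Rn n" using sets.sets_into_space[OF A] by simp
  have "(\<integral>\<^sup>+x. indicator (T ` A) (T x) \<partial>leb n) = (\<integral>\<^sup>+x. indicator A x \<partial>leb n)"
  proof (rule nn_integral_cong)
    fix x assume "x \<in> space (leb n)"
    then have "T x \<in> T ` A \<longleftrightarrow> x \<in> A" using inj_on_image_mem_iff[OF inj _ A'] by simp
    then show "indicator (T ` A) (T x) = (indicator A x :: ennreal)" by (simp add: indicator_def)
  qed
  then show ?thesis using d[of "indicator (T ` A)"] TA A by simp
qed

section \<open>Convex bodies and orthogonal maps\<close>

text \<open>Built on \<open>L2_set\<close> for the sake of its triangle and Cauchy-Schwarz
  inequalities. It reads only the first n coordinates, so it is a norm on \<open>Rn n\<close> and
  merely a seminorm beyond.\<close>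

definition enorm :: "nat \<Rightarrow> (nat \<Rightarrow> real) \<Rightarrow> real" where
  "enorm n x = L2_set x {..<n}"

lemma dot_commute: "dot n x y = dot n y x"
  by (simp add: dot_def mult.commute)

lemma dot_add_left: "dot n (x + y) z = dot n x z + dot n y z"
  by (simp add: dot_def distrib_right sum.distrib)

lemma dot_add_right: "dot n z (x + y) = dot n z x + dot n z y"
  by (simp add: dot_def distrib_left sum.distrib)

lemma dot_diff_left: "dot n (x - y) z = dot n x z - dot n y z"
  by (simp add: dot_def left_diff_distrib sum_subtractf)

lemma dot_diff_right: "dot n z (x - y) = dot n z x - dot n z y"
  by (simp add: dot_def right_diff_distrib sum_subtractf)

lemma dot_scaleR_left [simp]: "dot n (c *\<^sub>R x) y = c * dot n x y"
  by (simp add: dot_def scaleR_fun_def sum_distrib_left mult.assoc)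

lemma dot_scaleR_right [simp]: "dot n x (c *\<^sub>R y) = c * dot n x y"
  by (simp add: dot_def scaleR_fun_def sum_distrib_left ac_simps)

lemma dot_minus_left [simp]: "dot n (- x) y = - dot n x y"
  by (simp add: dot_def sum_negf)

lemma dot_minus_right [simp]: "dot n x (- y) = - dot n x y"
  by (simp add: dot_def sum_negf)

lemma dot_zero [simp]: "dot n 0 y = 0" "dot n x 0 = 0"
  by (simp_all add: dot_def)

lemma dot_sum_left: "dot n (\<Sum>i\<in>A. f i) y = (\<Sum>i\<in>A. dot n (f i) y)"
  unfolding dot_def sum_fun_apply sum_distrib_right by (rule sum.swap)

lemma dot_sum_right: "dot n y (\<Sum>i\<in>A. f i) = (\<Sum>i\<in>A. dot n y (f i))"
  unfolding dot_def sum_fun_apply sum_distrib_left by (rule sum.swap)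

lemma dot_basis_left: "i < n \<Longrightarrow> dot n (basis i) x = x i"
  by (simp add: dot_def basis_def if_distrib[of "\<lambda>c. c * _"] cong: if_cong)

lemma dot_basis_right: "i < n \<Longrightarrow> dot n x (basis i) = x i"
  by (simp add: dot_commute[of n x] dot_basis_left)

lemma enorm_nonneg [simp]: "0 \<le> enorm n x"
  by (simp add: enorm_def)

lemma dot_self: "dot n x x = (enorm n x)\<^sup>2"
  by (simp add: dot_def enorm_def L2_set_def power2_eq_square sum_nonneg)

lemma dot_self_nonneg [simp]: "0 \<le> dot n x x"
  by (simp add: dot_self)

lemma enorm_eq: "enorm n x = sqrt (dot n x x)"
  by (simp add: dot_self)

lemma dot_le: "\<bar>dot n x y\<bar> \<le> enorm n x * enorm n y"
proof -
  have "\<bar>dot n x y\<bar> \<le> (\<Sum>i<n. \<bar>x i\<bar> * \<bar>y i\<bar>)"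
    unfolding dot_def by (rule order_trans[OF sum_abs]) (simp add: abs_mult)
  also have "\<dots> \<le> enorm n x * enorm n y" unfolding enorm_def by (rule L2_set_mult_ineq)
  finally show ?thesis .
qed

lemma enorm_triangle: "enorm n (x + y) \<le> enorm n x + enorm n y"
  unfolding enorm_def using L2_set_triangle_ineq[of x y "{..<n}"] by (simp add: plus_fun_def)

lemma enorm_scaleR [simp]: "enorm n (c *\<^sub>R x) = \<bar>c\<bar> * enorm n x"
  by (simp add: enorm_eq real_sqrt_mult[symmetric] flip: mult.assoc) (simp add: real_sqrt_mult)

lemma enorm_minus [simp]: "enorm n (- x) = enorm n x"
  by (simp add: enorm_eq)

lemma enorm_zero [simp]: "enorm n 0 = 0"
  by (simp add: enorm_eq)

lemma enorm_eq_0: "x \<in> Rn n \<Longrightarrow> enorm n x = 0 \<longleftrightarrow> x = 0"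
  by (auto simp: enorm_def L2_set_eq_0_iff Rn_iff fun_eq_iff) (metis lessThan_iff not_less)

lemma abs_le_enorm: "i < n \<Longrightarrow> \<bar>x i\<bar> \<le> enorm n x"
  using dot_le[of n "basis i" x] by (simp add: dot_basis_left enorm_eq[of n "basis i"]) (simp add: basis_def)

lemma continuous_dot: "continuous_on A (\<lambda>x. dot n x y)"
  unfolding dot_def by (intro continuous_intros continuous_on_product_then_coordinatewise continuous_on_id)

lemma continuous_dot_self: "continuous_on A (\<lambda>x. dot n (x - a) (x - a))"
  unfolding dot_def fun_diff_def by (intro continuous_intros continuous_on_product_then_coordinatewise continuous_on_id)

lemma continuous_enorm: "continuous_on A (enorm n)"
proof -
  have "continuous_on A (\<lambda>x. sqrt (dot n (x - 0) (x - 0)))" by (intro continuous_intros continuous_dot_self)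
  then show ?thesis by (simp add: enorm_eq[abs_def])
qed

lemma borel_dot [measurable]: "(\<lambda>x. dot n x y) \<in> borel_measurable borel"
  by (rule borel_measurable_continuous_onI) (rule continuous_dot)

lemma borel_enorm [measurable]: "enorm n \<in> borel_measurable borel"
  by (rule borel_measurable_continuous_onI) (rule continuous_enorm)

lemma leb_dot [measurable]: "(\<lambda>x. dot m x y) \<in> borel_measurable (leb n)"
  by (rule measurable_leb_borel) simp

lemma leb_dot' [measurable]: "(\<lambda>x. dot m y x) \<in> borel_measurable (leb n)"
  by (subst dot_commute) simp

lemma leb_enorm [measurable]: "enorm m \<in> borel_measurable (leb n)"
  by (rule measurable_leb_borel) simp

lemma compactin_Euclidean_space: "compactin (Euclidean_space n) K \<longleftrightarrow> compact K \<and> K \<subseteq> Rn n"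
  by (auto simp: Rn_def topspace_Euclidean_space Euclidean_space_def compactin_subtopology euclidean_product_topology)

lemma openin_Euclidean_space: "openin (Euclidean_space n) U \<longleftrightarrow> (\<exists>V. open V \<and> U = V \<inter> Rn n)"
  by (simp add: Rn_def topspace_Euclidean_space Euclidean_space_def openin_subtopology euclidean_product_topology)

text \<open>A basic open set of the product topology restricts only finitely many coordinates, so
  the smallest of their radii serves for all.\<close>

lemma open_coordinate_box:
  fixes a :: "nat \<Rightarrow> real"
  assumes "open V" "a \<in> V"
  obtains r where "r > 0" "\<And>x. (\<And>i. \<bar>x i - a i\<bar> < r) \<Longrightarrow> x \<in> V"
proof -
  have "openin (product_topology (\<lambda>i. euclidean) UNIV) V"
    using assms(1) by (simp add: euclidean_product_topology)
  then obtain X where X: "a \<in> Pi\<^sub>E UNIV X" "\<And>i. open (X i)" "finite {i. X i \<noteq> UNIV}" "Pi\<^sub>E UNIV X \<subseteq> V"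
    using product_topology_open_contains_basis[of "\<lambda>i. euclidean" UNIV V a] assms(2) by auto
  have "\<forall>i. \<exists>e>0. \<forall>y. \<bar>y - a i\<bar> < e \<longrightarrow> y \<in> X i"
  proof
    fix i have "a i \<in> X i" using X(1) by (simp add: PiE_iff)
    then show "\<exists>e>0. \<forall>y. \<bar>y - a i\<bar> < e \<longrightarrow> y \<in> X i"
      using X(2)[of i] unfolding open_dist by (auto simp: dist_real_def)
  qed
  then obtain e where e: "\<And>i. e i > 0" "\<And>i y. \<bar>y - a i\<bar> < e i \<Longrightarrow> y \<in> X i" by metis
  define r where "r = Min (insert 1 (e ` {i. X i \<noteq> UNIV}))"
  have "r > 0" unfolding r_def using X(3) e(1) by (subst Min_gr_iff) auto
  moreover have "x \<in> V" if "\<And>i. \<bar>x i - a i\<bar> < r" for x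
  proof -
    have "x i \<in> X i" for i
    proof (cases "X i = UNIV")
      case False
      then have "r \<le> e i" unfolding r_def using X(3) by (intro Min_le) auto
      then show ?thesis using e(2)[of "x i" i] that[of i] by simp
    qed simp
    then show ?thesis using X(4) by (auto simp: PiE_iff)
  qed
  ultimately show ?thesis using that by blast
qed

text \<open>Around an interior point a there is a box inside K. For small x both a + x and -(a - x)
  lie in K, and their midpoint is x; thus symmetry and convexity move the ball to the origin, the
  form in which nonempty interior is used from here on.\<close>

lemma sym_convex_body_iff:
  "sym_convex_body n K \<longleftrightarrow> compact K \<and> K \<subseteq> Rn n \<and> convex K \<and> (\<forall>x\<in>K. - x \<in> K) \<and>
     (\<exists>r>0. \<forall>x\<in>Rn n. enorm n x \<le> r \<longrightarrow> x \<in> K)"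
proof
  assume *: "sym_convex_body n K"
  then have K: "compact K" "K \<subseteq> Rn n" "convex K" and int: "Euclidean_space n interior_of K \<noteq> {}" and sym: "uminus ` K = K"
    by (auto simp: sym_convex_body_def compactin_Euclidean_space)
  have sym': "- x \<in> K" if "x \<in> K" for x using sym that by force
  obtain a where a: "a \<in> Euclidean_space n interior_of K" using int by blast
  have "openin (Euclidean_space n) (Euclidean_space n interior_of K)" by simp
  then obtain V where V: "open V" "Euclidean_space n interior_of K = V \<inter> Rn n"
    unfolding openin_Euclidean_space by blast
  have VK: "V \<inter> Rn n \<subseteq> K" using V interior_of_subset by metis
  obtain r where r: "r > 0" "\<And>x. (\<And>i. \<bar>x i - a i\<bar> < r) \<Longrightarrow> x \<in> V"
    using open_coordinate_box[OF V(1), of a] a V(2) by blast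
  have aR: "a \<in> Rn n" using a V(2) by blast
  have "x \<in> K" if x: "x \<in> Rn n" "enorm n x \<le> r / 2" for x
  proof -
    have "\<bar>x i\<bar> < r" for i
      using abs_le_enorm[of i n x] x r(1) by (cases "i < n") (auto simp: Rn_iff)
    then have "a + x \<in> V" "a - x \<in> V" using r by auto
    then have "a + x \<in> K" "a - x \<in> K" using VK aR x by auto
    then have "a + x \<in> K" "x - a \<in> K" using sym'[of "a - x"] by auto
    then have "(1/2) *\<^sub>R (a + x) + (1/2) *\<^sub>R (x - a) \<in> K" using K(3) unfolding convex_def by simp
    moreover have "(1/2) *\<^sub>R (a + x) + (1/2) *\<^sub>R (x - a) = x" by (auto simp: scaleR_fun_def fun_eq_iff field_simps)
    ultimately show ?thesis by simp
  qed
  then have "\<exists>r>0. \<forall>x\<in>Rn n. enorm n x \<le> r \<longrightarrow> x \<in> K" using r(1) by (intro exI[of _ "r/2"]) auto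
  then show "compact K \<and> K \<subseteq> Rn n \<and> convex K \<and> (\<forall>x\<in>K. - x \<in> K) \<and> (\<exists>r>0. \<forall>x\<in>Rn n. enorm n x \<le> r \<longrightarrow> x \<in> K)"
    using K sym' by blast
next
  assume *: "compact K \<and> K \<subseteq> Rn n \<and> convex K \<and> (\<forall>x\<in>K. - x \<in> K) \<and> (\<exists>r>0. \<forall>x\<in>Rn n. enorm n x \<le> r \<longrightarrow> x \<in> K)"
  then obtain r where r: "r > 0" "\<And>x. x \<in> Rn n \<Longrightarrow> enorm n x \<le> r \<Longrightarrow> x \<in> K" by blast
  have "open {x. enorm n x < r}"
    by (intro open_Collect_less continuous_enorm continuous_on_const)
  then have "openin (Euclidean_space n) ({x. enorm n x < r} \<inter> Rn n)" unfolding openin_Euclidean_space by blast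
  then have "{x. enorm n x < r} \<inter> Rn n \<subseteq> Euclidean_space n interior_of K"
    using r by (intro interior_of_maximal) auto
  then have "Euclidean_space n interior_of K \<noteq> {}"
  proof -
    have "0 \<in> {x. enorm n x < r} \<inter> Rn n" using r(1) by simp
    then show ?thesis using \<open>_ \<subseteq> Euclidean_space n interior_of K\<close> by blast
  qed
  moreover have "uminus ` K = K"
  proof
    show "uminus ` K \<subseteq> K" using * by blast
    show "K \<subseteq> uminus ` K"
    proof
      fix x assume "x \<in> K"
      then show "x \<in> uminus ` K" using * by (intro image_eqI[of _ _ "- x"]) auto
    qed
  qed
  ultimately show "sym_convex_body n K" using * by (auto simp: sym_convex_body_def compactin_Euclidean_space)
qed

lemma body_bounded:
  assumes "sym_convex_body n K" obtains R where "R > 0" "\<And>x. x \<in> K \<Longrightarrow> enorm n x \<le> R"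
proof -
  have "compact (enorm n ` K)" using assms by (intro compact_continuous_image continuous_enorm) (simp add: sym_convex_body_iff)
  then have "bounded (enorm n ` K)" by (rule compact_imp_bounded)
  then obtain R where R: "\<forall>y\<in>enorm n ` K. norm y \<le> R" unfolding bounded_iff by blast
  show ?thesis
  proof (rule that[of "max 1 R"])
    show "enorm n x \<le> max 1 R" if "x \<in> K" for x using R that by (simp add: le_max_iff_disj)
  qed simp
qed

lemma body_sets: "sym_convex_body n K \<Longrightarrow> K \<in> sets (leb n)"
  by (rule sets_lebI) (auto simp: sym_convex_body_iff intro: borel_compact)

lemma bounded_emeasure_finite:
  assumes "A \<subseteq> Rn n" "\<And>x. x \<in> A \<Longrightarrow> enorm n x \<le> R" shows "emeasure (leb n) A < \<infinity>"
proof -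
  have "A \<subseteq> cube n \<bar>R\<bar>"
  proof
    fix x assume x: "x \<in> A"
    have "\<bar>x i\<bar> \<le> \<bar>R\<bar>" if "i < n" for i using abs_le_enorm[OF that, of x] assms(2)[OF x] by simp
    then show "x \<in> cube n \<bar>R\<bar>" using x assms(1) by (auto simp: cube_def abs_le_iff minus_le_iff)
  qed
  then have "emeasure (leb n) A \<le> emeasure (leb n) (cube n \<bar>R\<bar>)" by (intro emeasure_mono) auto
  also have "\<dots> < \<infinity>" by (simp add: emeasure_cube)
  finally show ?thesis .
qed

lemma body_emeasure_finite: "sym_convex_body n K \<Longrightarrow> emeasure (leb n) K < \<infinity>"
  by (rule body_bounded, assumption, rule bounded_emeasure_finite) (auto simp: sym_convex_body_iff)

lemma body_zero: "sym_convex_body n K \<Longrightarrow> 0 \<in> K"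
  unfolding sym_convex_body_iff by (metis Rn_zero enorm_zero less_imp_le)

lemma linear_enorm_bound:
  assumes "linear T" obtains C where "C > 0" "\<And>x. x \<in> Rn n \<Longrightarrow> enorm n (T x) \<le> C * enorm n x"
proof -
  define C where "C = (\<Sum>i<n. enorm n (T (basis i)))"
  have tri: "enorm n (\<Sum>i\<in>A. f i) \<le> (\<Sum>i\<in>A. enorm n (f i))" for f :: "nat \<Rightarrow> nat \<Rightarrow> real" and A
  proof (induction A rule: infinite_finite_induct)
    case (insert x F)
    have "enorm n (f x + sum f F) \<le> enorm n (f x) + (\<Sum>i\<in>F. enorm n (f i))"
      using enorm_triangle[of n "f x" "sum f F"] insert.IH by linarith
    then show ?case by (simp only: sum.insert[OF insert.hyps])
  qed (simp_all only: sum.infinite sum.empty enorm_zero order_refl not_False_eq_True)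
  have "enorm n (T x) \<le> C * enorm n x" if "x \<in> Rn n" for x
  proof -
    have "enorm n (T x) \<le> (\<Sum>i<n. \<bar>x i\<bar> * enorm n (T (basis i)))"
      unfolding linear_eq_sum[OF assms that] using tri[of "\<lambda>i. x i *\<^sub>R T (basis i)" "{..<n}"] by simp
    also have "\<dots> \<le> (\<Sum>i<n. enorm n x * enorm n (T (basis i)))"
      by (intro sum_mono mult_right_mono abs_le_enorm) auto
    finally show ?thesis by (simp add: C_def sum_distrib_left mult.commute)
  qed
  then show ?thesis using that[of "C + 1"]
    by (smt (verit) C_def enorm_nonneg mult_right_mono sum_nonneg)
qed

lemma linear_continuous_Rn:
  fixes T :: "(nat \<Rightarrow> real) \<Rightarrow> nat \<Rightarrow> real"
  assumes "linear T" "A \<subseteq> Rn n" shows "continuous_on A T"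
proof (rule continuous_on_coordinatewise_then_product)
  fix j
  have "continuous_on A (\<lambda>x. \<Sum>i<n. x i * T (basis i) j)"
    by (intro continuous_intros continuous_on_product_then_coordinatewise continuous_on_id)
  then show "continuous_on A (\<lambda>x. T x j)"
    by (rule continuous_on_eq) (use assms(2) in \<open>auto simp: linear_apply[OF assms(1), of _ n]\<close>)
qed

lemma body_GL_image:
  assumes K: "sym_convex_body n K" and T: "T \<in> GL n"
  shows "sym_convex_body n (T ` K)"
proof -
  have lin: "linear T" using T by (simp add: GL_def)
  obtain S where S: "S \<in> GL n" "\<And>x. x \<in> Rn n \<Longrightarrow> T (S x) = x" using GL_inverse[OF T] by metis
  have KR: "K \<subseteq> Rn n" using K by (simp add: sym_convex_body_iff)
  obtain C where C: "C > 0" "\<And>x. x \<in> Rn n \<Longrightarrow> enorm n (S x) \<le> C * enorm n x"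
    using linear_enorm_bound[of S n] S(1) by (auto simp: GL_def)
  obtain r where r: "r > 0" "\<And>x. x \<in> Rn n \<Longrightarrow> enorm n x \<le> r \<Longrightarrow> x \<in> K"
    using K unfolding sym_convex_body_iff by blast
  have "x \<in> T ` K" if "x \<in> Rn n" "enorm n x \<le> r / C" for x
  proof -
    have "C * enorm n x \<le> r" using that(2) C(1) by (simp add: field_simps)
    then have "S x \<in> K" using C(2)[OF that(1)] r(2)[OF GL_in_Rn[OF S(1) that(1)]] by simp
    then show ?thesis using S(2)[OF that(1)] by force
  qed
  then have "\<exists>r>0. \<forall>x\<in>Rn n. enorm n x \<le> r \<longrightarrow> x \<in> T ` K" using r(1) C(1) by (intro exI[of _ "r/C"]) auto
  moreover have "compact (T ` K)" using K linear_continuous_Rn[OF lin KR]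
    by (intro compact_continuous_image) (auto simp: sym_convex_body_iff)
  moreover have "T ` K \<subseteq> Rn n" using KR GL_in_Rn[OF T] by auto
  moreover have "convex (T ` K)" using K lin by (intro convex_linear_image) (auto simp: sym_convex_body_iff)
  moreover have "\<forall>x\<in>T ` K. - x \<in> T ` K"
  proof
    fix y assume "y \<in> T ` K"
    then obtain x where x: "x \<in> K" "y = T x" by blast
    have "- x \<in> K" using K x(1) by (simp add: sym_convex_body_iff)
    moreover have "- y = T (- x)" using linear_neg[OF lin, of x] x(2) by simp
    ultimately show "- y \<in> T ` K" by blast
  qed
  ultimately show ?thesis by (simp add: sym_convex_body_iff)
qed

section \<open>The unit ball, similarities and reflections\<close>

lemma unit_ball_iff: "unit_ball n = {x \<in> Rn n. enorm n x \<le> 1}"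
  by (auto simp: unit_ball_def dot_self abs_square_le_1)

lemma unit_sphere_iff: "unit_sphere n = {x \<in> Rn n. enorm n x = 1}"
  by (auto simp: unit_sphere_def dot_self abs_square_eq_1)

lemma basis_unit_sphere: "i < n \<Longrightarrow> basis i \<in> unit_sphere n"
  by (auto simp: unit_sphere_def basis_Rn dot_basis_left) (simp add: basis_def)

lemma unit_ball_sets [measurable]: "unit_ball n \<in> sets (leb n)"
proof -
  have "{x \<in> space (leb n). enorm n x \<le> 1} \<in> sets (leb n)" by measurable
  then show ?thesis by (simp add: unit_ball_iff)
qed

lemma emeasure_unit_ball_finite: "emeasure (leb n) (unit_ball n) < \<infinity>"
  by (rule bounded_emeasure_finite) (auto simp: unit_ball_iff)

text \<open>The inscribed cube has half side 1/sqrt n. This gives the n-th root of the volume its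
  true order 1/sqrt n.\<close>

lemma vol_unit_ball_ge:
  assumes "n \<ge> 1" shows "(2 / sqrt n) ^ n \<le> vol n (unit_ball n)"
proof -
  have "cube n (1 / sqrt n) \<subseteq> unit_ball n"
  proof
    fix x assume x: "x \<in> cube n (1 / sqrt n)"
    have "x i * x i \<le> 1 / n" if "i < n" for i
    proof -
      have "\<bar>x i\<bar> \<le> 1 / sqrt n" using x that by (auto simp: cube_def abs_le_iff)
      then have "\<bar>x i\<bar> * \<bar>x i\<bar> \<le> (1 / sqrt n) * (1 / sqrt n)" by (intro mult_mono) auto
      then show ?thesis by simp
    qed
    then have "dot n x x \<le> (\<Sum>i<n. 1 / n)" unfolding dot_def by (intro sum_mono) auto
    then show "x \<in> unit_ball n" using x assms by (simp add: unit_ball_def cube_def)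
  qed
  then have "emeasure (leb n) (cube n (1 / sqrt n)) \<le> emeasure (leb n) (unit_ball n)" by (intro emeasure_mono) auto
  then have "ennreal ((2 * (1 / sqrt n)) ^ n) \<le> emeasure (leb n) (unit_ball n)"
    using emeasure_cube[of "1 / sqrt n" n] by simp
  also have "\<dots> = ennreal (vol n (unit_ball n))" unfolding vol_def
    by (rule emeasure_eq_ennreal_measure) (use emeasure_unit_ball_finite[of n] in simp)
  finally show ?thesis by (simp add: vol_def)
qed

lemma vol_unit_ball_pos: "n \<ge> 1 \<Longrightarrow> vol n (unit_ball n) > 0"
  using vol_unit_ball_ge[of n] by (rule less_le_trans[rotated]) auto

lemma emeasure_unit_ball: "emeasure (leb n) (unit_ball n) = ennreal (vol n (unit_ball n))"
  unfolding vol_def by (rule emeasure_eq_ennreal_measure) (use emeasure_unit_ball_finite[of n] in simp)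

text \<open>Comparing the images of the unit ball determines the Jacobian of a similarity.\<close>

lemma similarity_jacobian:
  assumes n: "n \<ge> 1" and T: "T \<in> GL n" and \<rho>: "\<rho> > 0" "\<And>x. x \<in> Rn n \<Longrightarrow> enorm n (T x) = \<rho> * enorm n x"
    and d: "d > 0" "\<And>f. f \<in> borel_measurable (leb n) \<Longrightarrow> (\<integral>\<^sup>+x. f x \<partial>leb n) = ennreal d * (\<integral>\<^sup>+x. f (T x) \<partial>leb n)"
  shows "d = \<rho> ^ n"
proof -
  define D where "D = {x \<in> Rn n. enorm n x \<le> \<rho>}"
  have "{x \<in> space (leb n). enorm n x \<le> \<rho>} \<in> sets (leb n)" by measurable
  then have [measurable]: "D \<in> sets (leb n)" by (simp add: D_def)
  let ?w = "vol n (unit_ball n)"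
  have "(\<integral>\<^sup>+x. indicator D (T x) \<partial>leb n) = (\<integral>\<^sup>+x. indicator (unit_ball n) x \<partial>leb n)"
    using \<rho> GL_in_Rn[OF T] by (intro nn_integral_cong) (auto simp: D_def unit_ball_iff indicator_def)
  then have 1: "emeasure (leb n) D = ennreal d * ennreal ?w" using d(2)[of "indicator D"] by (simp add: emeasure_unit_ball)
  have "(\<integral>\<^sup>+x. indicator D (\<rho> *\<^sub>R x + 0) \<partial>leb n) = (\<integral>\<^sup>+x. indicator (unit_ball n) x \<partial>leb n)"
    using \<rho> by (intro nn_integral_cong) (auto simp: D_def unit_ball_iff indicator_def)
  then have 2: "emeasure (leb n) D = ennreal (\<rho> ^ n) * ennreal ?w"
    using nn_integral_leb_affine[of "indicator D" n \<rho> 0] \<rho>(1) by (simp add: emeasure_unit_ball)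
  have "ennreal (d * ?w) = ennreal (\<rho> ^ n * ?w)"
    using 1 2 d(1) \<rho>(1) vol_unit_ball_pos[OF n] by (simp add: ennreal_mult less_imp_le)
  then show ?thesis using d(1) \<rho>(1) vol_unit_ball_pos[OF n] by (simp add: less_imp_le)
qed

definition orthogonal_on :: "nat \<Rightarrow> ((nat \<Rightarrow> real) \<Rightarrow> nat \<Rightarrow> real) \<Rightarrow> bool" where
  "orthogonal_on n U \<longleftrightarrow> U \<in> GL n \<and> (\<forall>x\<in>Rn n. \<forall>y\<in>Rn n. dot n (U x) (U y) = dot n x y)"

lemma nn_integral_leb_orthogonal:
  assumes n: "n \<ge> 1" and U: "orthogonal_on n U" and f: "f \<in> borel_measurable (leb n)"
  shows "(\<integral>\<^sup>+x. f (U x) \<partial>leb n) = (\<integral>\<^sup>+x. f x \<partial>leb n)"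
proof -
  have G: "U \<in> GL n" and e: "\<And>x. x \<in> Rn n \<Longrightarrow> enorm n (U x) = 1 * enorm n x"
    using U by (auto simp: orthogonal_on_def enorm_eq)
  obtain d where d: "d > 0" "\<And>f. f \<in> borel_measurable (leb n) \<Longrightarrow> (\<integral>\<^sup>+x. f x \<partial>leb n) = ennreal d * (\<integral>\<^sup>+x. f (U x) \<partial>leb n)"
    using GL_change_of_variables[OF G] by metis
  have "d = 1" using similarity_jacobian[OF n G zero_less_one e d] by simp
  then show ?thesis using d(2)[OF f] by simp
qed

text \<open>The reflection in the hyperplane orthogonal to y - y'. That it is its own inverse
  matters on the sphere, where the invariance of the measure concerns images while integration needs
  preimages.\<close>

lemma householder:
  assumes y: "y \<in> Rn n" "y' \<in> Rn n" "enorm n y = enorm n y'"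
  obtains U where "orthogonal_on n U" "U y = y'" "\<And>x. x \<in> Rn n \<Longrightarrow> U (U x) = x"
proof (cases "y = y'")
  case True
  show ?thesis
  proof (rule that[of "\<lambda>x. x"])
    show "orthogonal_on n (\<lambda>x. x)" by (simp add: orthogonal_on_def GL_def bij_betw_def linear_iff)
  qed (use True in auto)
next
  case False
  define w where "w = y - y'"
  have w: "w \<in> Rn n" "w \<noteq> 0" using y False by (auto simp: w_def)
  define a where "a = dot n w w"
  have a: "a > 0" using enorm_eq_0[OF w(1)] w(2) by (simp add: a_def dot_self)
  define U where "U x = x - (2 * dot n x w / a) *\<^sub>R w" for x
  have lin: "linear U"
  proof (rule linearI)
    show "U (x + z) = U x + U z" for x z
      unfolding U_def dot_add_left by (simp add: distrib_left add_divide_distrib scaleR_left_distrib)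
    show "U (c *\<^sub>R x) = c *\<^sub>R U x" for c x
      unfolding U_def dot_scaleR_left by (simp add: scaleR_right_diff_distrib ac_simps)
  qed
  have dw: "dot n (U x) w = - dot n x w" for x
    using a by (simp add: U_def dot_diff_left a_def[symmetric])
  have UU: "U (U x) = x" for x
  proof -
    have "U (U x) = U x - (2 * dot n (U x) w / a) *\<^sub>R w" by (simp only: U_def[of "U x"])
    also have "\<dots> = U x + (2 * dot n x w / a) *\<^sub>R w" by (simp add: dw)
    finally show ?thesis by (simp add: U_def)
  qed
  have UR: "U x \<in> Rn n" if "x \<in> Rn n" for x unfolding U_def using that w by simp
  have orth: "dot n (U x) (U z) = dot n x z" for x z
  proof -
    have "dot n (U x) (U z) = dot n (U x) z - (2 * dot n z w / a) * dot n (U x) w"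
      by (subst (2) U_def) (simp add: dot_diff_right)
    also have "\<dots> = dot n x z - (2 * dot n x w / a) * dot n w z + (2 * dot n z w / a) * dot n x w"
      by (simp add: dw) (simp add: U_def dot_diff_left)
    finally show ?thesis by (simp add: dot_commute[of n w z])
  qed
  have "bij_betw U (Rn n) (Rn n)"
    by (rule bij_betw_byWitness[where f'=U]) (auto simp: UU UR)
  then have "orthogonal_on n U" using lin orth by (simp add: orthogonal_on_def GL_def)
  moreover have "U y = y'"
  proof -
    have "dot n y y = dot n y' y'" using y(3) by (simp add: dot_self)
    then have "a = 2 * dot n y w" unfolding a_def w_def
      by (simp add: dot_diff_left dot_diff_right dot_commute[of n y' y])
    then have "2 * dot n y w / a = 1" using a by simp
    then show ?thesis by (simp add: U_def w_def)
  qed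
  ultimately show ?thesis using that UU by blast
qed

section \<open>Moments of linear functionals on a convex body\<close>

lemma sets_leb_Int: "A \<in> sets (leb n) \<Longrightarrow> A \<inter> Rn n = A"
  using sets.sets_into_space[of A "leb n"] by (simp add: Int_absorb2)

lemma body_integrable:
  fixes f :: "(nat \<Rightarrow> real) \<Rightarrow> real"
  assumes "sym_convex_body n K" "f \<in> borel_measurable (leb n)" "\<And>x. x \<in> K \<Longrightarrow> \<bar>f x\<bar> \<le> B"
  shows "set_integrable (leb n) K f"
  unfolding set_integrable_def
  using assms body_sets[OF assms(1)] body_emeasure_finite[OF assms(1)]
  by (intro integrableI_bounded_set_indicator[where B=B]) auto

lemma body_dot_bound:
  assumes "sym_convex_body n K" obtains R where "R > 0" "\<And>x y. x \<in> K \<Longrightarrow> \<bar>dot n x y\<bar> \<le> R * enorm n y"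
proof -
  obtain R where R: "R > 0" "\<And>x. x \<in> K \<Longrightarrow> enorm n x \<le> R" using body_bounded[OF assms] by blast
  have "\<bar>dot n x y\<bar> \<le> R * enorm n y" if "x \<in> K" for x y
    using dot_le[of n x y] mult_right_mono[OF R(2)[OF that] enorm_nonneg[of n y]] by linarith
  then show ?thesis using that R(1) by blast
qed

lemma body_emeasure: "sym_convex_body n K \<Longrightarrow> A \<subseteq> K \<Longrightarrow> emeasure (leb n) A = ennreal (measure (leb n) A)"
  by (rule emeasure_eq_ennreal_measure)
    (metis body_sets body_emeasure_finite emeasure_mono infinity_ennreal_def leD top.extremum_strict top.not_eq_extremum)

lemma body_halfspace_sets: "sym_convex_body n K \<Longrightarrow> {x \<in> K. t \<le> dot n x \<theta>} \<in> sets (leb n)"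
proof -
  assume K: "sym_convex_body n K"
  have "{x \<in> space (leb n). t \<le> dot n x \<theta>} \<in> sets (leb n)" by measurable
  moreover have "{x \<in> K. t \<le> dot n x \<theta>} = K \<inter> {x \<in> space (leb n). t \<le> dot n x \<theta>}"
    using K by (auto simp: sym_convex_body_iff)
  ultimately show ?thesis using body_sets[OF K] by simp
qed

text \<open>Prekopa-Leindler for indicator functions: the midpoint of a point of K at height at
  least 0 and one at height at least 2 t lies in K at height at least t.\<close>

lemma halfspace_tail_log_concave:
  assumes K: "sym_convex_body n K"
  shows "measure (leb n) {x \<in> K. 0 \<le> dot n x \<theta>} * measure (leb n) {x \<in> K. 2 * t \<le> dot n x \<theta>}
    \<le> (measure (leb n) {x \<in> K. t \<le> dot n x \<theta>})\<^sup>2"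
proof -
  define H where "H t = {x \<in> K. t \<le> dot n x \<theta>}" for t
  have Hs: "H t \<in> sets (leb n)" for t unfolding H_def by (rule body_halfspace_sets[OF K])
  have E: "emeasure (leb n) (H t) = ennreal (measure (leb n) (H t))" for t
    by (rule body_emeasure[OF K]) (auto simp: H_def)
  have "(\<integral>\<^sup>+x. indicator (H 0) x \<partial>leb n) * (\<integral>\<^sup>+x. indicator (H (2*t)) x \<partial>leb n) \<le> (\<integral>\<^sup>+x. indicator (H t) x \<partial>leb n)\<^sup>2"
  proof (rule prekopa_leindler)
    fix x y
    have "(\<lambda>i. (x i + y i) / 2) \<in> H t" if "x \<in> H 0" "y \<in> H (2 * t)"
    proof -
      have eq: "(\<lambda>i. (x i + y i) / 2) = (1/2) *\<^sub>R x + (1/2) *\<^sub>R y" by (auto simp: scaleR_fun_def fun_eq_iff)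
      have "convex K" "x \<in> K" "y \<in> K" using K that by (auto simp: sym_convex_body_iff H_def)
      then have "(1/2) *\<^sub>R x + (1/2) *\<^sub>R y \<in> K" by (simp add: convexD)
      moreover have "t \<le> dot n ((1/2) *\<^sub>R x + (1/2) *\<^sub>R y) \<theta>"
        using that unfolding H_def dot_add_left dot_scaleR_left by auto
      ultimately show ?thesis unfolding H_def eq by blast
    qed
    then show "indicator (H 0) x * indicator (H (2*t)) y \<le> (indicator (H t) (\<lambda>i. (x i + y i) / 2) :: ennreal)\<^sup>2"
      by (auto simp: indicator_def)
  qed (use Hs in auto)
  then have "ennreal (measure (leb n) (H 0) * measure (leb n) (H (2*t))) \<le> ennreal ((measure (leb n) (H t))\<^sup>2)"
    using Hs by (simp add: E ennreal_mult ennreal_power)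
  then show ?thesis unfolding H_def by simp
qed

lemma halfspace_reflect:
  assumes K: "sym_convex_body n K"
  shows "measure (leb n) {x \<in> K. t \<le> dot n x (- \<theta>)} = measure (leb n) {x \<in> K. t \<le> dot n x \<theta>}"
proof -
  have s: "{x \<in> K. t \<le> dot n x \<theta>} \<in> sets (leb n)" for \<theta> by (rule body_halfspace_sets[OF K])
  have K': "- x \<in> K \<longleftrightarrow> x \<in> K" for x using K unfolding sym_convex_body_iff by (metis minus_minus)
  have "(\<integral>\<^sup>+x. indicator {x \<in> K. t \<le> dot n x \<theta>} (0 - x) \<partial>leb n) = (\<integral>\<^sup>+x. indicator {x \<in> K. t \<le> dot n x (- \<theta>)} x \<partial>leb n)"
    by (intro nn_integral_cong) (simp add: indicator_def K')
  then have "emeasure (leb n) {x \<in> K. t \<le> dot n x (- \<theta>)} = emeasure (leb n) {x \<in> K. t \<le> dot n x \<theta>}"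
    using nn_integral_leb_reflect[of "indicator {x \<in> K. t \<le> dot n x \<theta>}" n 0] s[of \<theta>] s[of "- \<theta>"] by simp
  then show ?thesis by (simp add: measure_def)
qed

lemma slab_tail_le:
  assumes K: "sym_convex_body n K"
  shows "measure (leb n) {x \<in> K. t \<le> \<bar>dot n x \<theta>\<bar>} \<le> 2 * measure (leb n) {x \<in> K. t \<le> dot n x \<theta>}"
    and "{x \<in> K. t \<le> \<bar>dot n x \<theta>\<bar>} \<in> sets (leb n)"
proof -
  have s: "{x \<in> K. t \<le> dot n x \<theta>} \<in> sets (leb n)" for \<theta> by (rule body_halfspace_sets[OF K])
  have eq: "{x \<in> K. t \<le> \<bar>dot n x \<theta>\<bar>} = {x \<in> K. t \<le> dot n x \<theta>} \<union> {x \<in> K. t \<le> dot n x (- \<theta>)}" by auto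
  show "{x \<in> K. t \<le> \<bar>dot n x \<theta>\<bar>} \<in> sets (leb n)" unfolding eq using s[of \<theta>] s[of "-\<theta>"] by (rule sets.Un)
  have "measure (leb n) {x \<in> K. t \<le> \<bar>dot n x \<theta>\<bar>}
    \<le> measure (leb n) {x \<in> K. t \<le> dot n x \<theta>} + measure (leb n) {x \<in> K. t \<le> dot n x (- \<theta>)}"
    unfolding eq by (rule measure_Un_le[OF s s])
  then show "measure (leb n) {x \<in> K. t \<le> \<bar>dot n x \<theta>\<bar>} \<le> 2 * measure (leb n) {x \<in> K. t \<le> dot n x \<theta>}"
    unfolding halfspace_reflect[OF K] by simp
qed

text \<open>With u = 2^k this pays for the growth (2^k)^p of the moment on the k-th dyadic shell out
  of the tail 4^(-u), at the price p^p. It is ln y <= y - 1 at y = u/(2p), together with 1/2 <= ln 2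
  <= 1.\<close>

lemma powr_le_two_powr:
  fixes u p :: real assumes "u > 0" "p > 0" shows "u powr p \<le> p powr p * 2 powr u"
proof -
  have "ln (u / (2 * p)) \<le> u / (2 * p) - 1" using assms by (intro ln_le_minus_one) simp
  then have "p * ln (u / (2 * p)) \<le> p * (u / (2 * p) - 1)" using assms by (intro mult_left_mono) auto
  then have "p * (ln u - ln 2 - ln p) \<le> u / 2 - p" using assms by (simp add: ln_div ln_mult algebra_simps)
  moreover have "p * ln 2 \<le> p * 1" using ln_2_less_1 assms by (intro mult_left_mono) auto
  moreover have "u / 2 \<le> u * ln 2" using ln2_ge_two_thirds assms by simp
  ultimately have "p * ln u \<le> p * ln p + u * ln 2" by (simp add: algebra_simps)
  then show ?thesis using assms by (simp add: powr_def exp_add[symmetric])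
qed

text \<open>Borell's lemma: \<open>halfspace_tail_log_concave\<close> and Chebyshev's inequality at \<open>3 s\<close> make the tail
  at \<open>2\<^sup>k \<cdot> 3 s\<close> at most \<open>4\<close> to the power \<open>-2\<^sup>k\<close>; the moment is summed over dyadic scales.\<close>

lemma body_khinchine:
  assumes K: "sym_convex_body n K" and p: "p \<ge> 1" and s: "s > 0" and V: "V = measure (leb n) K" "V > 0"
    and var: "(LINT x:K|leb n. (dot n x \<theta>)\<^sup>2) \<le> s\<^sup>2 * V"
  shows "(LINT x:K|leb n. \<bar>dot n x \<theta>\<bar> powr p) \<le> V * (12 * p * s) powr p"
proof -
  define g where "g t = measure (leb n) {x \<in> K. t \<le> dot n x \<theta>}" for t
  \<comment> \<open>Chebyshev at 3 s leaves at most V/9, and 2/9 <= 1/4 is the start of the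
    induction for \<open>q\<close>.\<close>
  define t0 where "t0 = 3 * s"
  have t0: "t0 > 0" using s by (simp add: t0_def)
  have Ks: "K \<in> sets (leb n)" by (rule body_sets[OF K])
  have Kfin: "emeasure (leb n) K < \<infinity>" by (rule body_emeasure_finite[OF K])
  obtain R where R: "R > 0" "\<And>x y. x \<in> K \<Longrightarrow> \<bar>dot n x y\<bar> \<le> R * enorm n y" using body_dot_bound[OF K] by blast
  define B where "B = R * enorm n \<theta>"
  have B: "\<And>x. x \<in> K \<Longrightarrow> \<bar>dot n x \<theta>\<bar> \<le> B" using R(2) by (simp add: B_def)
  have fin: "emeasure (leb n) A < \<infinity>" if "A \<subseteq> K" for A
    using emeasure_mono[OF that Ks] Kfin by (rule le_less_trans)
  have half: "V \<le> 2 * g 0"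
  proof -
    have "{x \<in> K. 0 \<le> \<bar>dot n x \<theta>\<bar>} = K" by auto
    then show ?thesis using slab_tail_le(1)[OF K, of 0 \<theta>] by (simp add: g_def V)
  qed
  have int2: "set_integrable (leb n) K (\<lambda>x. (dot n x \<theta>)\<^sup>2)"
    by (rule body_integrable[OF K, of _ "B\<^sup>2"]) (use B in \<open>auto simp: abs_le_square_iff[symmetric] intro: power2_le_iff_abs_le[THEN iffD2] order_trans[OF _ abs_ge_self]\<close>)
  have cheb: "g t0 \<le> V / 9"
  proof -
    have "t0\<^sup>2 * g t0 = (LINT x:K|leb n. t0\<^sup>2 * indicator {x \<in> K. t0 \<le> dot n x \<theta>} x)"
    proof -
      have "(LINT x:K|leb n. t0\<^sup>2 * indicator {x \<in> K. t0 \<le> dot n x \<theta>} x) = (LINT x|leb n. t0\<^sup>2 * indicator {x \<in> K. t0 \<le> dot n x \<theta>} x)"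
        unfolding set_lebesgue_integral_def by (intro Bochner_Integration.integral_cong) (auto simp: indicator_def)
      also have "\<dots> = t0\<^sup>2 * g t0"
        using sets_leb_Int[OF body_halfspace_sets[OF K, of t0 \<theta>]] body_halfspace_sets[OF K, of t0 \<theta>] by (simp add: g_def)
      finally show ?thesis by (rule sym)
    qed
    also have "\<dots> \<le> (LINT x:K|leb n. (dot n x \<theta>)\<^sup>2)"
    proof (rule set_integral_mono)
      show "set_integrable (leb n) K (\<lambda>x. t0\<^sup>2 * indicator {x \<in> K. t0 \<le> dot n x \<theta>} x)"
      proof (rule body_integrable[OF K, of _ "t0\<^sup>2"])
        show "(\<lambda>x. t0\<^sup>2 * indicator {x \<in> K. t0 \<le> dot n x \<theta>} x) \<in> borel_measurable (leb n)"
          using body_halfspace_sets[OF K, of t0 \<theta>] by (intro borel_measurable_times borel_measurable_const borel_measurable_indicator)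
      qed (auto simp: indicator_def)
    qed (use int2 t0 in \<open>auto simp: indicator_def intro: power_mono\<close>)
    also have "\<dots> \<le> s\<^sup>2 * V" by (rule var)
    finally show ?thesis using s by (simp add: t0_def power_mult_distrib field_simps)
  qed
  have gnn: "0 \<le> g t" for t by (simp add: g_def)
  \<comment> \<open>By symmetry \<open>g 0\<close> is at least V/2. So for r(t) = 2 g(t) / V
    log-concavity reads r(2 t) <= r(t)^2, and each doubling of t squares the bound.\<close>
  have q: "2 * g (2 ^ k * t0) / V \<le> (1/4) ^ (2 ^ k)" for k :: nat
  proof (induction k)
    case 0
    then show ?case using cheb V(2) by (simp add: field_simps)
  next
    case (Suc k)
    have "V / 2 * g (2 * (2 ^ k * t0)) \<le> g 0 * g (2 * (2 ^ k * t0))" using half gnn by (intro mult_right_mono) auto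
    also have "\<dots> \<le> (g (2 ^ k * t0))\<^sup>2" unfolding g_def by (rule halfspace_tail_log_concave[OF K])
    finally have "2 * g (2 ^ Suc k * t0) / V \<le> (2 * g (2 ^ k * t0) / V)\<^sup>2"
      using V(2) by (simp add: field_simps power2_eq_square)
    also have "\<dots> \<le> ((1/4) ^ (2 ^ k))\<^sup>2" using Suc gnn V(2) by (intro power_mono) auto
    also have "\<dots> = (1/4) ^ (2 ^ Suc k)" by (simp add: power_mult[symmetric] mult.commute)
    finally show ?case .
  qed
  \<comment> \<open>K is bounded, so from the scale N on the tails are empty and the dyadic series
    is a finite sum.\<close>
  obtain N :: nat where N: "B < 2 ^ N * t0"
  proof -
    obtain N :: nat where "B / t0 < 2 ^ N" using real_arch_pow[of 2 "B / t0"] by auto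
    then show ?thesis using that t0 by (simp add: field_simps)
  qed
  define S where "S k = {x \<in> K. 2 ^ k * t0 \<le> \<bar>dot n x \<theta>\<bar>}" for k :: nat
  have Ssets [measurable]: "S k \<in> sets (leb n)" for k unfolding S_def by (rule slab_tail_le(2)[OF K])
  have SV: "measure (leb n) (S k) \<le> V * (1/4) ^ (2 ^ k)" for k
  proof -
    have "2 * g (2 ^ k * t0) \<le> (1/4) ^ (2 ^ k) * V" using q[of k] V(2) by (simp only: pos_divide_le_eq)
    then show ?thesis using slab_tail_le(1)[OF K, of "2 ^ k * t0" \<theta>] unfolding S_def g_def by (simp only: mult.commute[of V])
  qed
  \<comment> \<open>A value in [2^k t0, 2^(k+1) t0) is paid for by the k-th term, a value below t0
    by the constant.\<close>
  have pt: "\<bar>dot n x \<theta>\<bar> powr p \<le> t0 powr p + (\<Sum>k<N. (2 ^ Suc k * t0) powr p * indicator (S k) x)" if "x \<in> K" for x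
  proof -
    define u where "u = \<bar>dot n x \<theta>\<bar>"
    have main: "u < 2 ^ m * t0 \<Longrightarrow> m \<le> N \<Longrightarrow> u powr p \<le> t0 powr p + (\<Sum>k<m. (2 ^ Suc k * t0) powr p * indicator (S k) x)" for m
    proof (induction m)
      case 0
      then show ?case using p by (simp add: u_def powr_mono2)
    next
      case (Suc m)
      show ?case
      proof (cases "u < 2 ^ m * t0")
        case True
        then show ?thesis using Suc by simp (smt (verit) powr_ge_zero indicator_pos_le mult_nonneg_nonneg)
      next
        case False
        then have "x \<in> S m" using that by (simp add: S_def u_def)
        moreover have "u powr p \<le> (2 ^ Suc m * t0) powr p" using Suc.prems p by (intro powr_mono2) (auto simp: u_def)
        moreover have "0 \<le> (\<Sum>k<m. (2 ^ Suc k * t0) powr p * indicator (S k) x)" by (intro sum_nonneg) auto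
        ultimately show ?thesis by (simp add: add_increasing)
      qed
    qed
    have "u < 2 ^ N * t0" using N B[OF that] by (simp add: u_def)
    then show ?thesis using main[of N] by (simp add: u_def)
  qed
  have intS: "set_integrable (leb n) K (\<lambda>x. (2 ^ Suc k * t0) powr p * indicator (S k) x)" for k
    by (rule body_integrable[OF K, of _ "(2 ^ Suc k * t0) powr p"]) (auto simp: indicator_def)
  have intc: "set_integrable (leb n) K (\<lambda>x. c)" for c :: real
    by (rule body_integrable[OF K, of _ "\<bar>c\<bar>"]) auto
  have intsum: "set_integrable (leb n) K (\<lambda>x. \<Sum>k<N. (2 ^ Suc k * t0) powr p * indicator (S k) x)"
    using intS unfolding set_integrable_def scaleR_sum_right by (rule Bochner_Integration.integrable_sum)
  have intp: "set_integrable (leb n) K (\<lambda>x. \<bar>dot n x \<theta>\<bar> powr p)"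
    by (rule body_integrable[OF K, of _ "B powr p"]) (use B p in \<open>auto intro: powr_mono2\<close>)
  have "(LINT x:K|leb n. \<bar>dot n x \<theta>\<bar> powr p) \<le> (LINT x:K|leb n. t0 powr p + (\<Sum>k<N. (2 ^ Suc k * t0) powr p * indicator (S k) x))"
    by (rule set_integral_mono[OF intp set_integral_add(1)[OF intc intsum] pt])
  also have "\<dots> = (LINT x:K|leb n. t0 powr p) + (LINT x:K|leb n. \<Sum>k<N. (2 ^ Suc k * t0) powr p * indicator (S k) x)"
    by (rule set_integral_add(2)[OF intc intsum])
  also have "(LINT x:K|leb n. t0 powr p) = V * t0 powr p"
    unfolding set_lebesgue_integral_def using Ks sets_leb_Int[OF Ks] by (simp add: V)
  also have "(LINT x:K|leb n. \<Sum>k<N. (2 ^ Suc k * t0) powr p * indicator (S k) x) = (\<Sum>k<N. LINT x:K|leb n. (2 ^ Suc k * t0) powr p * indicator (S k) x)"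
    using intS unfolding set_lebesgue_integral_def set_integrable_def scaleR_sum_right
    by (rule Bochner_Integration.integral_sum)
  also have "\<dots> = (\<Sum>k<N. (2 ^ Suc k * t0) powr p * measure (leb n) (S k))"
  proof (rule sum.cong[OF refl])
    fix k
    have "(LINT x:K|leb n. (2 ^ Suc k * t0) powr p * indicator (S k) x) = (LINT x|leb n. (2 ^ Suc k * t0) powr p * indicator (S k) x)"
      unfolding set_lebesgue_integral_def by (intro Bochner_Integration.integral_cong) (auto simp: indicator_def S_def)
    also have "\<dots> = (2 ^ Suc k * t0) powr p * measure (leb n) (S k)"
      using Ssets[of k] sets_leb_Int[OF Ssets[of k]] by simp
    finally show "(LINT x:K|leb n. (2 ^ Suc k * t0) powr p * indicator (S k) x) = (2 ^ Suc k * t0) powr p * measure (leb n) (S k)" .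
  qed
  also have "\<dots> \<le> (\<Sum>k<N. V * (t0 powr p * ((2 * p) powr p * (1/2) ^ Suc k)))"
  proof (rule sum_mono)
    fix k
    \<comment> \<open>The k-th term carries (2 u t0)^p against 4^(-u). By
      \<open>powr_le_two_powr\<close> a factor 2^(-u) is left over, and k + 1 <= 2^k makes the
      series at most geometric with sum 1.\<close>
    define u :: real where "u = 2 ^ k"
    have u: "u > 0" by (simp add: u_def)
    have "(2 ^ Suc k * t0) powr p * measure (leb n) (S k) \<le> (2 ^ Suc k * t0) powr p * (V * (1/4) ^ (2 ^ k))"
      by (intro mult_left_mono SV) auto
    also have "\<dots> = 2 powr p * u powr p * t0 powr p * (V * (1/4) ^ (2 ^ k))"
      using t0 by (simp add: u_def powr_mult)
    also have "\<dots> \<le> 2 powr p * (p powr p * 2 powr u) * t0 powr p * (V * (1/4) ^ (2 ^ k))"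
      using u p V(2) by (intro mult_right_mono mult_left_mono powr_le_two_powr) auto
    also have "\<dots> = V * (t0 powr p * ((2 * p) powr p * (2 powr u * (1/4) ^ (2 ^ k))))"
      using p by (simp add: powr_mult)
    also have "2 powr u * (1/4) ^ (2 ^ k) = (1/2 :: real) ^ (2 ^ k)"
    proof -
      have "u = real (2 ^ k)" by (simp add: u_def)
      then have "2 powr u = 2 ^ (2 ^ k)" using powr_realpow[of 2 "2 ^ k"] by simp
      then show ?thesis by (simp add: power_mult_distrib[symmetric])
    qed
    also have "V * (t0 powr p * ((2 * p) powr p * (1/2 :: real) ^ (2 ^ k))) \<le> V * (t0 powr p * ((2 * p) powr p * (1/2) ^ Suc k))"
    proof -
      have "Suc k \<le> 2 ^ k" by (rule Suc_leI[OF less_exp])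
      then have "(1/2 :: real) ^ (2 ^ k) \<le> (1/2) ^ Suc k" by (rule power_decreasing) auto
      then show ?thesis using V(2) by (intro mult_left_mono) auto
    qed
    finally show "(2 ^ Suc k * t0) powr p * measure (leb n) (S k) \<le> V * (t0 powr p * ((2 * p) powr p * (1/2) ^ Suc k))" .
  qed
  also have "\<dots> = V * (t0 powr p * ((2 * p) powr p * (\<Sum>k<N. (1/2) ^ Suc k)))"
    by (simp add: sum_distrib_left)
  also have "\<dots> \<le> V * (t0 powr p * ((2 * p) powr p * 1))"
  proof -
    have "(\<Sum>k<N. (1/2 :: real) ^ Suc k) = 1 - (1/2) ^ N" by (induction N) auto
    then show ?thesis using V(2) by (intro mult_left_mono) auto
  qed
  finally have "(LINT x:K|leb n. \<bar>dot n x \<theta>\<bar> powr p) \<le> V * t0 powr p * (1 + (2 * p) powr p)"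
    by (simp add: algebra_simps)
  \<comment> \<open>The part below t0 contributes 1 and the shells (2p)^p; both are absorbed in
    (4p)^p, whence 12 = 3 * 4.\<close>
  also have "\<dots> \<le> V * t0 powr p * (4 * p) powr p"
  proof -
    have "1 \<le> (2 * p) powr p" using p by (intro ge_one_powr_ge_zero) auto
    moreover have "2 powr 1 \<le> 2 powr p" using p by (intro powr_mono) auto
    ultimately have "1 + (2 * p) powr p \<le> 2 powr p * (2 * p) powr p"
      using mult_right_mono[of 2 "2 powr p" "(2 * p) powr p"] by auto
    also have "\<dots> = (4 * p) powr p" using p by (simp add: powr_mult[symmetric])
    finally show ?thesis using V(2) by (intro mult_left_mono) auto
  qed
  also have "\<dots> = V * (12 * p * s) powr p"
    using p s by (simp add: t0_def powr_mult[symmetric] ac_simps)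
  finally show ?thesis .
qed

section \<open>Moments of linear functionals on the sphere\<close>

lemma space_haar: "haar_sphere n \<sigma> \<Longrightarrow> space \<sigma> = unit_sphere n"
  using sets_eq_imp_space_eq[of \<sigma> "restrict_space borel (unit_sphere n)"]
  by (simp add: haar_sphere_def space_restrict_space)

lemma haar_measurable:
  assumes "haar_sphere n \<sigma>" "f \<in> borel_measurable borel" shows "f \<in> borel_measurable \<sigma>"
proof -
  have "sets \<sigma> = sets (restrict_space borel (unit_sphere n))" using assms(1) by (simp add: haar_sphere_def)
  then show ?thesis using measurable_restrict_space1[OF assms(2), of "unit_sphere n"] measurable_cong_sets by blast
qed

text \<open>For an involution the preimage of a set is its image, so invariance under images says
  that the push-forward of the measure is the measure itself.\<close>

lemma haar_orthogonal:
  assumes \<sigma>: "haar_sphere n \<sigma>" and U: "orthogonal_on n U" and UU: "\<And>x. x \<in> Rn n \<Longrightarrow> U (U x) = x"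
    and f: "f \<in> borel_measurable \<sigma>"
  shows "(\<integral>\<^sup>+x. f (U x) \<partial>\<sigma>) = (\<integral>\<^sup>+x. f x \<partial>\<sigma>)"
proof -
  have sp: "space \<sigma> = unit_sphere n" by (rule space_haar[OF \<sigma>])
  have st: "sets \<sigma> = sets (restrict_space borel (unit_sphere n))" using \<sigma> by (simp add: haar_sphere_def)
  have G: "U \<in> GL n" "linear U" using U by (auto simp: orthogonal_on_def GL_def)
  have US: "U x \<in> unit_sphere n" if "x \<in> unit_sphere n" for x
    using U that GL_in_Rn[OF G(1)] by (auto simp: orthogonal_on_def unit_sphere_def)
  have "U \<in> borel_measurable \<sigma>"
  proof (rule measurable_coordinatewise_then_product)
    fix j
    have "(\<lambda>x::nat \<Rightarrow> real. \<Sum>i<n. x i * U (basis i) j) \<in> borel_measurable borel" by measurable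
    then have "(\<lambda>x::nat \<Rightarrow> real. \<Sum>i<n. x i * U (basis i) j) \<in> borel_measurable \<sigma>" by (rule haar_measurable[OF \<sigma>])
    moreover have "(\<lambda>x. U x j) \<in> borel_measurable \<sigma> \<longleftrightarrow> (\<lambda>x::nat \<Rightarrow> real. \<Sum>i<n. x i * U (basis i) j) \<in> borel_measurable \<sigma>"
      by (rule measurable_cong) (simp add: sp unit_sphere_def linear_apply[OF G(2), of _ n])
    ultimately show "(\<lambda>x. U x j) \<in> borel_measurable \<sigma>" by blast
  qed
  then have "U \<in> \<sigma> \<rightarrow>\<^sub>M restrict_space borel (unit_sphere n)"
    using US sp by (intro measurable_restrict_space2) auto
  then have Um: "U \<in> \<sigma> \<rightarrow>\<^sub>M \<sigma>" using measurable_cong_sets[OF refl st] by blast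
  have "distr \<sigma> \<sigma> U = \<sigma>"
  proof (rule measure_eqI)
    fix A assume "A \<in> sets (distr \<sigma> \<sigma> U)"
    then have A: "A \<in> sets \<sigma>" by simp
    then have AS: "A \<subseteq> unit_sphere n" using sets.sets_into_space sp by blast
    have R: "x \<in> Rn n" if "x \<in> unit_sphere n" for x using that by (simp add: unit_sphere_def)
    have "U -` A \<inter> space \<sigma> = U ` A"
    proof
      show "U -` A \<inter> space \<sigma> \<subseteq> U ` A"
      proof
        fix x assume "x \<in> U -` A \<inter> space \<sigma>"
        then have "U x \<in> A" "x = U (U x)" using sp R UU by auto
        then show "x \<in> U ` A" by blast
      qed
      show "U ` A \<subseteq> U -` A \<inter> space \<sigma>" using AS US UU R sp by fastforce
    qed
    moreover have "emeasure \<sigma> (U ` A) = emeasure \<sigma> A"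
      using \<sigma> A U G(2) GL_in_Rn[OF G(1)] unfolding haar_sphere_def orthogonal_on_def by blast
    ultimately show "emeasure (distr \<sigma> \<sigma> U) A = emeasure \<sigma> A"
      using emeasure_distr[OF Um A] by simp
  qed simp
  then show ?thesis using nn_integral_distr[OF Um, of f] f by simp
qed

definition dot_moment :: "nat \<Rightarrow> real \<Rightarrow> (nat \<Rightarrow> real) measure \<Rightarrow> (nat \<Rightarrow> real) \<Rightarrow> ennreal" where
  "dot_moment n p \<sigma> y = (\<integral>\<^sup>+x. ennreal (\<bar>dot n x y\<bar> powr p) \<partial>\<sigma>)"

lemma borel_dot_powr [measurable]: "(\<lambda>x. ennreal (\<bar>dot n x y\<bar> powr p)) \<in> borel_measurable borel"
  by measurable

lemma dot_moment_scaleR: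
  assumes "haar_sphere n \<sigma>"
  shows "dot_moment n p \<sigma> (c *\<^sub>R y) = ennreal (\<bar>c\<bar> powr p) * dot_moment n p \<sigma> y"
  unfolding dot_moment_def
  by (subst nn_integral_cmult[symmetric])
    (auto simp: abs_mult powr_mult ennreal_mult intro: haar_measurable[OF assms])

text \<open>A reflection carries y to a multiple of the first basis vector, and homogeneity takes
  out the length.\<close>

lemma dot_moment_eq:
  assumes n: "n \<ge> 1" and \<sigma>: "haar_sphere n \<sigma>" and y: "y \<in> Rn n"
  shows "dot_moment n p \<sigma> y = ennreal (enorm n y powr p) * dot_moment n p \<sigma> (basis 0)"
proof -
  have b: "basis 0 \<in> Rn n" "enorm n (basis 0) = 1" using n by (auto simp: basis_Rn enorm_eq dot_basis_left) (simp add: basis_def)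
  define y' where "y' = enorm n y *\<^sub>R basis 0"
  have y': "y' \<in> Rn n" "enorm n y = enorm n y'" using b by (auto simp: y'_def)
  obtain U where U: "orthogonal_on n U" "U y = y'" "\<And>x. x \<in> Rn n \<Longrightarrow> U (U x) = x"
    using householder[OF y y'] by metis
  have "dot_moment n p \<sigma> y' = (\<integral>\<^sup>+x. ennreal (\<bar>dot n (U x) y'\<bar> powr p) \<partial>\<sigma>)"
    unfolding dot_moment_def by (rule haar_orthogonal[OF \<sigma> U(1,3), symmetric]) (auto intro: haar_measurable[OF \<sigma>])
  also have "\<dots> = dot_moment n p \<sigma> y" unfolding dot_moment_def
  proof (rule nn_integral_cong)
    fix x assume "x \<in> space \<sigma>"
    then have "x \<in> Rn n" using space_haar[OF \<sigma>] by (simp add: unit_sphere_def)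
    then have "dot n (U x) y' = dot n x y" using U(1) y unfolding U(2)[symmetric] orthogonal_on_def by blast
    then show "ennreal (\<bar>dot n (U x) y'\<bar> powr p) = ennreal (\<bar>dot n x y\<bar> powr p)" by simp
  qed
  finally show ?thesis using dot_moment_scaleR[OF \<sigma>, of p "enorm n y" "basis 0"] by (simp add: y'_def)
qed

text \<open>Average the sphere moment of y over the unit ball. Each such y has moment at most that
  of \<open>basis 0\<close>; exchanging the integrals leaves, for every point x of the sphere, a
  Lebesgue integral over the ball. Thus a measure known only through its invariance is replaced by
  \<open>leb\<close>.\<close>

lemma dot_moment_ge_ball_average:
  assumes n: "n \<ge> 1" and \<sigma>: "haar_sphere n \<sigma>" and p: "p \<ge> 0"
    and J: "\<And>x. x \<in> unit_sphere n \<Longrightarrow> J \<le> (\<integral>\<^sup>+y. ennreal (\<bar>dot n x y\<bar> powr p) * indicator (unit_ball n) y \<partial>leb n)"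
  shows "J \<le> dot_moment n p \<sigma> (basis 0) * emeasure (leb n) (unit_ball n)"
proof -
  interpret P: prob_space \<sigma> using \<sigma> by (simp add: haar_sphere_def)
  interpret L: sigma_finite_measure "leb n" by (rule sigma_finite_leb)
  interpret pair_sigma_finite \<sigma> "leb n" ..
  have sp: "space \<sigma> = unit_sphere n" by (rule space_haar[OF \<sigma>])
  have coord: "(\<lambda>z. fst z i) \<in> borel_measurable (\<sigma> \<Otimes>\<^sub>M leb n)" "(\<lambda>z. snd z i) \<in> borel_measurable (\<sigma> \<Otimes>\<^sub>M leb n)" for i
    by (rule measurable_compose[OF measurable_fst haar_measurable[OF \<sigma> measurable_product_coordinates]])
      (rule measurable_compose[OF measurable_snd measurable_leb_coord])
  have dm: "(\<lambda>z. dot n (fst z) (snd z)) \<in> borel_measurable (\<sigma> \<Otimes>\<^sub>M leb n)"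
    unfolding dot_def using coord by (intro borel_measurable_sum borel_measurable_times) auto
  have im: "(\<lambda>z. indicator (unit_ball n) (snd z) :: ennreal) \<in> borel_measurable (\<sigma> \<Otimes>\<^sub>M leb n)"
    by (rule measurable_compose[OF measurable_snd]) simp
  have m: "(\<lambda>(x, y). ennreal (\<bar>dot n x y\<bar> powr p) * indicator (unit_ball n) y) \<in> borel_measurable (\<sigma> \<Otimes>\<^sub>M leb n)"
    unfolding case_prod_beta using dm im by measurable
  have "J = (\<integral>\<^sup>+x. J \<partial>\<sigma>)" by (simp add: P.emeasure_space_1)
  also have "\<dots> \<le> (\<integral>\<^sup>+x. \<integral>\<^sup>+y. ennreal (\<bar>dot n x y\<bar> powr p) * indicator (unit_ball n) y \<partial>leb n \<partial>\<sigma>)"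
    by (rule nn_integral_mono) (simp add: J sp)
  also have "\<dots> = (\<integral>\<^sup>+y. \<integral>\<^sup>+x. ennreal (\<bar>dot n x y\<bar> powr p) * indicator (unit_ball n) y \<partial>\<sigma> \<partial>leb n)"
    by (rule Fubini'[OF m, symmetric])
  also have "\<dots> \<le> (\<integral>\<^sup>+y. dot_moment n p \<sigma> (basis 0) * indicator (unit_ball n) y \<partial>leb n)"
  proof (rule nn_integral_mono)
    fix y assume "y \<in> space (leb n)"
    then have y: "y \<in> Rn n" by simp
    have "(\<integral>\<^sup>+x. ennreal (\<bar>dot n x y\<bar> powr p) * indicator (unit_ball n) y \<partial>\<sigma>) = dot_moment n p \<sigma> y * indicator (unit_ball n) y"
      unfolding dot_moment_def by (rule nn_integral_multc) (auto intro: haar_measurable[OF \<sigma>])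
    also have "\<dots> \<le> dot_moment n p \<sigma> (basis 0) * indicator (unit_ball n) y"
    proof (cases "y \<in> unit_ball n")
      case True
      then have "enorm n y powr p \<le> 1 powr p" using p by (intro powr_mono2) (auto simp: unit_ball_iff)
      then have "ennreal (enorm n y powr p) \<le> 1" by simp
      then have "dot_moment n p \<sigma> y \<le> 1 * dot_moment n p \<sigma> (basis 0)"
        unfolding dot_moment_eq[OF n \<sigma> y] by (rule mult_right_mono) simp
      then show ?thesis using True by simp
    qed simp
    finally show "(\<integral>\<^sup>+x. ennreal (\<bar>dot n x y\<bar> powr p) * indicator (unit_ball n) y \<partial>\<sigma>) \<le> dot_moment n p \<sigma> (basis 0) * indicator (unit_ball n) y" .
  qed
  also have "\<dots> = dot_moment n p \<sigma> (basis 0) * emeasure (leb n) (unit_ball n)"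
    by (rule nn_integral_cmult_indicator) simp
  finally show ?thesis .
qed

text \<open>Substitute y = \<rho> z + t x: the copy of E shrunk by \<rho> and pushed by t in the
  direction x has to stay in the ball and at height at least a.\<close>

lemma ball_moment_ge:
  assumes x: "x \<in> Rn n" and E: "E \<in> sets (leb n)" and \<rho>: "\<rho> > 0" and a: "a \<ge> 0" and p: "p \<ge> 0"
    and sub: "\<And>z. z \<in> E \<Longrightarrow> enorm n (\<rho> *\<^sub>R z + t *\<^sub>R x) \<le> 1" "\<And>z. z \<in> E \<Longrightarrow> a \<le> \<bar>dot n x (\<rho> *\<^sub>R z + t *\<^sub>R x)\<bar>"
  shows "ennreal (\<rho> ^ n * a powr p) * emeasure (leb n) E
    \<le> (\<integral>\<^sup>+y. ennreal (\<bar>dot n x y\<bar> powr p) * indicator (unit_ball n) y \<partial>leb n)"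
proof -
  have ER: "E \<subseteq> Rn n" using sets.sets_into_space[OF E] by simp
  define f where "f y = ennreal (\<bar>dot n x y\<bar> powr p) * indicator (unit_ball n) y" for y
  have f: "f \<in> borel_measurable (leb n)" unfolding f_def by measurable
  have "ennreal (\<rho> ^ n * a powr p) * emeasure (leb n) E = ennreal (\<bar>\<rho>\<bar> ^ n) * (ennreal (a powr p) * emeasure (leb n) E)"
    using \<rho> by (simp add: ennreal_mult mult.assoc)
  also have "\<dots> = ennreal (\<bar>\<rho>\<bar> ^ n) * (\<integral>\<^sup>+z. ennreal (a powr p) * indicator E z \<partial>leb n)"
    using E by (simp add: nn_integral_cmult_indicator)
  also have "\<dots> \<le> ennreal (\<bar>\<rho>\<bar> ^ n) * (\<integral>\<^sup>+z. f (\<rho> *\<^sub>R z + t *\<^sub>R x) \<partial>leb n)"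
  proof (intro mult_left_mono nn_integral_mono)
    fix z
    show "ennreal (a powr p) * indicator E z \<le> f (\<rho> *\<^sub>R z + t *\<^sub>R x)"
    proof (cases "z \<in> E")
      case True
      then have "\<rho> *\<^sub>R z + t *\<^sub>R x \<in> unit_ball n" using sub(1) ER x by (auto simp: unit_ball_iff)
      moreover have "a powr p \<le> \<bar>dot n x (\<rho> *\<^sub>R z + t *\<^sub>R x)\<bar> powr p" using sub(2)[OF True] a p by (intro powr_mono2) auto
      ultimately show ?thesis using True by (simp add: f_def ennreal_leI)
    qed simp
  qed simp
  also have "\<dots> = (\<integral>\<^sup>+y. f y \<partial>leb n)" by (rule nn_integral_leb_affine[OF f]) (use \<rho> x in auto)
  finally show ?thesis unfolding f_def .
qed

text \<open>Reflections make the second moment the same in all directions, and on the ball the n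
  coordinate squares add up to at most 1.\<close>

lemma unit_ball_second_moment:
  assumes n: "n \<ge> 1" and x: "x \<in> unit_sphere n"
  shows "of_nat n * (\<integral>\<^sup>+z. ennreal ((dot n x z)\<^sup>2) * indicator (unit_ball n) z \<partial>leb n) \<le> emeasure (leb n) (unit_ball n)"
proof -
  define F where "F y = (\<integral>\<^sup>+z. ennreal ((dot n y z)\<^sup>2) * indicator (unit_ball n) z \<partial>leb n)" for y
  have m: "(\<lambda>z. ennreal ((dot n y z)\<^sup>2) * indicator (unit_ball n) z) \<in> borel_measurable (leb n)" for y by measurable
  have eq: "F (basis i) = F x" if i: "i < n" for i
  proof -
    have "basis i \<in> Rn n" "enorm n (basis i) = enorm n x" "x \<in> Rn n"
      using i x by (auto simp: basis_Rn unit_sphere_iff enorm_eq dot_basis_left) (simp add: basis_def)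
    then obtain U where U: "orthogonal_on n U" "U (basis i) = x" using householder[of "basis i" n x] by metis
    have "F x = (\<integral>\<^sup>+z. ennreal ((dot n x (U z))\<^sup>2) * indicator (unit_ball n) (U z) \<partial>leb n)"
      unfolding F_def by (rule nn_integral_leb_orthogonal[OF n U(1) m, symmetric])
    also have "\<dots> = F (basis i)" unfolding F_def
    proof (rule nn_integral_cong)
      fix z assume "z \<in> space (leb n)"
      then have z: "z \<in> Rn n" by simp
      then have "dot n x (U z) = dot n (basis i) z" using U basis_Rn[OF i] unfolding orthogonal_on_def by metis
      moreover have "U z \<in> unit_ball n \<longleftrightarrow> z \<in> unit_ball n"
        using U(1) z GL_in_Rn[of U n z] by (simp add: orthogonal_on_def unit_ball_def)
      ultimately show "ennreal ((dot n x (U z))\<^sup>2) * indicator (unit_ball n) (U z) = ennreal ((dot n (basis i) z)\<^sup>2) * indicator (unit_ball n) z"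
        by (simp add: indicator_def)
    qed
    finally show ?thesis by simp
  qed
  have "of_nat n * F x = (\<Sum>i<n. F (basis i))" by (simp add: eq)
  also have "\<dots> = (\<integral>\<^sup>+z. (\<Sum>i<n. ennreal ((dot n (basis i) z)\<^sup>2) * indicator (unit_ball n) z) \<partial>leb n)"
    unfolding F_def by (rule nn_integral_sum[symmetric]) (rule m)
  also have "\<dots> \<le> (\<integral>\<^sup>+z. indicator (unit_ball n) z \<partial>leb n)"
  proof (rule nn_integral_mono)
    fix z
    show "(\<Sum>i<n. ennreal ((dot n (basis i) z)\<^sup>2) * indicator (unit_ball n) z) \<le> indicator (unit_ball n) z"
    proof (cases "z \<in> unit_ball n")
      case True
      have "(\<Sum>i<n. ennreal ((dot n (basis i) z)\<^sup>2)) = (\<Sum>i<n. ennreal ((z i)\<^sup>2))"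
        by (rule sum.cong) (auto simp: dot_basis_left)
      also have "\<dots> = ennreal (\<Sum>i<n. (z i)\<^sup>2)" by (rule sum_ennreal) simp
      also have "\<dots> \<le> ennreal 1" using True by (intro ennreal_leI) (simp add: unit_ball_def dot_def power2_eq_square)
      finally show ?thesis using True by simp
    qed simp
  qed
  also have "\<dots> = emeasure (leb n) (unit_ball n)" by simp
  finally show ?thesis unfolding F_def .
qed

text \<open>Chebyshev with the second moment vol/n: off the slab the square exceeds (t/2)^2 >= 2/n,
  so at most half of the ball lies there.\<close>

lemma unit_ball_slab:
  assumes n: "n \<ge> 1" and x: "x \<in> unit_sphere n" and t: "t > 0" "8 \<le> real n * t\<^sup>2"
  shows "vol n (unit_ball n) / 2 \<le> measure (leb n) {z \<in> unit_ball n. \<bar>dot n x z\<bar> \<le> t / 2}"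
    and "{z \<in> unit_ball n. \<bar>dot n x z\<bar> \<le> t / 2} \<in> sets (leb n)"
proof -
  define A where "A = {z \<in> unit_ball n. \<bar>dot n x z\<bar> \<le> t / 2}"
  define B where "B = {z \<in> unit_ball n. t / 2 < \<bar>dot n x z\<bar>}"
  have "{z \<in> space (leb n). \<bar>dot n x z\<bar> \<le> t / 2} \<in> sets (leb n)" by measurable
  then have "unit_ball n \<inter> {z \<in> space (leb n). \<bar>dot n x z\<bar> \<le> t / 2} \<in> sets (leb n)" by (intro sets.Int) auto
  moreover have "unit_ball n \<inter> {z \<in> space (leb n). \<bar>dot n x z\<bar> \<le> t / 2} = A" by (auto simp: A_def unit_ball_def)
  ultimately show As: "{z \<in> unit_ball n. \<bar>dot n x z\<bar> \<le> t / 2} \<in> sets (leb n)" unfolding A_def by simp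
  have "B = unit_ball n - A" by (auto simp: A_def B_def)
  then have Bs: "B \<in> sets (leb n)" using As unfolding A_def by simp
  have fin: "emeasure (leb n) C \<noteq> \<infinity>" if "C \<subseteq> unit_ball n" for C
    using emeasure_mono[OF that unit_ball_sets] emeasure_unit_ball_finite[of n] by (metis leD infinity_ennreal_def top.not_eq_extremum)
  have fB: "emeasure (leb n) B = ennreal (measure (leb n) B)"
    by (rule emeasure_eq_ennreal_measure) (use fin[of B] in \<open>auto simp: B_def\<close>)
  have "ennreal ((t/2)\<^sup>2) * emeasure (leb n) B = (\<integral>\<^sup>+z. ennreal ((t/2)\<^sup>2) * indicator B z \<partial>leb n)"
    using Bs by (simp add: nn_integral_cmult_indicator)
  also have "\<dots> \<le> (\<integral>\<^sup>+z. ennreal ((dot n x z)\<^sup>2) * indicator (unit_ball n) z \<partial>leb n)"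
  proof (rule nn_integral_mono)
    fix z
    show "ennreal ((t/2)\<^sup>2) * indicator B z \<le> ennreal ((dot n x z)\<^sup>2) * indicator (unit_ball n) z"
    proof (cases "z \<in> B")
      case True
      then have "(t/2)\<^sup>2 \<le> \<bar>dot n x z\<bar>\<^sup>2" using t by (intro power_mono) (auto simp: B_def)
      then show ?thesis using True by (simp add: B_def ennreal_leI)
    qed simp
  qed
  finally have "of_nat n * (ennreal ((t/2)\<^sup>2) * emeasure (leb n) B) \<le> of_nat n * (\<integral>\<^sup>+z. ennreal ((dot n x z)\<^sup>2) * indicator (unit_ball n) z \<partial>leb n)"
    by (rule mult_left_mono) simp
  also have "\<dots> \<le> ennreal (vol n (unit_ball n))" using unit_ball_second_moment[OF n x] by (simp add: emeasure_unit_ball)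
  finally have "ennreal (real n * ((t/2)\<^sup>2 * measure (leb n) B)) \<le> ennreal (vol n (unit_ball n))"
    by (simp add: fB ennreal_mult ennreal_of_nat_eq_real_of_nat)
  then have "real n * ((t/2)\<^sup>2 * measure (leb n) B) \<le> vol n (unit_ball n)" by (simp add: vol_def)
  then have "real n * t\<^sup>2 * measure (leb n) B \<le> 4 * vol n (unit_ball n)" by (simp add: power_divide)
  moreover have "8 * measure (leb n) B \<le> real n * t\<^sup>2 * measure (leb n) B" using t by (intro mult_right_mono) auto
  ultimately have B2: "2 * measure (leb n) B \<le> vol n (unit_ball n)" by linarith
  have "vol n (unit_ball n) = measure (leb n) (A \<union> B)" unfolding vol_def by (rule arg_cong[of _ _ "measure (leb n)"]) (auto simp: A_def B_def)
  also have "\<dots> \<le> measure (leb n) A + measure (leb n) B" using As Bs unfolding A_def by (intro measure_Un_le)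
  finally show "vol n (unit_ball n) / 2 \<le> measure (leb n) {z \<in> unit_ball n. \<bar>dot n x z\<bar> \<le> t / 2}" using B2 unfolding A_def by linarith
qed

lemma enorm_add_sq: "(enorm n (x + y))\<^sup>2 = (enorm n x)\<^sup>2 + 2 * dot n x y + (enorm n y)\<^sup>2"
  by (simp add: dot_self[symmetric] dot_add_left dot_add_right dot_commute[of n y x])

text \<open>Half of the ball can be shifted to height of order sqrt(p/n) at the cost of a factor
  e^(-O(p)) in volume, which disappears on taking p-th roots. For n <= 32 p a smaller ball of fixed
  radius does the same; it costs 4^(-n) >= 4^(-32 p) in volume and 4^(-p) in height, whence
  4^33.\<close>

lemma dot_moment_basis_ge:
  assumes n: "n \<ge> 1" and \<sigma>: "haar_sphere n \<sigma>" and p: "p \<ge> 1"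
  shows "ennreal ((1 / 4 ^ 33 * sqrt (min p n / n)) powr p) \<le> dot_moment n p \<sigma> (basis 0)"
proof -
  define w where "w = vol n (unit_ball n)"
  have w: "w > 0" "emeasure (leb n) (unit_ball n) = ennreal w"
    using vol_unit_ball_pos[OF n] by (simp_all add: w_def emeasure_unit_ball)
  have cancel: "ennreal c \<le> \<kappa>" if "ennreal (c * w) \<le> \<kappa> * ennreal w" "c \<ge> 0" for c \<kappa>
  proof -
    have "ennreal c * ennreal w \<le> \<kappa> * ennreal w" using that w(1) by (simp add: ennreal_mult)
    then have "ennreal c * ennreal w * ennreal (1/w) \<le> \<kappa> * ennreal w * ennreal (1/w)" by (rule mult_right_mono) simp
    then show ?thesis using w(1) by (simp add: mult.assoc ennreal_mult'[symmetric])
  qed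
  show ?thesis
  proof (cases "real n \<le> 32 * p")
    case True
    have "ennreal ((1/4) ^ n * (1/4) powr p * w) \<le> dot_moment n p \<sigma> (basis 0) * emeasure (leb n) (unit_ball n)"
    proof (rule dot_moment_ge_ball_average[OF n \<sigma>])
      fix x assume x: "x \<in> unit_sphere n"
      then have xR: "x \<in> Rn n" "enorm n x = 1" by (auto simp: unit_sphere_iff)
      have "ennreal ((1/4) ^ n * (1/4) powr p) * emeasure (leb n) (unit_ball n) \<le> (\<integral>\<^sup>+y. ennreal (\<bar>dot n x y\<bar> powr p) * indicator (unit_ball n) y \<partial>leb n)"
      \<comment> \<open>The ball of radius 1/4 about x/2 lies in the unit ball, and its points have
        height at least 1/4.\<close>
      proof (rule ball_moment_ge[OF xR(1), where t="1/2"])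
        fix z assume z: "z \<in> unit_ball n"
        have "enorm n ((1/4) *\<^sub>R z + (1/2) *\<^sub>R x) \<le> 1/4 * enorm n z + 1/2 * enorm n x"
          using enorm_triangle[of n "(1/4) *\<^sub>R z" "(1/2) *\<^sub>R x"] by simp
        then show "enorm n ((1/4) *\<^sub>R z + (1/2) *\<^sub>R x) \<le> 1" using z xR by (simp add: unit_ball_iff)
        have "\<bar>dot n x z\<bar> \<le> 1" using dot_le[of n x z] z xR by (simp add: unit_ball_iff)
        moreover have "dot n x ((1/4) *\<^sub>R z + (1/2) *\<^sub>R x) = 1/4 * dot n x z + 1/2"
          using xR by (simp add: dot_add_right dot_self)
        ultimately show "1/4 \<le> \<bar>dot n x ((1/4) *\<^sub>R z + (1/2) *\<^sub>R x)\<bar>" by linarith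
      qed (use p in auto)
      then show "ennreal ((1/4) ^ n * (1/4) powr p * w) \<le> (\<integral>\<^sup>+y. ennreal (\<bar>dot n x y\<bar> powr p) * indicator (unit_ball n) y \<partial>leb n)"
        using w by (simp add: ennreal_mult)
    qed (use p in auto)
    from this[unfolded w(2)] have 1: "ennreal ((1/4) ^ n * (1/4) powr p) \<le> dot_moment n p \<sigma> (basis 0)"
      by (rule cancel) simp
    have 2: "(1 / 4 ^ 33 * sqrt (min p n / n)) powr p \<le> (1 / 4 ^ 33 :: real) powr p"
      using p n by (intro powr_mono2) (auto simp: min_def divide_simps)
    have "(1 / 4 ^ 33 :: real) = (1/4) powr 33" by (simp add: powr_numeral power_divide)
    then have "(1 / 4 ^ 33 :: real) powr p = (1/4) powr (33 * p)" by (simp only: powr_powr)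
    also have "33 * p = 32 * p + p" by simp
    also have "(1/4 :: real) powr (32 * p + p) = (1/4) powr (32 * p) * (1/4) powr p" by (rule powr_add)
    finally have 3: "(1 / 4 ^ 33 :: real) powr p = (1/4) powr (32 * p) * (1/4) powr p" .
    have "(1/4 :: real) powr (32 * p) \<le> (1/4) powr n" using True by (intro powr_mono') auto
    also have "\<dots> = (1/4) ^ n" by (rule powr_realpow) simp
    finally have "(1/4 :: real) powr (32 * p) * (1/4) powr p \<le> (1/4) ^ n * (1/4) powr p" by (rule mult_right_mono) simp
    then have "(1 / 4 ^ 33 * sqrt (min p n / n)) powr p \<le> (1/4) ^ n * (1/4) powr p" using 2 3 by linarith
    then show ?thesis by (rule order_trans[OF ennreal_leI 1])
  next
    case False
    \<comment> \<open>As p >= 1, this t satisfies the condition of the slab lemma. A shifted slab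
      point has squared length at most \<rho>^2 + 2 t (t/2) + t^2, so \<rho> is chosen with \<rho>^2
      + 2 t^2 = 1. The assumption n > 32 p keeps u = 2 t^2 at most 1/2.\<close>
    define t where "t = sqrt (8 * p / n)"
    define u where "u = 2 * t\<^sup>2"
    define \<rho> where "\<rho> = sqrt (1 - u)"
    have t: "t > 0" "t\<^sup>2 = 8 * p / n" using p n by (auto simp: t_def)
    have "u = 16 * p / n" by (simp add: u_def t(2))
    moreover have "16 * p / n \<le> 1/2" using n False by (simp add: divide_le_eq)
    moreover have "0 \<le> u" unfolding u_def by simp
    ultimately have u: "u = 16 * p / n" "0 \<le> u" "u \<le> 1/2" by simp_all
    have \<rho>: "\<rho> > 0" "\<rho> \<le> 1" "\<rho>\<^sup>2 = 1 - u" using u by (auto simp: \<rho>_def)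
    have "ennreal (\<rho> ^ n * (t/2) powr p * (1/2) * w) \<le> dot_moment n p \<sigma> (basis 0) * emeasure (leb n) (unit_ball n)"
    proof (rule dot_moment_ge_ball_average[OF n \<sigma>])
      fix x assume x: "x \<in> unit_sphere n"
      then have xR: "x \<in> Rn n" "enorm n x = 1" by (auto simp: unit_sphere_iff)
      define E where "E = {z \<in> unit_ball n. \<bar>dot n x z\<bar> \<le> t / 2}"
      have nt: "8 \<le> real n * t\<^sup>2" using t p n by simp
      have E: "w / 2 \<le> measure (leb n) E" "E \<in> sets (leb n)"
        using unit_ball_slab[OF n x t(1) nt] by (auto simp: E_def w_def)
      have fE: "emeasure (leb n) E = ennreal (measure (leb n) E)"
        by (rule emeasure_eq_ennreal_measure)
          (metis (no_types, lifting) E_def emeasure_mono emeasure_unit_ball_finite infinity_ennreal_def leD mem_Collect_eq subsetI top.not_eq_extremum unit_ball_sets)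
      have "\<rho> ^ n * (t/2) powr p * (w / 2) \<le> \<rho> ^ n * (t/2) powr p * measure (leb n) E"
        using E(1) \<rho> by (intro mult_left_mono) auto
      then have "ennreal (\<rho> ^ n * (t/2) powr p * (1/2) * w) \<le> ennreal (\<rho> ^ n * (t/2) powr p) * emeasure (leb n) E"
        unfolding fE using \<rho>(1) by (simp add: ennreal_mult[symmetric] ennreal_leI)
      also have "\<dots> \<le> (\<integral>\<^sup>+y. ennreal (\<bar>dot n x y\<bar> powr p) * indicator (unit_ball n) y \<partial>leb n)"
      proof (rule ball_moment_ge[OF xR(1) E(2), where t=t])
        fix z assume z: "z \<in> E"
        then have z1: "enorm n z \<le> 1" "\<bar>dot n z x\<bar> \<le> t / 2" by (auto simp: E_def unit_ball_iff dot_commute[of n x])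
        have "(enorm n (\<rho> *\<^sub>R z + t *\<^sub>R x))\<^sup>2 = \<rho>\<^sup>2 * (enorm n z)\<^sup>2 + 2 * (\<rho> * (t * dot n z x)) + t\<^sup>2"
          unfolding enorm_add_sq using xR by (simp add: power_mult_distrib)
        also have "\<dots> \<le> \<rho>\<^sup>2 * 1 + 2 * (1 * (t * (t / 2))) + t\<^sup>2"
        proof -
          have "\<rho>\<^sup>2 * (enorm n z)\<^sup>2 \<le> \<rho>\<^sup>2 * 1" using z1 by (intro mult_left_mono) (auto simp: power_le_one)
          moreover have "\<rho> * (t * dot n z x) \<le> 1 * (t * (t / 2))"
          proof -
            have "\<rho> * (t * dot n z x) \<le> \<rho> * (t * (t / 2))" using \<rho> t z1 by (intro mult_left_mono) auto
            also have "\<dots> \<le> 1 * (t * (t / 2))" using \<rho> t by (intro mult_right_mono) auto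
            finally show ?thesis .
          qed
          ultimately show ?thesis by linarith
        qed
        also have "\<dots> = 1"
        proof -
          have "2 * (1 * (t * (t / 2))) = t\<^sup>2" by (simp add: power2_eq_square)
          then show ?thesis using \<rho>(3) u_def by linarith
        qed
        finally show "enorm n (\<rho> *\<^sub>R z + t *\<^sub>R x) \<le> 1" by (simp add: abs_square_le_1)
        have "\<bar>\<rho> * dot n z x\<bar> \<le> 1 * (t / 2)" unfolding abs_mult using \<rho> z1 t by (intro mult_mono) auto
        moreover have "dot n x (\<rho> *\<^sub>R z + t *\<^sub>R x) = \<rho> * dot n z x + t"
          using xR by (simp add: dot_add_right dot_self dot_commute[of n x z])
        ultimately show "t / 2 \<le> \<bar>dot n x (\<rho> *\<^sub>R z + t *\<^sub>R x)\<bar>" by linarith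
      qed (use \<rho> t p in auto)
      finally show "ennreal (\<rho> ^ n * (t/2) powr p * (1/2) * w) \<le> (\<integral>\<^sup>+y. ennreal (\<bar>dot n x y\<bar> powr p) * indicator (unit_ball n) y \<partial>leb n)" .
    qed (use p in auto)
    from this[unfolded w(2)] have 1: "ennreal (\<rho> ^ n * (t/2) powr p * (1/2)) \<le> dot_moment n p \<sigma> (basis 0)"
      by (rule cancel) (use \<rho>(1) in simp)
    \<comment> \<open>For u <= 1/2 one has ln (1 - u) >= - 2 u, hence ln \<rho> >= - u and \<rho>^n
      >= exp (- n u) = exp (- 16 p).\<close>
    have r: "exp (- 16) powr p \<le> \<rho> ^ n"
    proof -
      have "- u - 2 * u\<^sup>2 \<le> ln (1 - u)" using ln_one_minus_pos_lower_bound[of u] u by simp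
      moreover have "u * u \<le> u * (1/2)" using u by (intro mult_left_mono) auto
      ultimately have "- 2 * u \<le> ln (1 - u)" by (simp add: power2_eq_square)
      then have "- u \<le> ln \<rho>" using u by (simp add: \<rho>_def ln_sqrt)
      then have "real n * (- u) \<le> real n * ln \<rho>" by (intro mult_left_mono) auto
      then have "- 16 * p \<le> real n * ln \<rho>" using u(1) n by simp
      then have "exp (- 16 * p) \<le> exp (real n * ln \<rho>)" by simp
      also have "\<dots> = \<rho> ^ n" using \<rho>(1) by (simp add: exp_of_nat_mult)
      finally show ?thesis by (simp add: powr_def mult.commute)
    qed
    \<comment> \<open>The factor 1/2 for the slab is weakened to (1/2)^p, so that the whole bound
      becomes a p-th power.\<close>
    have h: "(1/2) powr p \<le> (1/2 :: real)" using powr_mono'[of 1 p "1/2 :: real"] p by simp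
    have "min p n = p" using False p by auto
    then have "sqrt (min p n / n) \<le> t / 2"
    proof -
      have "p / n \<le> 8 * p / n / 4" using p n by (simp add: divide_simps)
      then have "sqrt (p / n) \<le> sqrt (8 * p / n / 4)" by (rule real_sqrt_le_mono)
      also have "\<dots> = t / 2" unfolding real_sqrt_divide[of "8 * p / n" 4] t_def by simp
      finally show ?thesis using \<open>min p n = p\<close> by simp
    qed
    moreover have "1 / 4 ^ 33 \<le> exp (- 16) * (1/2 :: real)"
    proof -
      have "exp (16 :: real) = exp 1 ^ 16" by (simp add: exp_of_nat_mult[symmetric])
      also have "\<dots> \<le> 3 ^ 16" by (intro power_mono exp_le) simp
      finally have "exp (16 :: real) * 2 \<le> 4 ^ 33" by simp
      then show ?thesis by (simp add: exp_minus field_simps)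
    qed
    ultimately have "1 / 4 ^ 33 * sqrt (min p n / n) \<le> exp (- 16) * (1/2) * (t / 2)"
      using p t(1) by (intro mult_mono) auto
    then have "(1 / 4 ^ 33 * sqrt (min p n / n)) powr p \<le> (exp (- 16) * (1/2) * (t / 2)) powr p"
      using p by (intro powr_mono2) auto
    also have "\<dots> = exp (- 16) powr p * (1/2) powr p * (t/2) powr p" using t(1) by (simp only: powr_mult)
    also have "\<dots> \<le> \<rho> ^ n * (1/2) * (t/2) powr p"
      using r h \<rho>(1) by (intro mult_mono mult_right_mono) auto
    also have "\<dots> = \<rho> ^ n * (t/2) powr p * (1/2)" by simp
    finally have "(1 / 4 ^ 33 * sqrt (min p n / n)) powr p \<le> \<rho> ^ n * (t/2) powr p * (1/2)" .
    then show ?thesis by (rule order_trans[OF ennreal_leI 1])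
  qed
qed

lemma dot_moment_ge:
  assumes n: "n \<ge> 1" and \<sigma>: "haar_sphere n \<sigma>" and p: "p \<ge> 1" and y: "y \<in> Rn n"
  shows "ennreal ((1 / 4 ^ 33 * sqrt (min p n / n) * enorm n y) powr p) \<le> dot_moment n p \<sigma> y"
proof -
  have "ennreal ((1 / 4 ^ 33 * sqrt (min p n / n) * enorm n y) powr p)
      = ennreal (enorm n y powr p) * ennreal ((1 / 4 ^ 33 * sqrt (min p n / n)) powr p)"
    unfolding powr_mult[of _ "enorm n y"] by (simp only: ennreal_mult powr_ge_zero mult.commute)
  also have "\<dots> \<le> ennreal (enorm n y powr p) * dot_moment n p \<sigma> (basis 0)"
    by (intro mult_left_mono dot_moment_basis_ge[OF n \<sigma> p]) simp
  finally show ?thesis unfolding dot_moment_eq[OF n \<sigma> y] .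
qed

section \<open>Support functions of quotients of Lq\<close>

text \<open>The support function; on symmetric bodies the absolute value does not change it. On
  \<open>Rn n\<close> it is the norm whose unit ball is the polar (\<open>body_norm_polar\<close>),
  hence the function that \<open>M_star\<close> averages.\<close>

definition hs :: "nat \<Rightarrow> (nat \<Rightarrow> real) set \<Rightarrow> (nat \<Rightarrow> real) \<Rightarrow> real" where
  "hs n G x = (SUP z\<in>G. \<bar>dot n x z\<bar>)"

lemma body_bdd_dot:
  assumes "sym_convex_body n G" shows "bdd_above ((\<lambda>z. \<bar>dot n x z\<bar>) ` G)"
proof -
  obtain R where R: "R > 0" "\<And>z. z \<in> G \<Longrightarrow> enorm n z \<le> R" using body_bounded[OF assms] by blast
  have "\<bar>dot n x z\<bar> \<le> enorm n x * R" if "z \<in> G" for z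
    using dot_le[of n x z] mult_left_mono[OF R(2)[OF that] enorm_nonneg[of n x]] by linarith
  then show ?thesis by (rule bdd_aboveI2)
qed

lemma dot_le_hs: "sym_convex_body n G \<Longrightarrow> z \<in> G \<Longrightarrow> \<bar>dot n x z\<bar> \<le> hs n G x"
  unfolding hs_def by (rule cSUP_upper[OF _ body_bdd_dot])

lemma hs_le: "sym_convex_body n G \<Longrightarrow> (\<And>z. z \<in> G \<Longrightarrow> \<bar>dot n x z\<bar> \<le> c) \<Longrightarrow> hs n G x \<le> c"
  unfolding hs_def using body_zero[of n G] by (intro cSUP_least) auto

lemma hs_nonneg: assumes "sym_convex_body n G" shows "0 \<le> hs n G x"
  using dot_le_hs[OF assms body_zero[OF assms], of x] by (simp only: dot_zero abs_zero)

lemma body_norm_bdd: "bdd_below {t. 0 < t \<and> x \<in> (\<lambda>y. t *\<^sub>R y) ` G}"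
  by (rule bdd_belowI[of _ 0]) (drule CollectD, erule conjE, erule less_imp_le)

lemma body_norm_le_1: "z \<in> G \<Longrightarrow> body_norm G z \<le> 1"
  unfolding body_norm_def by (rule cInf_lower[OF _ body_norm_bdd], rule CollectI, rule conjI, rule zero_less_one, rule image_eqI[of _ _ z]) simp_all

text \<open>Each dilate of L containing w gives the bound with its factor; dividing by
  \<open>hs\<close> passes to the infimum, with \<open>hs\<close> = 0 treated apart. The ball inside
  L makes the set of factors nonempty, so that the infimum is a genuine one.\<close>

lemma dot_le_body_norm:
  assumes L: "sym_convex_body n L" and w: "w \<in> Rn n"
  shows "\<bar>dot n x w\<bar> \<le> hs n L x * body_norm L w"
proof -
  define S where "S = {t. 0 < t \<and> w \<in> (\<lambda>y. t *\<^sub>R y) ` L}"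
  have *: "\<bar>dot n x w\<bar> \<le> hs n L x * t" if t: "t \<in> S" for t
  proof -
    obtain y where y: "y \<in> L" "w = t *\<^sub>R y" "t > 0" using t unfolding S_def by blast
    have "\<bar>dot n x w\<bar> = t * \<bar>dot n x y\<bar>" using y by (simp add: abs_mult)
    also have "\<dots> \<le> t * hs n L x" using y dot_le_hs[OF L y(1)] by (intro mult_left_mono) auto
    finally show ?thesis by (simp add: mult.commute)
  qed
  obtain r where r: "r > 0" "\<And>x. x \<in> Rn n \<Longrightarrow> enorm n x \<le> r \<Longrightarrow> x \<in> L" using L unfolding sym_convex_body_iff by blast
  define t where "t = (enorm n w + 1) / r"
  have t: "t > 0" using r(1) enorm_nonneg[of n w] by (simp add: t_def add_nonneg_pos)
  have "t * r = enorm n w + 1" using r(1) by (simp add: t_def)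
  then have "enorm n w / t \<le> r" using t by (simp add: pos_divide_le_eq mult.commute)
  then have "enorm n ((1 / t) *\<^sub>R w) \<le> r" using t by simp
  then have "(1 / t) *\<^sub>R w \<in> L" by (rule r(2)[OF Rn_scaleR[OF w]])
  moreover have "w = t *\<^sub>R ((1/t) *\<^sub>R w)" using t by simp
  ultimately have "t \<in> S" using t unfolding S_def by blast
  then have ne: "S \<noteq> {}" by blast
  show ?thesis
  proof (cases "hs n L x = 0")
    case True
    then show ?thesis using *[OF \<open>t \<in> S\<close>] by simp
  next
    case False
    then have h: "hs n L x > 0" using hs_nonneg[OF L, of x] by simp
    have "\<bar>dot n x w\<bar> / hs n L x \<le> Inf S"
      using ne * h by (intro cInf_greatest) (auto simp: divide_le_eq mult.commute)
    then show ?thesis using h by (simp add: body_norm_def S_def divide_le_eq mult.commute)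
  qed
qed

section \<open>The spaces L_q of the unit interval\<close>

abbreviation unit_leb :: "real measure" where
  "unit_leb \<equiv> lebesgue_on {0..1}"

lemma prob_space_unit_interval: "prob_space unit_leb"
  by (rule prob_spaceI) (simp add: emeasure_restrict_space)

lemma Lq_space_measurable: "f \<in> Lq_space q \<Longrightarrow> f \<in> borel_measurable unit_leb"
  by (simp add: Lq_space_def)

lemma esssup_abs_nonneg:
  fixes f :: "real \<Rightarrow> real"
  shows "0 \<le> esssup unit_leb (\<lambda>x. ereal \<bar>f x\<bar>)"
proof -
  interpret prob_space unit_leb by (rule prob_space_unit_interval)
  have "0 = esssup unit_leb (\<lambda>x. 0 :: ereal)" by (rule esssup_const[symmetric]) (use emeasure_space_1 in simp)
  also have "\<dots> \<le> esssup unit_leb (\<lambda>x. ereal \<bar>f x\<bar>)" by (rule esssup_mono) auto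
  finally show ?thesis .
qed

lemma Lq_norm_nonneg: "0 \<le> Lq_norm q f"
  unfolding Lq_norm_def using esssup_abs_nonneg[of f] by (auto intro: real_of_ereal_pos)

lemma Linf_norm_AE:
  assumes "f \<in> Lq_space \<infinity>" shows "AE x in unit_leb. \<bar>f x\<bar> \<le> Lq_norm \<infinity> f"
proof -
  define s where "s = esssup unit_leb (\<lambda>x. ereal \<bar>f x\<bar>)"
  have s: "0 \<le> s" "s < \<infinity>" using esssup_abs_nonneg assms by (auto simp: s_def Lq_space_def)
  then have "s = ereal (Lq_norm \<infinity> f)" by (cases s) (auto simp: Lq_norm_def s_def)
  moreover have "AE x in unit_leb. ereal \<bar>f x\<bar> \<le> s" unfolding s_def by (rule esssup_AE)
  ultimately show ?thesis by simp
qed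

lemma Linf_I:
  assumes f: "f \<in> borel_measurable unit_leb" and B: "AE x in unit_leb. \<bar>f x\<bar> \<le> B"
  shows "f \<in> Lq_space \<infinity>" "Lq_norm \<infinity> f \<le> B"
proof -
  have *: "esssup unit_leb (\<lambda>x. ereal \<bar>f x\<bar>) \<le> ereal B"
    by (rule esssup_I) (use f B in auto)
  then show "f \<in> Lq_space \<infinity>" using f by (auto simp: Lq_space_def intro: le_less_trans)
  show "Lq_norm \<infinity> f \<le> B" using * esssup_abs_nonneg[of f]
    by (cases "esssup unit_leb (\<lambda>x. ereal \<bar>f x\<bar>)") (auto simp: Lq_norm_def)
qed

lemma Lq_space_fin: "r \<ge> 0 \<Longrightarrow> f \<in> Lq_space (ennreal r) \<longleftrightarrow> f \<in> borel_measurable unit_leb \<and>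
    integrable unit_leb (\<lambda>x. \<bar>f x\<bar> powr r)"
  by (simp add: Lq_space_def)

lemma Lq_norm_fin: "r \<ge> 0 \<Longrightarrow> Lq_norm (ennreal r) f = (LINT x|unit_leb. \<bar>f x\<bar> powr r) powr (1 / r)"
  by (simp add: Lq_norm_def)

text \<open>Functions live on the whole line while the seminorm sees only the unit interval. A
  simple function and the step function built from its level sets agree on that interval
  alone.\<close>

lemma Lq_cong:
  assumes "f \<in> Lq_space q" "\<And>x. x \<in> {0..1} \<Longrightarrow> f x = g x"
  shows "g \<in> Lq_space q" "Lq_norm q g = Lq_norm q f"
proof -
  have f: "f \<in> borel_measurable unit_leb" by (rule Lq_space_measurable[OF assms(1)])
  have g: "g \<in> borel_measurable unit_leb"
    using f assms(2) measurable_cong[of unit_leb f g borel] by simp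
  show "g \<in> Lq_space q"
  proof (cases "q = \<infinity>")
    case True
    have "AE x in unit_leb. \<bar>g x\<bar> \<le> Lq_norm \<infinity> f"
      using Linf_norm_AE[of f] AE_space assms True by auto
    then show ?thesis using Linf_I(1)[OF g] True by simp
  next
    case False
    have "integrable unit_leb (\<lambda>x. \<bar>f x\<bar> powr enn2real q) = integrable unit_leb (\<lambda>x. \<bar>g x\<bar> powr enn2real q)"
      using assms(2) by (intro Bochner_Integration.integrable_cong) auto
    then show ?thesis using assms(1) g False by (simp add: Lq_space_def)
  qed
  have 1: "(LINT x|unit_leb. \<bar>g x\<bar> powr enn2real q) = (LINT x|unit_leb. \<bar>f x\<bar> powr enn2real q)"
    using assms(2) by (intro Bochner_Integration.integral_cong) auto
  have 2: "esssup unit_leb (\<lambda>x. ereal \<bar>g x\<bar>) = esssup unit_leb (\<lambda>x. ereal \<bar>f x\<bar>)"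
    using f g assms(2) by (intro esssup_AE_cong) auto
  show "Lq_norm q g = Lq_norm q f" by (simp add: Lq_norm_def 1 2)
qed

lemma powr_add_le:
  fixes a b r :: real assumes "r \<ge> 1" "a \<ge> 0" "b \<ge> 0"
  shows "(a + b) powr r \<le> 2 powr r * (a powr r + b powr r)"
proof -
  have "(a + b) powr r \<le> (2 * max a b) powr r" using assms by (intro powr_mono2) auto
  also have "\<dots> = 2 powr r * max a b powr r" using assms by (simp add: powr_mult)
  also have "\<dots> \<le> 2 powr r * (a powr r + b powr r)"
    by (intro mult_left_mono) (auto simp: max_def)
  finally show ?thesis .
qed

lemma Lq_diff:
  assumes q: "1 \<le> q" and f: "f \<in> Lq_space q" and g: "g \<in> Lq_space q"
  shows "f - g \<in> Lq_space q"
proof (cases "q = \<infinity>")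
  case True
  have m: "f - g \<in> borel_measurable unit_leb"
    using Lq_space_measurable[OF f] Lq_space_measurable[OF g] unfolding fun_diff_def by (rule borel_measurable_diff)
  have "AE x in unit_leb. \<bar>f x\<bar> \<le> Lq_norm \<infinity> f" "AE x in unit_leb. \<bar>g x\<bar> \<le> Lq_norm \<infinity> g"
    by (rule Linf_norm_AE[OF f[unfolded True]], rule Linf_norm_AE[OF g[unfolded True]])
  then have "AE x in unit_leb. \<bar>(f - g) x\<bar> \<le> Lq_norm \<infinity> f + Lq_norm \<infinity> g"
    by eventually_elim auto
  then show ?thesis using Linf_I(1)[OF m] True by simp
next
  case False
  then obtain r where r: "q = ennreal r" "r \<ge> 1" using q by (cases q) auto
  have m: "f - g \<in> borel_measurable unit_leb"
    using Lq_space_measurable[OF f] Lq_space_measurable[OF g] unfolding fun_diff_def by (rule borel_measurable_diff)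
  have "integrable unit_leb (\<lambda>x. \<bar>(f - g) x\<bar> powr r)"
  proof (rule Bochner_Integration.integrable_bound)
    show "integrable unit_leb (\<lambda>x. 2 powr r * (\<bar>f x\<bar> powr r + \<bar>g x\<bar> powr r))"
      using f g r by (simp add: Lq_space_fin)
    show "(\<lambda>x. \<bar>(f - g) x\<bar> powr r) \<in> borel_measurable unit_leb" using m by measurable
    have "\<bar>(f - g) x\<bar> powr r \<le> 2 powr r * (\<bar>f x\<bar> powr r + \<bar>g x\<bar> powr r)" for x
    proof -
      have "\<bar>(f - g) x\<bar> powr r \<le> (\<bar>f x\<bar> + \<bar>g x\<bar>) powr r" using r by (intro powr_mono2) auto
      also have "\<dots> \<le> 2 powr r * (\<bar>f x\<bar> powr r + \<bar>g x\<bar> powr r)" using r by (intro powr_add_le) auto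
      finally show ?thesis .
    qed
    then show "AE x in unit_leb. norm (\<bar>(f - g) x\<bar> powr r) \<le> norm (2 powr r * (\<bar>f x\<bar> powr r + \<bar>g x\<bar> powr r))"
      by simp
  qed
  then show ?thesis using m r by (simp add: Lq_space_fin)
qed

text \<open>For q = \<infinity> values are rounded down to a mesh e/2, otherwise convergence is
  dominated. The bound on the norm of g comes from pointwise estimates, the rounding error or |g| <=
  2 |f|, instead of a triangle inequality for \<open>Lq_norm\<close>.\<close>

lemma Lq_simple_approx:
  assumes q: "1 \<le> q" and f: "f \<in> Lq_space q" and e: "e > 0"
  obtains g where "simple_function unit_leb g" "g \<in> Lq_space q" "Lq_norm q (f - g) < e"
    "Lq_norm q g \<le> 2 * Lq_norm q f + e"
proof (cases "q = \<infinity>")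
  case True
  define B where "B = Lq_norm \<infinity> f"
  have B: "B \<ge> 0" "AE x in unit_leb. \<bar>f x\<bar> \<le> B"
    unfolding B_def by (rule Lq_norm_nonneg, rule Linf_norm_AE[OF f[unfolded True]])
  have fm [measurable]: "f \<in> borel_measurable unit_leb" by (rule Lq_space_measurable[OF f])
  \<comment> \<open>f is bounded only almost everywhere; truncating it everywhere leaves finitely
    many rounded values, as a simple function must have.\<close>
  define c where "c x = max (- B) (min B (f x))" for x
  define d where "d = e / 2"
  have d: "d > 0" using e by (simp add: d_def)
  define g where "g x = d * of_int \<lfloor>c x / d\<rfloor>" for x
  have cB: "\<bar>c x\<bar> \<le> B" for x using B(1) by (auto simp: c_def)
  have gc: "\<bar>c x - g x\<bar> \<le> d" for x
  proof -
    have "of_int \<lfloor>c x / d\<rfloor> \<le> c x / d" "c x / d \<le> of_int \<lfloor>c x / d\<rfloor> + 1" by linarith+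
    then have "d * of_int \<lfloor>c x / d\<rfloor> \<le> d * (c x / d)" "d * (c x / d) \<le> d * (of_int \<lfloor>c x / d\<rfloor> + 1)"
      using d by (intro mult_left_mono; simp)+
    then show ?thesis using d unfolding g_def abs_le_iff by (simp add: distrib_left)
  qed
  have "c \<in> borel_measurable unit_leb" unfolding c_def[abs_def]
    by (intro borel_measurable_max borel_measurable_min borel_measurable_const fm)
  then have "(\<lambda>x. c x / d) \<in> borel_measurable unit_leb" by measurable
  then have "(\<lambda>x. real_of_int \<lfloor>c x / d\<rfloor>) \<in> borel_measurable unit_leb"
    by (rule measurable_compose[OF _ borel_measurable_real_floor])
  then have gm [measurable]: "g \<in> borel_measurable unit_leb" unfolding g_def[abs_def]
    by (intro borel_measurable_times borel_measurable_const)
  have "finite (range g)"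
  proof (rule finite_subset)
    show "range g \<subseteq> (\<lambda>k. d * of_int k) ` {\<lfloor>- B / d\<rfloor>..\<lfloor>B / d\<rfloor>}"
    proof
      fix y assume "y \<in> range g"
      then obtain x where x: "y = g x" by blast
      have "- B / d \<le> c x / d" "c x / d \<le> B / d" using cB[of x] d by (intro divide_right_mono; auto simp: abs_le_iff)+
      then have "\<lfloor>c x / d\<rfloor> \<in> {\<lfloor>- B / d\<rfloor>..\<lfloor>B / d\<rfloor>}" by (auto intro: floor_mono)
      then show "y \<in> (\<lambda>k. d * of_int k) ` {\<lfloor>- B / d\<rfloor>..\<lfloor>B / d\<rfloor>}" unfolding x g_def by blast
    qed
  qed simp
  then have fin: "finite (g ` space unit_leb)" by (rule finite_subset[rotated]) auto
  have sg: "simple_function unit_leb g"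
    using simple_function_borel_measurable[OF gm fin] .
  have gB: "AE x in unit_leb. \<bar>g x\<bar> \<le> B + d"
  proof (rule AE_I2)
    fix x show "\<bar>g x\<bar> \<le> B + d" using cB[of x] gc[of x] by linarith
  qed
  have fg: "AE x in unit_leb. \<bar>(f - g) x\<bar> \<le> d"
    using B(2)
  proof eventually_elim
    fix x assume "\<bar>f x\<bar> \<le> B"
    then have "c x = f x" by (auto simp: c_def)
    then show "\<bar>(f - g) x\<bar> \<le> d" using gc[of x] by simp
  qed
  have m: "f - g \<in> borel_measurable unit_leb" unfolding fun_diff_def by measurable
  show ?thesis
  proof (rule that[OF sg])
    show "g \<in> Lq_space q" unfolding True by (rule Linf_I(1)[OF gm gB])
    show "Lq_norm q (f - g) < e" unfolding True using Linf_I(2)[OF m fg] e d_def by linarith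
    show "Lq_norm q g \<le> 2 * Lq_norm q f + e" unfolding True using Linf_I(2)[OF gm gB] e B(1) B_def d_def by linarith
  qed
next
  case False
  then obtain r where r: "q = ennreal r" "r \<ge> 1" using q by (cases q) auto
  have fm [measurable]: "f \<in> borel_measurable unit_leb" by (rule Lq_space_measurable[OF f])
  have fi: "integrable unit_leb (\<lambda>x. \<bar>f x\<bar> powr r)" using f r by (simp add: Lq_space_fin)
  obtain F where F: "\<And>i. simple_function unit_leb (F i)"
    "\<And>x. x \<in> space unit_leb \<Longrightarrow> (\<lambda>i. F i x) \<longlonglongrightarrow> f x"
    "\<And>i x. x \<in> space unit_leb \<Longrightarrow> dist (F i x) 0 \<le> 2 * dist (f x) 0"
    using borel_measurable_implies_sequence_metric[OF fm, of 0] by blast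
  have Fm [measurable]: "F i \<in> borel_measurable unit_leb" for i
    using F(1) by (rule borel_measurable_simple_function)
  have Fb: "\<bar>F i x\<bar> powr r \<le> 2 powr r * \<bar>f x\<bar> powr r" if "x \<in> {0..1}" for i x
  proof -
    have "\<bar>F i x\<bar> \<le> 2 * \<bar>f x\<bar>" using F(3)[of x i] that by simp
    then have "\<bar>F i x\<bar> powr r \<le> (2 * \<bar>f x\<bar>) powr r" using r by (intro powr_mono2) auto
    then show ?thesis by (simp add: powr_mult)
  qed
  have Fi: "integrable unit_leb (\<lambda>x. \<bar>F i x\<bar> powr r)" for i
    by (rule Bochner_Integration.integrable_bound[where f="\<lambda>x. 2 powr r * \<bar>f x\<bar> powr r"]) (use fi Fb in \<open>auto intro!: AE_I2\<close>)
  have "(\<lambda>i. LINT x|unit_leb. \<bar>f x - F i x\<bar> powr r) \<longlonglongrightarrow> (LINT x|unit_leb. 0)"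
  \<comment> \<open>The majorant comes from |F i| <= 2 |f|, which gives |f - F i| <= 3 |f|.\<close>
  proof (rule integral_dominated_convergence[where w="\<lambda>x. 3 powr r * \<bar>f x\<bar> powr r"])
    show "AE x in unit_leb. (\<lambda>i. \<bar>f x - F i x\<bar> powr r) \<longlonglongrightarrow> 0"
    proof (rule AE_I2)
      fix x assume "x \<in> space unit_leb"
      then have "(\<lambda>i. \<bar>f x - F i x\<bar>) \<longlonglongrightarrow> \<bar>f x - f x\<bar>" by (intro tendsto_intros F(2))
      then have "(\<lambda>i. \<bar>f x - F i x\<bar> powr r) \<longlonglongrightarrow> 0 powr r"
        using r by (intro tendsto_powr') auto
      then show "(\<lambda>i. \<bar>f x - F i x\<bar> powr r) \<longlonglongrightarrow> 0" by simp
    qed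
    show "AE x in unit_leb. norm (\<bar>f x - F i x\<bar> powr r) \<le> 3 powr r * \<bar>f x\<bar> powr r" for i
    proof (rule AE_I2)
      fix x assume "x \<in> space unit_leb"
      then have "\<bar>f x - F i x\<bar> \<le> 3 * \<bar>f x\<bar>" using F(3)[of x i] by simp
      then have "\<bar>f x - F i x\<bar> powr r \<le> (3 * \<bar>f x\<bar>) powr r" using r by (intro powr_mono2) auto
      then show "norm (\<bar>f x - F i x\<bar> powr r) \<le> 3 powr r * \<bar>f x\<bar> powr r" by (simp add: powr_mult)
    qed
  qed (use fi in auto)
  moreover have "e powr r > 0" using e by simp
  ultimately have "eventually (\<lambda>i. (LINT x|unit_leb. \<bar>f x - F i x\<bar> powr r) < e powr r) sequentially"
    by (intro order_tendstoD) auto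
  then obtain i where i: "(LINT x|unit_leb. \<bar>f x - F i x\<bar> powr r) < e powr r"
    by (auto simp: eventually_sequentially)
  show ?thesis
  proof (rule that[OF F(1)[of i]])
    show "F i \<in> Lq_space q" using Fi r by (simp add: Lq_space_fin)
    have "Lq_norm q (f - F i) = (LINT x|unit_leb. \<bar>f x - F i x\<bar> powr r) powr (1 / r)"
      using r by (simp add: Lq_norm_fin)
    also have "\<dots> < (e powr r) powr (1 / r)" using i r by (intro powr_less_mono2) auto
    also have "\<dots> = e" using e r by (simp add: powr_powr)
    finally show "Lq_norm q (f - F i) < e" .
    have "(LINT x|unit_leb. \<bar>F i x\<bar> powr r) \<le> (LINT x|unit_leb. 2 powr r * \<bar>f x\<bar> powr r)"
      using Fi fi Fb by (intro Bochner_Integration.integral_mono) auto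
    then have "(LINT x|unit_leb. \<bar>F i x\<bar> powr r) \<le> 2 powr r * (LINT x|unit_leb. \<bar>f x\<bar> powr r)" by simp
    then have "(LINT x|unit_leb. \<bar>F i x\<bar> powr r) powr (1/r) \<le> (2 powr r * (LINT x|unit_leb. \<bar>f x\<bar> powr r)) powr (1/r)"
      using r by (intro powr_mono2) auto
    also have "\<dots> = 2 * (LINT x|unit_leb. \<bar>f x\<bar> powr r) powr (1/r)"
      using r by (simp add: powr_mult powr_powr)
    finally have "Lq_norm q (F i) \<le> 2 * Lq_norm q f" using r by (simp add: Lq_norm_fin)
    then show "Lq_norm q (F i) \<le> 2 * Lq_norm q f + e" using e by simp
  qed
qed

lemma Holder_sum:
  fixes a b :: "'a \<Rightarrow> real"
  assumes J: "finite J" and r: "r > 1" "p > 1" "1/r + 1/p = 1"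
  shows "(\<Sum>j\<in>J. \<bar>a j * b j\<bar>) \<le> (\<Sum>j\<in>J. \<bar>a j\<bar> powr r) powr (1/r) * (\<Sum>j\<in>J. \<bar>b j\<bar> powr p) powr (1/p)"
proof -
  define X where "X = (\<Sum>j\<in>J. \<bar>a j\<bar> powr r)"
  define Y where "Y = (\<Sum>j\<in>J. \<bar>b j\<bar> powr p)"
  have XY: "X \<ge> 0" "Y \<ge> 0" by (auto simp: X_def Y_def intro: sum_nonneg)
  show ?thesis
  proof (cases "X = 0 \<or> Y = 0")
    case True
    have "a j * b j = 0" if "j \<in> J" for j
      using True that sum_nonneg_eq_0_iff[OF J, of "\<lambda>j. \<bar>a j\<bar> powr r"] sum_nonneg_eq_0_iff[OF J, of "\<lambda>j. \<bar>b j\<bar> powr p"]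
      unfolding X_def Y_def by fastforce
    then have "(\<Sum>j\<in>J. \<bar>a j * b j\<bar>) = 0" by (intro sum.neutral ballI) (simp only: abs_zero)
    then show ?thesis by simp
  next
    case False
    then have pos: "X > 0" "Y > 0" using XY by auto
    define \<alpha> where "\<alpha> = X powr (1/r)"
    define \<beta> where "\<beta> = Y powr (1/p)"
    have ab: "\<alpha> > 0" "\<beta> > 0" "\<alpha> powr r = X" "\<beta> powr p = Y" using pos r by (auto simp: \<alpha>_def \<beta>_def powr_powr)
    have "\<bar>a j * b j\<bar> / (\<alpha> * \<beta>) \<le> \<bar>a j\<bar> powr r / X / r + \<bar>b j\<bar> powr p / Y / p" for j
    proof -
      have "(\<bar>a j\<bar> / \<alpha>) * (\<bar>b j\<bar> / \<beta>) \<le> (\<bar>a j\<bar> / \<alpha>) powr r / r + (\<bar>b j\<bar> / \<beta>) powr p / p"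
        using r ab by (intro Youngs_inequality) auto
      then show ?thesis using ab by (simp add: powr_divide abs_mult)
    qed
    then have "(\<Sum>j\<in>J. \<bar>a j * b j\<bar> / (\<alpha> * \<beta>)) \<le> (\<Sum>j\<in>J. \<bar>a j\<bar> powr r / X / r + \<bar>b j\<bar> powr p / Y / p)" by (rule sum_mono)
    also have "\<dots> = X / X / r + Y / Y / p" by (simp only: sum.distrib sum_divide_distrib[symmetric] X_def[symmetric] Y_def[symmetric])
    also have "\<dots> = 1" using pos r by simp
    finally have "(\<Sum>j\<in>J. \<bar>a j * b j\<bar>) / (\<alpha> * \<beta>) \<le> 1" by (simp add: sum_divide_distrib)
    then have "(\<Sum>j\<in>J. \<bar>a j * b j\<bar>) \<le> \<alpha> * \<beta>" using ab by (simp add: divide_le_eq)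
    then show ?thesis by (simp add: \<alpha>_def \<beta>_def X_def Y_def)
  qed
qed

text \<open>The combination is formed in the space of functions, so that a linear \<pi> can be
  pulled through the sum; \<open>step_apply\<close> recovers the values.\<close>

definition step :: "'j set \<Rightarrow> ('j \<Rightarrow> real set) \<Rightarrow> ('j \<Rightarrow> real) \<Rightarrow> real \<Rightarrow> real" where
  "step J A a = (\<Sum>j\<in>J. a j *\<^sub>R indicator (A j))"

lemma step_apply: "step J A a x = (\<Sum>j\<in>J. a j * indicator (A j) x)"
  by (simp add: step_def sum_fun_apply scaleR_fun_def)

text \<open>What is kept of a quotient map: it does not increase norms, and every point of L has a
  preimage of norm below 2. The infimum defining the quotient norm need not be attained, hence a
  bound larger than 1. In this form the property passes from L to T L.\<close>

locale lq_quotient =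
  fixes n :: nat and q :: ennreal and L :: "(nat \<Rightarrow> real) set" and \<pi> :: "(real \<Rightarrow> real) \<Rightarrow> nat \<Rightarrow> real"
  assumes body: "sym_convex_body n L" and lin: "linear \<pi>" and q: "1 \<le> q"
    and range: "f \<in> Lq_space q \<Longrightarrow> \<pi> f \<in> Rn n"
    and norm_le: "f \<in> Lq_space q \<Longrightarrow> body_norm L (\<pi> f) \<le> Lq_norm q f"
    and lift: "z \<in> L \<Longrightarrow> \<exists>f\<in>Lq_space q. \<pi> f = z \<and> Lq_norm q f < 2"

lemma QL_lq_quotient:
  assumes L: "L \<in> QL n q" and q: "1 \<le> q" obtains \<pi> where "lq_quotient n q L \<pi>"
proof -
  obtain Y \<pi> where body: "sym_convex_body n L" and Y: "closed_subspace_Lq q Y" and lin: "linear \<pi>"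
    and surj: "\<pi> ` Lq_space q = Rn n" and ker: "{f \<in> Lq_space q. \<pi> f = 0} = Y"
    and nrm: "\<And>f. f \<in> Lq_space q \<Longrightarrow> body_norm L (\<pi> f) = quotient_norm_Lq q Y f"
    using L unfolding QL_def by blast
  have Y0: "0 \<in> Y" using Y by (auto simp: closed_subspace_Lq_def intro: subspace_0)
  have bdd: "bdd_below ((\<lambda>g. Lq_norm q (f - g)) ` Y)" for f by (rule bdd_belowI2[where m=0]) (rule Lq_norm_nonneg)
  have "lq_quotient n q L \<pi>"
  proof (rule lq_quotient.intro[OF body lin q])
    fix f assume f: "f \<in> Lq_space q"
    show "\<pi> f \<in> Rn n" using f surj by blast
    show "body_norm L (\<pi> f) \<le> Lq_norm q f"
      unfolding nrm[OF f] quotient_norm_Lq_def using cINF_lower[OF bdd Y0, of f] by simp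
  next
    fix z assume z: "z \<in> L"
    have "z \<in> Rn n" using body z by (auto simp: sym_convex_body_iff)
    then have "z \<in> \<pi> ` Lq_space q" by (simp only: surj)
    then obtain f0 where "z = \<pi> f0" "f0 \<in> Lq_space q" by (rule imageE)
    then have f0: "f0 \<in> Lq_space q" "\<pi> f0 = z" by simp_all
    have "(INF g\<in>Y. Lq_norm q (f0 - g)) < 2"
      using body_norm_le_1[OF z] nrm[OF f0(1)] f0(2) by (simp add: quotient_norm_Lq_def)
    then obtain g where g: "g \<in> Y" "Lq_norm q (f0 - g) < 2"
      using cINF_less_iff[OF _ bdd, of f0 2] Y0 by blast
    have g': "g \<in> Lq_space q" "\<pi> g = 0" using g(1) ker by auto
    have "\<pi> (f0 - g) = z" using linear_diff[OF lin, of f0 g] g'(2) f0(2) by simp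
    then show "\<exists>f\<in>Lq_space q. \<pi> f = z \<and> Lq_norm q f < 2" using Lq_diff[OF q f0(1) g'(1)] g(2) by blast
  qed
  then show ?thesis using that by blast
qed

context lq_quotient
begin

text \<open>For fixed x, f \<mapsto> \<open>dot n x (\<pi> f)\<close> is a functional on L_q of norm
  at most \<open>hs n L x\<close>. Lower bounds for \<open>hs\<close> are found by testing
  it.\<close>

lemma dot_pi_le: "f \<in> Lq_space q \<Longrightarrow> \<bar>dot n x (\<pi> f)\<bar> \<le> hs n L x * Lq_norm q f"
  using dot_le_body_norm[OF body range, of f x] mult_left_mono[OF norm_le hs_nonneg[OF body], of f x] by linarith

lemma pi_step: "\<pi> (step J A a) = (\<Sum>j\<in>J. a j *\<^sub>R \<pi> (indicator (A j)))"
  unfolding step_def linear_sum[OF lin] linear_scale[OF lin] ..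

lemma dot_pi_step: "dot n x (\<pi> (step J A a)) = (\<Sum>j\<in>J. a j * dot n x (\<pi> (indicator (A j))))"
  unfolding pi_step dot_sum_right dot_scaleR_right ..

section \<open>Duality for step functions over finitely many disjoint sets\<close>

context
  fixes J :: "'j set" and A :: "'j \<Rightarrow> real set"
  assumes J: "finite J" and A: "\<And>j. j \<in> J \<Longrightarrow> A j \<in> sets unit_leb" and disj: "disjoint_family_on A J"
begin

lemma step_eq: "j \<in> J \<Longrightarrow> x \<in> A j \<Longrightarrow> step J A a x = a j"
proof -
  assume j: "j \<in> J" "x \<in> A j"
  have "x \<notin> A i" if "i \<in> J" "i \<noteq> j" for i using disj j that by (auto simp: disjoint_family_on_def)
  then have "(\<Sum>i\<in>J. a i * indicator (A i) x) = (\<Sum>i\<in>J. if i = j then a j else 0)"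
    using j by (intro sum.cong) (auto simp: indicator_def)
  then show ?thesis using j J by (simp add: step_apply)
qed

lemma step_eq_0: "(\<And>j. j \<in> J \<Longrightarrow> x \<notin> A j) \<Longrightarrow> step J A a x = 0"
  by (simp add: step_apply)

lemma step_measurable: "step J A a \<in> borel_measurable unit_leb"
proof -
  have "(\<lambda>x. \<Sum>j\<in>J. a j * indicator (A j) x) \<in> borel_measurable unit_leb"
    using A by (intro borel_measurable_sum borel_measurable_times borel_measurable_const borel_measurable_indicator)
  then show ?thesis by (simp add: step_apply[abs_def])
qed

lemma step_bounded: "\<bar>step J A a x\<bar> \<le> (\<Sum>j\<in>J. \<bar>a j\<bar>)"
  unfolding step_apply by (rule order_trans[OF sum_abs]) (auto intro!: sum_mono simp: indicator_def)

lemma step_Lq: "step J A a \<in> Lq_space q"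
proof (cases "q = \<infinity>")
  case True
  show ?thesis unfolding True by (rule Linf_I(1)[OF step_measurable AE_I2]) (rule step_bounded)
next
  case False
  then obtain r where r: "q = ennreal r" "r \<ge> 1" using q by (cases q) auto
  interpret prob_space unit_leb by (rule prob_space_unit_interval)
  have "integrable unit_leb (\<lambda>x. \<bar>step J A a x\<bar> powr r)"
    using step_measurable step_bounded r
    by (intro integrable_const_bound[where B="(\<Sum>j\<in>J. \<bar>a j\<bar>) powr r"]) (auto intro!: AE_I2 powr_mono2)
  then show ?thesis using step_measurable r by (simp add: Lq_space_fin)
qed

lemma indicator_Lq: "j \<in> J \<Longrightarrow> indicator (A j) \<in> Lq_space q"
proof -
  assume j: "j \<in> J"
  have "(indicator (A j) :: real \<Rightarrow> real) = step J A (\<lambda>i. if i = j then 1 else 0)"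
    using J j by (auto simp: step_apply fun_eq_iff if_distrib[of "\<lambda>c. c * _"] cong: if_cong)
  then show ?thesis using step_Lq by simp
qed

lemma step_integral_powr:
  assumes "r > 0"
  shows "(LINT x|unit_leb. \<bar>step J A a x\<bar> powr r) = (\<Sum>j\<in>J. \<bar>a j\<bar> powr r * measure unit_leb (A j))"
proof -
  interpret prob_space unit_leb by (rule prob_space_unit_interval)
  have "\<bar>step J A a x\<bar> powr r = step J A (\<lambda>j. \<bar>a j\<bar> powr r) x" for x
  proof (cases "\<exists>j\<in>J. x \<in> A j")
    case True
    then obtain j where "j \<in> J" "x \<in> A j" by blast
    then show ?thesis by (simp add: step_eq)
  next
    case False
    then show ?thesis using step_eq_0[of x] by auto
  qed
  then have "(LINT x|unit_leb. \<bar>step J A a x\<bar> powr r) = (LINT x|unit_leb. (\<Sum>j\<in>J. \<bar>a j\<bar> powr r * indicator (A j) x))"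
    by (simp only: step_apply)
  also have "\<dots> = (\<Sum>j\<in>J. LINT x|unit_leb. \<bar>a j\<bar> powr r * indicator (A j) x)"
    by (rule Bochner_Integration.integral_sum) (use A in \<open>auto simp: emeasure_eq_measure\<close>)
  also have "\<dots> = (\<Sum>j\<in>J. \<bar>a j\<bar> powr r * measure unit_leb (A j))"
  proof (rule sum.cong[OF refl])
    fix j assume "j \<in> J"
    then have "A j \<inter> space unit_leb = A j" using sets.sets_into_space[OF A] by blast
    then have "(LINT x|unit_leb. indicator (A j) x) = measure unit_leb (A j)"
      using Bochner_Integration.integral_indicator[of unit_leb "A j"] by metis
    then show "(LINT x|unit_leb. \<bar>a j\<bar> powr r * indicator (A j) x) = \<bar>a j\<bar> powr r * measure unit_leb (A j)"
      using Bochner_Integration.integral_mult_right_zero[of unit_leb "\<bar>a j\<bar> powr r" "indicator (A j)"] by metis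
  qed
  finally show ?thesis .
qed

text \<open>The indicator has seminorm 0 and the functional is bounded. So the cells by whose
  measure one cannot divide contribute nothing.\<close>

lemma null_part:
  assumes j: "j \<in> J" and 0: "measure unit_leb (A j) = 0"
  shows "dot n x (\<pi> (indicator (A j))) = 0"
proof -
  interpret prob_space unit_leb by (rule prob_space_unit_interval)
  have null: "A j \<in> null_sets unit_leb" using 0 A[OF j] by (simp add: null_sets_def emeasure_eq_measure)
  have AE: "AE x in unit_leb. indicator (A j) x = (0::real)"
    using AE_not_in[OF null] by eventually_elim simp
  have m: "(indicator (A j) :: real \<Rightarrow> real) \<in> borel_measurable unit_leb" using A[OF j] by simp
  have "Lq_norm q (indicator (A j)) \<le> 0"
  proof (cases "q = \<infinity>")
    case True
    have "AE x in unit_leb. \<bar>indicator (A j) x\<bar> \<le> (0::real)" using AE by eventually_elim simp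
    then show ?thesis using Linf_I(2)[OF m] True by simp
  next
    case False
    then obtain r where r: "q = ennreal r" "r \<ge> 1" using q by (cases q) auto
    have "(LINT x|unit_leb. \<bar>indicator (A j) x\<bar> powr r) = (LINT x|unit_leb. (0::real))"
      using AE m by (intro integral_cong_AE) auto
    then show ?thesis using r by (simp add: Lq_norm_fin)
  qed
  then have "Lq_norm q (indicator (A j)) = 0" using Lq_norm_nonneg[of q "indicator (A j)"] by simp
  then show ?thesis using dot_pi_le[OF indicator_Lq[OF j], of x] by simp
qed

text \<open>Normalising the indicators by m^(-1/r) turns the step functions into \<ell>_r, where the
  functional of x has the coordinates \<open>dot n x (v j)\<close>. The first estimate tests the
  equality case of Hoelder's inequality, the second is Hoelder itself. The vectors v j do not depend
  on x.\<close>

lemma step_duality_fin: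
  assumes r: "q = ennreal r" "r > 1" and p: "p > 1" "1/r + 1/p = 1"
  obtains v where "\<And>j. j \<in> J \<Longrightarrow> v j \<in> Rn n"
    "\<And>x. (\<Sum>j\<in>J. \<bar>dot n x (v j)\<bar> powr p) \<le> hs n L x powr p"
    "\<And>x a. \<bar>dot n x (\<pi> (step J A a))\<bar> \<le> Lq_norm q (step J A a) * (\<Sum>j\<in>J. \<bar>dot n x (v j)\<bar> powr p) powr (1/p)"
proof -
  define m where "m j = measure unit_leb (A j)" for j
  have mnn: "m j \<ge> 0" for j by (simp add: m_def)
  define w where "w j = \<pi> (indicator (A j))" for j
  \<comment> \<open>For m j = 0 the convention 0 powr y = 0 makes v j vanish, in agreement with
    \<open>null_part\<close>.\<close>
  define v where "v j = (m j powr (- (1/r))) *\<^sub>R w j" for j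
  have dv: "dot n x (v j) = m j powr (- (1/r)) * dot n x (w j)" for x j by (simp add: v_def)
  have w0: "dot n x (w j) = 0" if "j \<in> J" "m j = 0" for x j using null_part that by (simp add: w_def m_def)
  have wv: "dot n x (w j) = m j powr (1/r) * dot n x (v j)" if "j \<in> J" for x j
    using w0[OF that] mnn[of j] by (cases "m j = 0") (auto simp: dv powr_minus)
  have nrm: "Lq_norm q (step J A a) = (\<Sum>j\<in>J. \<bar>a j\<bar> powr r * m j) powr (1/r)" for a
    using r step_integral_powr[of r a] by (simp add: Lq_norm_fin m_def)
  show ?thesis
  proof (rule that[of v])
    show "v j \<in> Rn n" if "j \<in> J" for j unfolding v_def w_def using range[OF indicator_Lq[OF that]] by simp
    fix x
    define P where "P = (\<Sum>j\<in>J. \<bar>dot n x (v j)\<bar> powr p)"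
    have P: "P \<ge> 0" by (auto simp: P_def intro: sum_nonneg)
    have pr: "(p - 1) * r = p" "1 - 1/r = 1/p" using p r by (auto simp: field_simps)
    show "(\<Sum>j\<in>J. \<bar>dot n x (v j)\<bar> powr p) \<le> hs n L x powr p"
    proof (cases "P = 0")
      case True
      then show ?thesis by (simp add: P_def)
    next
      case False
      then have Ppos: "P > 0" using P by simp
      \<comment> \<open>The extremal sequence: \<Sum> |a j|^r m j and \<Sum> a j <x, w j> both equal
        P. So P is at most \<open>hs\<close> times P^(1/r), and division leaves P^(1/p) <=
        \<open>hs\<close>.\<close>
      define a where "a j = sgn (dot n x (v j)) * \<bar>dot n x (v j)\<bar> powr (p - 1) * m j powr (- (1/r))" for j
      have "\<bar>a j\<bar> powr r * m j = \<bar>dot n x (v j)\<bar> powr p" if j: "j \<in> J" for j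
      proof (cases "dot n x (v j) = 0 \<or> m j = 0")
        case True
        then show ?thesis using w0[OF j] r p by (auto simp: a_def dv)
      next
        case False
        then have "\<bar>a j\<bar> powr r = (\<bar>dot n x (v j)\<bar> powr (p - 1) * m j powr (- (1/r))) powr r"
          by (simp add: a_def abs_mult abs_sgn_eq)
        also have "\<dots> = \<bar>dot n x (v j)\<bar> powr p * m j powr (- 1)"
          using r by (simp add: powr_mult powr_powr pr)
        finally show ?thesis using False mnn[of j] by (simp add: powr_minus)
      qed
      then have 1: "(\<Sum>j\<in>J. \<bar>a j\<bar> powr r * m j) = P" unfolding P_def by (intro sum.cong) auto
      have "a j * dot n x (w j) = \<bar>dot n x (v j)\<bar> powr p" for j
      proof -
        have "a j * dot n x (w j) = (sgn (dot n x (v j)) * dot n x (v j)) * \<bar>dot n x (v j)\<bar> powr (p - 1)"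
          by (simp add: a_def dv)
        also have "\<dots> = \<bar>dot n x (v j)\<bar> powr 1 * \<bar>dot n x (v j)\<bar> powr (p - 1)"
          by (simp add: sgn_if)
        also have "\<dots> = \<bar>dot n x (v j)\<bar> powr (1 + (p - 1))" by (rule powr_add[symmetric])
        also have "\<dots> = \<bar>dot n x (v j)\<bar> powr p" by simp
        finally show ?thesis .
      qed
      then have 2: "dot n x (\<pi> (step J A a)) = P" unfolding dot_pi_step P_def by (simp add: w_def)
      have "P \<le> hs n L x * P powr (1/r)"
        using dot_pi_le[OF step_Lq, of x a] P unfolding 2 nrm 1 by simp
      then have "P * P powr (- (1/r)) \<le> hs n L x * P powr (1/r) * P powr (- (1/r))" by (rule mult_right_mono) simp
      then have "P powr 1 * P powr (- (1/r)) \<le> hs n L x"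
        using Ppos by (simp add: powr_minus mult.assoc)
      then have "P powr (1/p) \<le> hs n L x" unfolding powr_add[symmetric] using pr by simp
      then have "(P powr (1/p)) powr p \<le> hs n L x powr p" using p by (intro powr_mono2) auto
      then show ?thesis using Ppos p by (simp add: powr_powr P_def)
    qed
    fix a
    have "\<bar>dot n x (\<pi> (step J A a))\<bar> \<le> (\<Sum>j\<in>J. \<bar>(a j * m j powr (1/r)) * dot n x (v j)\<bar>)"
      unfolding dot_pi_step by (rule order_trans[OF sum_abs], rule sum_mono) (simp add: w_def[symmetric] wv mult.assoc)
    also have "\<dots> \<le> (\<Sum>j\<in>J. \<bar>a j * m j powr (1/r)\<bar> powr r) powr (1/r) * (\<Sum>j\<in>J. \<bar>dot n x (v j)\<bar> powr p) powr (1/p)"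
      by (rule Holder_sum[OF J r(2) p])
    also have "(\<Sum>j\<in>J. \<bar>a j * m j powr (1/r)\<bar> powr r) = (\<Sum>j\<in>J. \<bar>a j\<bar> powr r * m j)"
      using r mnn by (intro sum.cong) (auto simp: abs_mult powr_mult powr_powr)
    finally show "\<bar>dot n x (\<pi> (step J A a))\<bar> \<le> Lq_norm q (step J A a) * (\<Sum>j\<in>J. \<bar>dot n x (v j)\<bar> powr p) powr (1/p)"
      unfolding nrm .
  qed
qed

text \<open>At this endpoint \<ell>_1 is the dual of \<ell>_\<infinity>; cell sizes do not enter a
  supremum norm, and the signs of the coordinates are extremal. On a cell of positive measure |a j|
  is at most the norm, and \<open>null_part\<close> covers the other cells.\<close>

lemma step_duality_inf:
  assumes qi: "q = \<infinity>"
  obtains v where "\<And>j. j \<in> J \<Longrightarrow> v j \<in> Rn n"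
    "\<And>x. (\<Sum>j\<in>J. \<bar>dot n x (v j)\<bar>) \<le> hs n L x"
    "\<And>x a. \<bar>dot n x (\<pi> (step J A a))\<bar> \<le> Lq_norm q (step J A a) * (\<Sum>j\<in>J. \<bar>dot n x (v j)\<bar>)"
proof -
  interpret prob_space unit_leb by (rule prob_space_unit_interval)
  define v where "v j = \<pi> (indicator (A j))" for j
  show ?thesis
  proof (rule that[of v])
    show "v j \<in> Rn n" if "j \<in> J" for j unfolding v_def using range[OF indicator_Lq[OF that]] .
    fix x
    define a where "a j = sgn (dot n x (v j))" for j
    have a1: "\<bar>step J A a y\<bar> \<le> 1" for y
    proof (cases "\<exists>j\<in>J. y \<in> A j")
      case True
      then obtain j where "j \<in> J" "y \<in> A j" by blast
      then show ?thesis by (simp add: step_eq a_def abs_sgn_eq)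
    next
      case False
      then show ?thesis using step_eq_0[of y a] by auto
    qed
    have "Lq_norm q (step J A a) \<le> 1" unfolding qi by (rule Linf_I(2)[OF step_measurable AE_I2]) (rule a1)
    then have "hs n L x * Lq_norm q (step J A a) \<le> hs n L x * 1" using hs_nonneg[OF body] by (intro mult_left_mono) auto
    moreover have "dot n x (\<pi> (step J A a)) = (\<Sum>j\<in>J. \<bar>dot n x (v j)\<bar>)"
      unfolding dot_pi_step a_def v_def by (intro sum.cong) (auto simp: sgn_if)
    ultimately show "(\<Sum>j\<in>J. \<bar>dot n x (v j)\<bar>) \<le> hs n L x" using dot_pi_le[OF step_Lq, of x a] by linarith
    fix a
    have "\<bar>a j * dot n x (v j)\<bar> \<le> Lq_norm q (step J A a) * \<bar>dot n x (v j)\<bar>" if j: "j \<in> J" for j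
    proof (cases "measure unit_leb (A j) = 0")
      case True
      then show ?thesis using null_part[OF j True] by (simp add: v_def)
    next
      case False
      have "\<bar>a j\<bar> \<le> Lq_norm q (step J A a)"
      proof (rule ccontr)
        assume neg: "\<not> ?thesis"
        have "AE y in unit_leb. \<bar>step J A a y\<bar> \<le> Lq_norm q (step J A a)"
          using Linf_norm_AE[of "step J A a"] step_Lq[of a] qi by simp
        then have "AE y in unit_leb. y \<notin> A j"
          by eventually_elim (use neg step_eq[OF j] in auto)
        then have "A j \<in> null_sets unit_leb" by (rule iffD2[OF AE_iff_null_sets[OF A[OF j]]])
        then have "measure unit_leb (A j) = 0" by (rule measure_eq_0_null_sets)
        then show False using False by simp
      qed
      then show ?thesis unfolding abs_mult by (rule mult_right_mono) simp
    qed
    then have "(\<Sum>j\<in>J. \<bar>a j * dot n x (v j)\<bar>) \<le> (\<Sum>j\<in>J. Lq_norm q (step J A a) * \<bar>dot n x (v j)\<bar>)" by (rule sum_mono)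
    moreover have "\<bar>dot n x (\<pi> (step J A a))\<bar> \<le> (\<Sum>j\<in>J. \<bar>a j * dot n x (v j)\<bar>)"
      unfolding dot_pi_step v_def by (rule sum_abs)
    ultimately show "\<bar>dot n x (\<pi> (step J A a))\<bar> \<le> Lq_norm q (step J A a) * (\<Sum>j\<in>J. \<bar>dot n x (v j)\<bar>)"
      by (simp add: sum_distrib_left)
  qed
qed

text \<open>As p is a finite real, q > 1. If q = \<infinity> then 1 / q = 0 forces p = 1; otherwise
  both exponents are finite and exceed 1.\<close>

lemma step_duality:
  assumes p: "p \<ge> 1" and pq: "1 / ennreal p + 1 / q = 1"
  obtains v where "\<And>j. j \<in> J \<Longrightarrow> v j \<in> Rn n"
    "\<And>x. (\<Sum>j\<in>J. \<bar>dot n x (v j)\<bar> powr p) \<le> hs n L x powr p"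
    "\<And>x a. \<bar>dot n x (\<pi> (step J A a))\<bar> \<le> Lq_norm q (step J A a) * (\<Sum>j\<in>J. \<bar>dot n x (v j)\<bar> powr p) powr (1/p)"
proof (cases "q = \<infinity>")
  case True
  then have "1 / ennreal p = 1" using pq by simp
  moreover have "1 / ennreal p = ennreal (1 / p)" using divide_ennreal[of 1 p] p by simp
  ultimately have "p = 1" using p by simp
  obtain v where "\<And>j. j \<in> J \<Longrightarrow> v j \<in> Rn n"
    "\<And>x. (\<Sum>j\<in>J. \<bar>dot n x (v j)\<bar>) \<le> hs n L x"
    "\<And>x a. \<bar>dot n x (\<pi> (step J A a))\<bar> \<le> Lq_norm q (step J A a) * (\<Sum>j\<in>J. \<bar>dot n x (v j)\<bar>)"
    using step_duality_inf[OF True] by blast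
  then show ?thesis using that[of v] \<open>p = 1\<close> hs_nonneg[OF body] by (simp add: sum_nonneg)
next
  case False
  then obtain r where r: "q = ennreal r" "r \<ge> 1" using q by (cases q) auto
  have "ennreal (1/p) + ennreal (1/r) = 1"
    using pq r p divide_ennreal[of 1 p] divide_ennreal[of 1 r] by simp
  then have "ennreal (1/p + 1/r) = ennreal 1" using p r by (simp add: ennreal_plus[symmetric] del: ennreal_plus)
  then have s: "1/p + 1/r = 1" by (rule iffD1[OF ennreal_inj, rotated 2]) (use p r in auto)
  have "1/p > 0" "1/r > 0" using p r by auto
  then have "1/p < 1" "1/r < 1" using s by linarith+
  then have pr: "p > 1" "r > 1" using p r by (auto simp: divide_less_eq)
  have s': "1/r + 1/p = 1" using s by simp
  show ?thesis using step_duality_fin[OF r(1) pr(2,1) s'] that by metis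
qed

end

text \<open>If L contains the ball of radius r, the points of a net of mesh r/4 miss those of L by
  elements of L/4. The error is thus relative to \<open>hs\<close> itself, uniformly in x.\<close>

lemma hs_net:
  obtains Z where "finite Z" "Z \<subseteq> L" "\<And>x c. (\<And>z. z \<in> Z \<Longrightarrow> \<bar>dot n x z\<bar> \<le> c) \<Longrightarrow> hs n L x \<le> c + hs n L x / 4"
proof -
  obtain r where r: "r > 0" "\<And>x. x \<in> Rn n \<Longrightarrow> enorm n x \<le> r \<Longrightarrow> x \<in> L" using body unfolding sym_convex_body_iff by blast
  have LR: "L \<subseteq> Rn n" "compact L" using body by (auto simp: sym_convex_body_iff)
  define U where "U z = {w. enorm n (w - z) < r / 4}" for z
  have "open (U z)" for z
  proof -
    have "continuous_on UNIV (\<lambda>w. sqrt (dot n (w - z) (w - z)))" by (intro continuous_intros continuous_dot_self)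
    then show ?thesis unfolding U_def enorm_eq by (intro open_Collect_less continuous_on_const) auto
  qed
  moreover have "L \<subseteq> (\<Union>z\<in>L. U z)" using r(1) by (auto simp: U_def)
  ultimately obtain Z where Z: "Z \<subseteq> L" "finite Z" "L \<subseteq> (\<Union>z\<in>Z. U z)"
    using compactE_image[OF LR(2), of L U] by metis
  show ?thesis
  proof (rule that[OF Z(2,1)])
    fix x c assume c: "\<And>z. z \<in> Z \<Longrightarrow> \<bar>dot n x z\<bar> \<le> c"
    show "hs n L x \<le> c + hs n L x / 4"
    proof (rule hs_le[OF body])
      fix z assume z: "z \<in> L"
      then obtain z' where z': "z' \<in> Z" "enorm n (z - z') < r / 4" using Z(3) by (auto simp: U_def)
      have "4 *\<^sub>R (z - z') \<in> L" using r(2)[of "4 *\<^sub>R (z - z')"] z z' Z(1) LR(1) by (auto simp: subset_iff)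
      then have "\<bar>dot n x (4 *\<^sub>R (z - z'))\<bar> \<le> hs n L x" by (rule dot_le_hs[OF body])
      then have "4 * \<bar>dot n x (z - z')\<bar> \<le> hs n L x" by (simp add: abs_mult)
      moreover have "dot n x z = dot n x z' + dot n x (z - z')" by (simp add: dot_diff_right)
      ultimately show "\<bar>dot n x z\<bar> \<le> c + hs n L x / 4" using c[OF z'(1)] by linarith
    qed
  qed
qed

text \<open>On the span of the indicators of a finite partition the dual of \<open>L\<^sub>q\<close> is \<open>\<ell>\<^sub>p\<close>, for every \<open>q > 1\<close> (including
  \<open>q = \<infinity>\<close>); a partition fine enough for a finite net of \<open>L\<close> gives the support function up to a constant.\<close>

theorem support_function_discretization:
  assumes p: "p \<ge> 1" and pq: "1 / ennreal p + 1 / q = 1"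
  obtains J :: "((nat \<Rightarrow> real) \<Rightarrow> real) set" and v where "finite J" "\<And>j. j \<in> J \<Longrightarrow> v j \<in> Rn n"
    "\<And>x. (\<Sum>j\<in>J. \<bar>dot n x (v j)\<bar> powr p) \<le> hs n L x powr p"
    "\<And>x. hs n L x \<le> 10 * (\<Sum>j\<in>J. \<bar>dot n x (v j)\<bar> powr p) powr (1/p)"
proof -
  obtain Z where Z: "finite Z" "Z \<subseteq> L" "\<And>x c. (\<And>z. z \<in> Z \<Longrightarrow> \<bar>dot n x z\<bar> \<le> c) \<Longrightarrow> hs n L x \<le> c + hs n L x / 4"
    using hs_net by blast
  \<comment> \<open>The approximation may cost 1/4 of \<open>hs\<close> and the net another 1/4, so
    that half of it remains and 10 = 2 * 5. The 5 bounds 2 * 2 + 1/4.\<close>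
  define Q where "Q z f g \<longleftrightarrow> f \<in> Lq_space q \<and> \<pi> f = z \<and> simple_function unit_leb g \<and> g \<in> Lq_space q \<and>
      Lq_norm q (f - g) < 1/4 \<and> Lq_norm q g \<le> 5" for z f g
  have "\<forall>z\<in>Z. \<exists>f g. Q z f g"
  proof
    fix z assume "z \<in> Z"
    then have "z \<in> L" using Z(2) by blast
    then obtain f where f: "f \<in> Lq_space q" "\<pi> f = z" "Lq_norm q f < 2" using lift by blast
    obtain g where g: "simple_function unit_leb g" "g \<in> Lq_space q" "Lq_norm q (f - g) < 1/4"
      "Lq_norm q g \<le> 2 * Lq_norm q f + 1/4"
      using Lq_simple_approx[OF q f(1), of "1/4"] by auto
    have "Lq_norm q g \<le> 5" using g(4) f(3) by linarith
    then have "Q z f g" unfolding Q_def using f(1,2) g(1-3) by blast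
    then show "\<exists>f g. Q z f g" by blast
  qed
  then obtain f where "\<forall>z\<in>Z. \<exists>g. Q z (f z) g" by (rule bchoice[THEN exE])
  then obtain g where "\<forall>z\<in>Z. Q z (f z) (g z)" by (rule bchoice[THEN exE])
  then have fg: "\<And>z. z \<in> Z \<Longrightarrow> f z \<in> Lq_space q" "\<And>z. z \<in> Z \<Longrightarrow> \<pi> (f z) = z"
    "\<And>z. z \<in> Z \<Longrightarrow> simple_function unit_leb (g z)" "\<And>z. z \<in> Z \<Longrightarrow> g z \<in> Lq_space q"
    "\<And>z. z \<in> Z \<Longrightarrow> Lq_norm q (f z - g z) < 1/4" "\<And>z. z \<in> Z \<Longrightarrow> Lq_norm q (g z) \<le> 5"
    unfolding Q_def by blast+
  \<comment> \<open>The cells are the joint level sets of all the g z, each labelled by its vector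
    of values; hence g z takes the value j z on the cell j. Labels are set to 0 off Z, so that only
    finitely many occur.\<close>
  define G where "G \<omega> = (\<lambda>z. if z \<in> Z then g z \<omega> else 0)" for \<omega>
  define J where "J = G ` {0..1}"
  define A where "A j = {\<omega> \<in> {0..1}. G \<omega> = j}" for j
  have "J \<subseteq> (\<lambda>h z. if z \<in> Z then h z else 0) ` (Pi\<^sub>E Z (\<lambda>z. g z ` {0..1}))"
  proof
    fix j assume "j \<in> J"
    then obtain \<omega> where \<omega>: "\<omega> \<in> {0..1}" "j = G \<omega>" by (auto simp: J_def)
    have "j = (\<lambda>h z. if z \<in> Z then h z else 0) (restrict (\<lambda>z. g z \<omega>) Z)" by (auto simp: \<omega> G_def)
    moreover have "restrict (\<lambda>z. g z \<omega>) Z \<in> Pi\<^sub>E Z (\<lambda>z. g z ` {0..1})" using \<omega>(1) by auto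
    ultimately show "j \<in> (\<lambda>h z. if z \<in> Z then h z else 0) ` (Pi\<^sub>E Z (\<lambda>z. g z ` {0..1}))" by (rule image_eqI)
  qed
  moreover have "finite (Pi\<^sub>E Z (\<lambda>z. g z ` {0..1}))"
    using simple_functionD(1)[OF fg(3)] Z(1) by (intro finite_PiE) auto
  ultimately have J: "finite J" using finite_surj by blast
  have A: "A j \<in> sets unit_leb" if "j \<in> J" for j
  proof -
    have "{\<omega> \<in> space unit_leb. \<forall>z\<in>Z. g z \<omega> = j z} \<in> sets unit_leb"
    proof (rule sets.sets_Collect_finite_All[OF _ Z(1)])
      fix z assume "z \<in> Z"
      then have "g z -` {j z} \<inter> space unit_leb \<in> sets unit_leb"
        using simple_functionD(2)[OF fg(3)] by blast
      moreover have "g z -` {j z} \<inter> space unit_leb = {\<omega> \<in> space unit_leb. g z \<omega> = j z}" by auto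
      ultimately show "{\<omega> \<in> space unit_leb. g z \<omega> = j z} \<in> sets unit_leb" by simp
    qed
    moreover have "{\<omega> \<in> space unit_leb. \<forall>z\<in>Z. g z \<omega> = j z} = A j"
      using that by (auto simp: A_def G_def J_def fun_eq_iff)
    ultimately show ?thesis by simp
  qed
  have disj: "disjoint_family_on A J" by (auto simp: disjoint_family_on_def A_def)
  obtain v where v: "\<And>j. j \<in> J \<Longrightarrow> v j \<in> Rn n"
    "\<And>x. (\<Sum>j\<in>J. \<bar>dot n x (v j)\<bar> powr p) \<le> hs n L x powr p"
    "\<And>x a. \<bar>dot n x (\<pi> (step J A a))\<bar> \<le> Lq_norm q (step J A a) * (\<Sum>j\<in>J. \<bar>dot n x (v j)\<bar> powr p) powr (1/p)"
    using step_duality[OF J A disj p pq] by blast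
  show ?thesis
  proof (rule that[OF J v(1,2)])
    fix x
    define N where "N = (\<Sum>j\<in>J. \<bar>dot n x (v j)\<bar> powr p) powr (1/p)"
    have "\<bar>dot n x z\<bar> \<le> 5 * N + hs n L x / 4" if z: "z \<in> Z" for z
    proof -
      define s where "s = step J A (\<lambda>j. j z)"
      have s: "s \<in> Lq_space q" unfolding s_def by (rule step_Lq[OF J A disj])
      have gs: "g z \<omega> = s \<omega>" if "\<omega> \<in> {0..1}" for \<omega>
      proof -
        have "G \<omega> \<in> J" "\<omega> \<in> A (G \<omega>)" using that by (auto simp: J_def A_def)
        then have "s \<omega> = G \<omega> z" unfolding s_def using step_eq[OF J A disj, of "G \<omega>" \<omega> "\<lambda>j. j z"] by simp
        then show ?thesis using z by (simp add: G_def)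
      qed
      have ns: "Lq_norm q s = Lq_norm q (g z)" by (rule Lq_cong(2)[OF fg(4)[OF z]]) (rule gs)
      have fs: "f z - g z \<in> Lq_space q" by (rule Lq_diff[OF q fg(1)[OF z] fg(4)[OF z]])
      have "Lq_norm q (f z - s) = Lq_norm q (f z - g z)" by (rule Lq_cong(2)[OF fs]) (simp add: gs)
      then have "Lq_norm q (f z - s) \<le> 1/4" using fg(5)[OF z] by simp
      then have "hs n L x * Lq_norm q (f z - s) \<le> hs n L x * (1/4)" using hs_nonneg[OF body] by (intro mult_left_mono)
      then have 1: "\<bar>dot n x (\<pi> (f z - s))\<bar> \<le> hs n L x / 4"
        using dot_pi_le[OF Lq_diff[OF q fg(1)[OF z] s], of x] by simp
      have "\<bar>dot n x (\<pi> s)\<bar> \<le> Lq_norm q s * N" unfolding s_def N_def by (rule v(3))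
      also have "\<dots> \<le> 5 * N" unfolding ns using fg(6)[OF z] by (intro mult_right_mono) (auto simp: N_def)
      finally have 2: "\<bar>dot n x (\<pi> s)\<bar> \<le> 5 * N" .
      have "dot n x z = dot n x (\<pi> (f z - s)) + dot n x (\<pi> s)"
        using linear_diff[OF lin, of "f z" s] fg(2)[OF z] by (simp add: dot_diff_right)
      then show ?thesis using 1 2 by linarith
    qed
    then have "hs n L x \<le> 5 * N + hs n L x / 4 + hs n L x / 4" by (rule Z(3))
    then show "hs n L x \<le> 10 * N" by simp
  qed
qed

end

section \<open>Isotropic bodies\<close>

lemma body_nonempty: "sym_convex_body n K \<Longrightarrow> K \<noteq> {}"
  by (rule ex_in_conv[THEN iffD1], rule exI, rule body_zero)

text \<open>The supremum runs over uncountably many points, but its superlevel sets are unions of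
  open sets.\<close>

lemma borel_hs: "sym_convex_body n G \<Longrightarrow> hs n G \<in> borel_measurable borel"
proof -
  assume G: "sym_convex_body n G"
  have "{x. a < hs n G x} \<in> sets borel" for a
  proof -
    have "a < hs n G x \<longleftrightarrow> (\<exists>z\<in>G. a < \<bar>dot n x z\<bar>)" for x
      unfolding hs_def by (rule less_cSUP_iff[OF body_nonempty[OF G] body_bdd_dot[OF G]])
    then have "{x. a < hs n G x} = (\<Union>z\<in>G. {x. a < \<bar>dot n x z\<bar>})" by blast
    moreover have "open {x. a < \<bar>dot n x z\<bar>}" for z
      by (rule open_Collect_less[OF continuous_on_const continuous_on_rabs[OF continuous_dot]])
    ultimately show ?thesis by (auto intro!: borel_open)
  qed
  then show ?thesis by (simp add: borel_measurable_iff_greater)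
qed

lemma body_norm_polar:
  assumes G: "sym_convex_body n G" and x: "x \<in> Rn n"
  shows "body_norm (polar n G) x = hs n G x"
proof -
  have "{t. 0 < t \<and> x \<in> (\<lambda>y. t *\<^sub>R y) ` polar n G} = {t. 0 < t \<and> hs n G x \<le> t}"
  proof (intro Collect_cong conj_cong refl)
    fix t :: real assume t: "0 < t"
    show "x \<in> (\<lambda>y. t *\<^sub>R y) ` polar n G \<longleftrightarrow> hs n G x \<le> t"
    proof
      assume "x \<in> (\<lambda>y. t *\<^sub>R y) ` polar n G"
      then obtain y where y: "y \<in> polar n G" "x = t *\<^sub>R y" by blast
      show "hs n G x \<le> t"
      proof (rule hs_le[OF G])
        fix z assume "z \<in> G"
        then have "\<bar>dot n z y\<bar> \<le> 1" using y(1) by (simp add: polar_def)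
        then show "\<bar>dot n x z\<bar> \<le> t" using t by (simp add: y(2) abs_mult dot_commute[of n y z])
      qed
    next
      assume h: "hs n G x \<le> t"
      have "\<bar>dot n z ((1/t) *\<^sub>R x)\<bar> \<le> 1" if "z \<in> G" for z
        using dot_le_hs[OF G that, of x] h t by (simp add: abs_mult dot_commute[of n x z] divide_le_eq)
      then have "(1/t) *\<^sub>R x \<in> polar n G" using x by (simp add: polar_def)
      moreover have "x = t *\<^sub>R ((1/t) *\<^sub>R x)" using t by simp
      ultimately show "x \<in> (\<lambda>y. t *\<^sub>R y) ` polar n G" by blast
    qed
  qed
  moreover have "Inf {t. 0 < t \<and> hs n G x \<le> t} = hs n G x"
  proof (rule cInf_eq_non_empty)
    show "{t. 0 < t \<and> hs n G x \<le> t} \<noteq> {}" by (rule ex_in_conv[THEN iffD1], rule exI[of _ "\<bar>hs n G x\<bar> + 1"]) auto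
    fix y assume y: "\<And>t. t \<in> {t. 0 < t \<and> hs n G x \<le> t} \<Longrightarrow> y \<le> t"
    show "y \<le> hs n G x"
    proof (rule field_le_epsilon)
      fix e :: real assume "e > 0"
      then show "y \<le> hs n G x + e" using hs_nonneg[OF G, of x] by (intro y) auto
    qed
  qed auto
  ultimately show ?thesis by (simp add: body_norm_def)
qed

lemma hs_sphere_bound:
  assumes "sym_convex_body n G" obtains R where "\<And>x. x \<in> unit_sphere n \<Longrightarrow> hs n G x \<le> R"
proof -
  obtain R where R: "R > 0" "\<And>z. z \<in> G \<Longrightarrow> enorm n z \<le> R" using body_bounded[OF assms] by blast
  have "hs n G x \<le> R" if x: "x \<in> unit_sphere n" for x
  proof (rule hs_le[OF assms])
    fix z assume "z \<in> G"
    then show "\<bar>dot n x z\<bar> \<le> R" using dot_le[of n x z] R(2)[of z] x by (simp add: unit_sphere_iff)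
  qed
  then show ?thesis using that by blast
qed

text \<open>\<open>M_mean\<close> is a Bochner integral, which would be 0 by convention for a
  function that is not integrable. Boundedness of \<open>hs\<close> on the sphere rules this out and
  lets bounds on the non-negative integral be transferred.\<close>

lemma M_star_finite_ge:
  assumes \<sigma>: "haar_sphere n \<sigma>" and G: "sym_convex_body n G" and p: "p \<ge> 1" and X: "X \<ge> 0"
    and le: "ennreal (X powr p) \<le> (\<integral>\<^sup>+x. ennreal (hs n G x powr p) \<partial>\<sigma>)"
  shows "X \<le> M_star n \<sigma> (ennreal p) G"
proof -
  interpret prob_space \<sigma> using \<sigma> by (simp add: haar_sphere_def)
  have sp: "space \<sigma> = unit_sphere n" by (rule space_haar[OF \<sigma>])
  obtain R where R: "\<And>x. x \<in> unit_sphere n \<Longrightarrow> hs n G x \<le> R" using hs_sphere_bound[OF G] by blast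
  have m: "(\<lambda>x. hs n G x powr p) \<in> borel_measurable \<sigma>"
    by (rule haar_measurable[OF \<sigma>]) (use borel_hs[OF G] in measurable)
  have int: "integrable \<sigma> (\<lambda>x. hs n G x powr p)"
  proof (rule integrable_const_bound[OF AE_I2 m])
    fix x assume "x \<in> space \<sigma>"
    then have "hs n G x \<le> R" using R sp by blast
    then have "hs n G x powr p \<le> R powr p" using hs_nonneg[OF G, of x] p by (intro powr_mono2) auto
    then show "norm (hs n G x powr p) \<le> R powr p" by simp
  qed
  have "ennreal (X powr p) \<le> ennreal (LINT x|\<sigma>. hs n G x powr p)"
    using le nn_integral_eq_integral[OF int] by simp
  then have "X powr p \<le> (LINT x|\<sigma>. hs n G x powr p)" by (simp add: integral_nonneg_AE)
  also have "\<dots> = (LINT x|\<sigma>. body_norm (polar n G) x powr p)"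
    using sp by (intro Bochner_Integration.integral_cong) (auto simp: body_norm_polar[OF G] unit_sphere_def)
  finally have "(X powr p) powr (1/p) \<le> (LINT x|\<sigma>. body_norm (polar n G) x powr p) powr (1/p)"
    using p by (intro powr_mono2) auto
  moreover have "(X powr p) powr (1/p) = X" using X p by (simp add: powr_powr)
  ultimately show ?thesis using p by (simp add: M_star_def M_mean_def)
qed

lemma body_farthest:
  assumes G: "sym_convex_body n G" obtains z where "z \<in> G" "\<And>y. y \<in> G \<Longrightarrow> enorm n y \<le> enorm n z"
proof -
  have "compact G" using G by (simp add: sym_convex_body_iff)
  then have "\<exists>z\<in>G. \<forall>y\<in>G. enorm n y \<le> enorm n z"
    by (rule continuous_attains_sup[OF _ body_nonempty[OF G] continuous_enorm])
  then show ?thesis using that by blast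
qed

text \<open>\<open>hs n G\<close> dominates the functional of z, whose p-th moment is of order |z|
  as soon as p >= n, since then min p n / n = 1. At p = \<infinity> the direction of z is
  tested.\<close>

lemma M_star_ge_radius:
  assumes n: "n \<ge> 1" and \<sigma>: "haar_sphere n \<sigma>" and G: "sym_convex_body n G" and p: "of_nat n \<le> p" and z: "z \<in> G"
  shows "enorm n z / 4 ^ 33 \<le> M_star n \<sigma> p G"
proof (cases "p = \<infinity>")
  case True
  have zR: "z \<in> Rn n" using G z by (auto simp: sym_convex_body_iff)
  have M: "M_star n \<sigma> p G = (SUP x\<in>unit_sphere n. hs n G x)"
    unfolding M_star_def M_mean_def using True by (auto intro!: SUP_cong simp: body_norm_polar[OF G] unit_sphere_def)
  obtain R where R: "\<And>x. x \<in> unit_sphere n \<Longrightarrow> hs n G x \<le> R" using hs_sphere_bound[OF G] by blast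
  have bdd: "bdd_above (hs n G ` unit_sphere n)" using R by (rule bdd_aboveI2)
  have "enorm n z \<le> M_star n \<sigma> p G"
  proof (cases "z = 0")
    case True
    have b: "basis 0 \<in> unit_sphere n" using n by (intro basis_unit_sphere) simp
    have "0 \<le> hs n G (basis 0)" by (rule hs_nonneg[OF G])
    also have "\<dots> \<le> M_star n \<sigma> p G" unfolding M by (rule cSUP_upper[OF b bdd])
    finally show ?thesis using True by simp
  next
    case False
    then have z0: "enorm n z > 0" using enorm_eq_0[OF zR] enorm_nonneg[of n z] by linarith
    define x where "x = (1 / enorm n z) *\<^sub>R z"
    have x: "x \<in> unit_sphere n" using z0 zR by (simp add: x_def unit_sphere_iff)
    have "enorm n z = \<bar>dot n x z\<bar>" using z0 by (simp add: x_def dot_self power2_eq_square)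
    also have "\<dots> \<le> hs n G x" by (rule dot_le_hs[OF G z])
    also have "\<dots> \<le> M_star n \<sigma> p G" unfolding M by (rule cSUP_upper[OF x bdd])
    finally show ?thesis .
  qed
  moreover have "enorm n z / 4 ^ 33 \<le> enorm n z" using enorm_nonneg[of n z] by simp
  ultimately show ?thesis by linarith
next
  case False
  then obtain r where r: "p = ennreal r" "r \<ge> 0" by (cases p) auto
  have rn: "real n \<le> r" using p r by (simp add: ennreal_of_nat_eq_real_of_nat)
  then have r1: "r \<ge> 1" using n by simp
  have zR: "z \<in> Rn n" using G z by (auto simp: sym_convex_body_iff)
  have "ennreal ((1 / 4 ^ 33 * sqrt (min r n / n) * enorm n z) powr r) \<le> dot_moment n r \<sigma> z"
    by (rule dot_moment_ge[OF n \<sigma> r1 zR])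
  also have "\<dots> \<le> (\<integral>\<^sup>+x. ennreal (hs n G x powr r) \<partial>\<sigma>)"
    unfolding dot_moment_def using dot_le_hs[OF G z] r1 by (intro nn_integral_mono ennreal_leI powr_mono2) auto
  finally have le: "ennreal ((1 / 4 ^ 33 * sqrt (min r n / n) * enorm n z) powr r) \<le> (\<integral>\<^sup>+x. ennreal (hs n G x powr r) \<partial>\<sigma>)" .
  have "0 \<le> 1 / 4 ^ 33 * sqrt (min r n / n) * enorm n z"
    using r1 by (intro mult_nonneg_nonneg real_sqrt_ge_zero divide_nonneg_nonneg) auto
  then have "1 / 4 ^ 33 * sqrt (min r n / n) * enorm n z \<le> M_star n \<sigma> p G"
    unfolding r(1) by (rule M_star_finite_ge[OF \<sigma> G r1 _ le])
  moreover have "sqrt (min r n / n) = 1" using rn n by simp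
  ultimately show ?thesis by simp
qed

section \<open>Triangular factorisation of linear maps\<close>

definition orthonormal :: "nat \<Rightarrow> (nat \<Rightarrow> nat \<Rightarrow> real) \<Rightarrow> bool" where
  "orthonormal n v \<longleftrightarrow> (\<forall>i<n. v i \<in> Rn n) \<and> (\<forall>i<n. \<forall>j<n. dot n (v i) (v j) = (if i = j then 1 else 0))"

text \<open>Besides v and u the induction carries preimages a i of the v i, supported on the
  coordinates up to i. So the preimage b of the new residual w has k-th coordinate 1; by injectivity
  w is not 0, and its length becomes the positive diagonal entry.\<close>

lemma gram_schmidt:
  assumes T: "T \<in> GL n"
  obtains v u where "orthonormal n v" "\<forall>i<n. T (basis i) = (\<Sum>j<n. u j i *\<^sub>R v j)"
    "\<forall>i<n. 0 < u i i" "\<forall>i<n. \<forall>j>i. u j i = (0 :: real)"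
proof -
  have lin: "linear T" and inj: "inj_on T (Rn n)" using T by (auto simp: GL_def bij_betw_def)
  have "\<exists>v u a. (\<forall>i<k. v i \<in> Rn n \<and> a i \<in> Rn n \<and> v i = T (a i) \<and> (\<forall>l>i. a i l = 0)) \<and>
     (\<forall>i<k. \<forall>j<k. dot n (v i) (v j) = (if i = j then 1 else 0)) \<and>
     (\<forall>i<k. T (basis i) = (\<Sum>j<n. u j i *\<^sub>R v j) \<and> u i i > 0 \<and> (\<forall>j>i. u j i = 0))" if "k \<le> n" for k
    using that
  proof (induction k)
    case 0
    then show ?case by simp
  next
    case (Suc k)
    have "k \<le> n" using Suc.prems by simp
    from Suc.IH[OF this] obtain v u a where
      IH1: "\<forall>i<k. v i \<in> Rn n \<and> a i \<in> Rn n \<and> v i = T (a i) \<and> (\<forall>l>i. a i l = 0)"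
      and IH2: "\<forall>i<k. \<forall>j<k. dot n (v i) (v j) = (if i = j then 1 else 0)"
      and IH3: "\<forall>i<k. T (basis i) = (\<Sum>j<n. u j i *\<^sub>R v j) \<and> u i i > 0 \<and> (\<forall>j>i. u j i = 0)"
      by (elim exE conjE) (rule that, assumption+)
    have IH: "\<And>i. i < k \<Longrightarrow> v i \<in> Rn n" "\<And>i. i < k \<Longrightarrow> a i \<in> Rn n" "\<And>i. i < k \<Longrightarrow> v i = T (a i)"
      "\<And>i l. i < k \<Longrightarrow> l > i \<Longrightarrow> a i l = 0"
      "\<And>i j. i < k \<Longrightarrow> j < k \<Longrightarrow> dot n (v i) (v j) = (if i = j then 1 else 0)"
      "\<And>i. i < k \<Longrightarrow> T (basis i) = (\<Sum>j<n. u j i *\<^sub>R v j)" "\<And>i. i < k \<Longrightarrow> u i i > 0" "\<And>i j. i < k \<Longrightarrow> j > i \<Longrightarrow> u j i = 0"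
      using IH1 IH2 IH3 by blast+
    have k: "k < n" using Suc.prems by simp
    define c where "c j = dot n (v j) (T (basis k))" for j
    define b where "b = basis k - (\<Sum>j<k. c j *\<^sub>R a j)"
    define w where "w = T (basis k) - (\<Sum>j<k. c j *\<^sub>R v j)"
    have bR: "b \<in> Rn n" unfolding b_def by (intro Rn_diff Rn_sum Rn_scaleR basis_Rn k IH(2)) simp
    have wT: "w = T b" unfolding w_def b_def linear_diff[OF lin] linear_sum[OF lin] linear_scale[OF lin]
      using IH(3) by simp
    have wR: "w \<in> Rn n" unfolding wT by (rule GL_in_Rn[OF T bR])
    have bl: "b l = (if l = k then 1 else 0)" if "l \<ge> k" for l
      using IH(4) that by (simp add: b_def sum_fun_apply scaleR_fun_def basis_def)
    have "b k \<noteq> 0" using bl[of k] by simp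
    then have "b \<noteq> 0" by auto
    then have "w \<noteq> 0" using inj_onD[OF inj, of b 0] bR linear_0[OF lin] by (auto simp: wT)
    then have w0: "enorm n w > 0" using enorm_eq_0[OF wR] enorm_nonneg[of n w] by linarith
    have orth: "dot n (v i) w = 0" if "i < k" for i
    proof -
      have "dot n (v i) w = c i - (\<Sum>j<k. c j * dot n (v i) (v j))"
        by (simp add: w_def dot_diff_right dot_sum_right c_def)
      also have "(\<Sum>j<k. c j * dot n (v i) (v j)) = (\<Sum>j<k. if i = j then c j else 0)"
        using IH(5) that by (intro sum.cong) auto
      finally show ?thesis using that by simp
    qed
    define v' where "v' = v(k := (1 / enorm n w) *\<^sub>R w)"
    define a' where "a' = a(k := (1 / enorm n w) *\<^sub>R b)"
    \<comment> \<open>The sums run up to n although only k + 1 vectors exist so far. The entries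
      below the diagonal are 0, so the later v j may be arbitrary.\<close>
    define u' where "u' j i = (if i < k then u j i else if j < k then c j else if j = k then enorm n w else 0)" for j i
    have v'k: "v' k = (1 / enorm n w) *\<^sub>R w" and v'l: "\<And>i. i < k \<Longrightarrow> v' i = v i" by (auto simp: v'_def)
    have a'k: "a' k = (1 / enorm n w) *\<^sub>R b" and a'l: "\<And>i. i < k \<Longrightarrow> a' i = a i" by (auto simp: a'_def)
    have 1: "v' i \<in> Rn n \<and> a' i \<in> Rn n \<and> v' i = T (a' i) \<and> (\<forall>l>i. a' i l = 0)" if "i < Suc k" for i
    proof (cases "i = k")
      case True
      have "v' k \<in> Rn n" "a' k \<in> Rn n" unfolding v'k a'k by (rule Rn_scaleR[OF wR], rule Rn_scaleR[OF bR])
      moreover have "v' k = T (a' k)" by (simp only: v'k a'k wT linear_scale[OF lin])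
      moreover have "\<forall>l>k. a' k l = 0" using bl by (simp add: a'k scaleR_fun_def)
      ultimately show ?thesis using True by blast
    next
      case False
      then have "i < k" using that by simp
      then show ?thesis using IH(1-4) by (simp add: v'l a'l)
    qed
    have 2: "dot n (v' i) (v' j) = (if i = j then 1 else 0)" if ij: "i < Suc k" "j < Suc k" for i j
    proof (cases "i = k"; cases "j = k")
      assume "i = k" "j = k"
      then show ?thesis using w0 by (simp add: v'k dot_self power2_eq_square)
    next
      assume "i = k" "j \<noteq> k"
      then show ?thesis using ij orth[of j] by (simp add: v'k v'l dot_commute[of n w])
    next
      assume "i \<noteq> k" "j = k"
      then show ?thesis using ij orth[of i] by (simp add: v'k v'l)
    next
      assume "i \<noteq> k" "j \<noteq> k"
      then show ?thesis using ij IH(5) by (simp add: v'l)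
    qed
    have 3: "T (basis i) = (\<Sum>j<n. u' j i *\<^sub>R v' j) \<and> u' i i > 0 \<and> (\<forall>j>i. u' j i = 0)" if "i < Suc k" for i
    proof (cases "i = k")
      case True
      have "(\<Sum>j<n. u' j k *\<^sub>R v' j) = (\<Sum>j<Suc k. u' j k *\<^sub>R v' j)"
        using k by (intro sum.mono_neutral_right) (auto simp: u'_def)
      also have "\<dots> = (\<Sum>j<k. u' j k *\<^sub>R v' j) + u' k k *\<^sub>R v' k" by (rule sum.lessThan_Suc)
      also have "u' k k *\<^sub>R v' k = w"
      proof -
        have "u' k k = enorm n w" by (simp add: u'_def)
        then have "u' k k *\<^sub>R v' k = (enorm n w * (1 / enorm n w)) *\<^sub>R w" by (simp only: v'k scaleR_scaleR)
        also have "enorm n w * (1 / enorm n w) = 1" using w0 by simp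
        finally show ?thesis by (simp only: scaleR_one)
      qed
      also have "(\<Sum>j<k. u' j k *\<^sub>R v' j) = (\<Sum>j<k. c j *\<^sub>R v j)" by (intro sum.cong) (auto simp: u'_def v'l)
      also have "(\<Sum>j<k. c j *\<^sub>R v j) + w = T (basis k)" by (simp add: w_def)
      finally show ?thesis using True w0 by (simp add: u'_def)
    next
      case False
      then have i: "i < k" using that by simp
      have "(\<Sum>j<n. u' j i *\<^sub>R v' j) = (\<Sum>j<n. u j i *\<^sub>R v j)"
      proof (rule sum.cong[OF refl])
        fix j show "u' j i *\<^sub>R v' j = u j i *\<^sub>R v j"
          using i IH(8)[OF i] by (cases "j = k") (auto simp: u'_def v'_def)
      qed
      then show ?thesis using i IH(6-8)[OF i] by (simp add: u'_def)
    qed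
    show ?case using 1 2 3 by blast
  qed
  from this[OF order_refl] obtain v u a where
    1: "\<forall>i<n. v i \<in> Rn n \<and> a i \<in> Rn n \<and> v i = T (a i) \<and> (\<forall>l>i. a i l = 0)"
    and 2: "\<forall>i<n. \<forall>j<n. dot n (v i) (v j) = (if i = j then 1 else 0)"
    and 3: "\<forall>i<n. T (basis i) = (\<Sum>j<n. u j i *\<^sub>R v j) \<and> u i i > 0 \<and> (\<forall>j>i. u j i = 0)"
    by (elim exE conjE) (rule that, assumption+)
  show ?thesis
  proof (rule that[of v u])
    show "orthonormal n v" unfolding orthonormal_def using 1 2 by blast
  qed (use 3 in blast)+
qed

text \<open>For orthonormal v this is the orthogonal map taking \<open>basis i\<close> to v i, the V
  of the overview.\<close>

definition frame_map :: "nat \<Rightarrow> (nat \<Rightarrow> nat \<Rightarrow> real) \<Rightarrow> (nat \<Rightarrow> real) \<Rightarrow> nat \<Rightarrow> real" where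
  "frame_map n v x = (\<Sum>i<n. x i *\<^sub>R v i)"

lemma frame_map_Rn: "orthonormal n v \<Longrightarrow> frame_map n v x \<in> Rn n"
  unfolding frame_map_def by (intro Rn_sum Rn_scaleR) (auto simp: orthonormal_def)

lemma frame_map_dot_left: "dot n (frame_map n v x) y = (\<Sum>i<n. x i * dot n (v i) y)"
  unfolding frame_map_def dot_sum_left dot_scaleR_left ..

lemma frame_map_dot:
  assumes v: "orthonormal n v" shows "dot n (frame_map n v x) (frame_map n v y) = dot n x y"
proof -
  have "dot n (v i) (frame_map n v y) = y i" if i: "i < n" for i
  proof -
    have "dot n (v i) (frame_map n v y) = (\<Sum>j<n. y j * dot n (v i) (v j))"
      unfolding frame_map_def dot_sum_right dot_scaleR_right ..
    also have "\<dots> = (\<Sum>j<n. if i = j then y j else 0)"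
      using v i by (intro sum.cong) (auto simp: orthonormal_def)
    finally show ?thesis using i by simp
  qed
  then show ?thesis unfolding frame_map_dot_left dot_def[of n x y] by (intro sum.cong) auto
qed

lemma frame_map_enorm: "orthonormal n v \<Longrightarrow> enorm n (frame_map n v x) = enorm n x"
  by (simp add: enorm_eq frame_map_dot)

text \<open>By Hadamard's argument the diagonal of the triangular factor of \<open>T\<close> has product \<open>1\<close>, so its sum is
  at least \<open>n\<close>.\<close>

lemma SL_frame:
  assumes n: "n \<ge> 1" and T: "T \<in> SL n"
  obtains v where "orthonormal n v" "real n \<le> (\<Sum>i<n. dot n (v i) (T (basis i)))"
proof -
  have G: "T \<in> GL n" and pres: "\<And>A. A \<in> sets (leb n) \<Longrightarrow> emeasure (leb n) (T ` A) = emeasure (leb n) A"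
    using T by (auto simp: SL_def)
  have lin: "linear T" using G by (simp add: GL_def)
  obtain v u where v: "orthonormal n v" and Tu': "\<forall>i<n. T (basis i) = (\<Sum>j<n. u j i *\<^sub>R v j)"
    and upos': "\<forall>i<n. 0 < u i i" and u0': "\<forall>i<n. \<forall>j>i. u j i = (0 :: real)"
    by (rule gram_schmidt[OF G])
  have on: "dot n (v i) (v j) = (if i = j then 1 else 0)" if "i < n" "j < n" for i j
    using v that unfolding orthonormal_def by blast
  note Tu = Tu'[rule_format] and upos = upos'[rule_format] and u0 = u0'[rule_format]
  define V where "V = frame_map n v"
  have Tx: "T x = V (tri_map n u 0 x)" if x: "x \<in> Rn n" for x
  proof -
    have "T x = (\<Sum>i<n. x i *\<^sub>R (\<Sum>j<n. u j i *\<^sub>R v j))" unfolding linear_eq_sum[OF lin x] using Tu by (intro sum.cong) auto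
    also have "\<dots> = (\<Sum>i<n. \<Sum>j<n. (u j i * x i) *\<^sub>R v j)" by (simp only: scaleR_sum_right scaleR_scaleR mult.commute)
    also have "\<dots> = (\<Sum>j<n. \<Sum>i<n. (u j i * x i) *\<^sub>R v j)" by (rule sum.swap)
    also have "\<dots> = (\<Sum>j<n. (\<Sum>i<n. u j i * x i) *\<^sub>R v j)" by (simp only: scaleR_sum_left)
    also have "\<dots> = (\<Sum>j<n. tri_map n u 0 x j *\<^sub>R v j)"
    proof (rule sum.cong[OF refl])
      fix j assume j: "j \<in> {..<n}"
      have "(\<Sum>i\<in>{j..<n}. u j i * x i) = (\<Sum>i<n. u j i * x i)"
        using u0 by (intro sum.mono_neutral_left) (auto simp: not_le)
      then show "(\<Sum>i<n. u j i * x i) *\<^sub>R v j = tri_map n u 0 x j *\<^sub>R v j" using j by (simp add: tri_map_def)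
    qed
    finally show ?thesis by (simp add: V_def frame_map_def)
  qed
  have triR: "tri_map n u 0 x \<in> Rn n" for x by (simp add: tri_map_def Rn_iff)
  have Vlin: "linear V" unfolding V_def frame_map_def[abs_def] by (rule linear_sum_scaleR)
  have VR: "V x \<in> Rn n" for x unfolding V_def by (rule frame_map_Rn[OF v])
  have Ven: "enorm n (V x) = enorm n x" for x unfolding V_def by (rule frame_map_enorm[OF v])
  have "inj_on V (Rn n)"
  proof (rule inj_onI)
    fix x y assume xy: "x \<in> Rn n" "y \<in> Rn n" "V x = V y"
    then have "V (x - y) = 0" by (simp add: linear_diff[OF Vlin])
    then have "enorm n (x - y) = 0" using Ven[of "x - y"] by simp
    then show "x = y" using enorm_eq_0[of "x - y" n] xy by simp
  qed
  moreover have "V ` Rn n = Rn n"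
  proof
    show "V ` Rn n \<subseteq> Rn n" using VR by blast
    show "Rn n \<subseteq> V ` Rn n"
    proof
      fix y assume "y \<in> Rn n"
      then obtain x where "x \<in> Rn n" "y = T x" using G unfolding GL_def bij_betw_def by blast
      then show "y \<in> V ` Rn n" using Tx triR by blast
    qed
  qed
  ultimately have "V \<in> GL n" using Vlin by (simp add: GL_def bij_betw_def)
  then have Vo: "orthogonal_on n V" by (simp add: orthogonal_on_def V_def frame_map_dot[OF v])
  obtain d where d: "d > 0" "\<And>f. f \<in> borel_measurable (leb n) \<Longrightarrow> (\<integral>\<^sup>+x. f x \<partial>leb n) = ennreal d * (\<integral>\<^sup>+x. f (T x) \<partial>leb n)"
    using GL_change_of_variables[OF G] by metis
  \<comment> \<open>Members of \<open>SL\<close> are given by preservation of volumes, so the unit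
    cube suffices to find the Jacobian.\<close>
  have "ennreal d * 1 = 1"
    using emeasure_GL_image[OF G d(2) cube_sets[of n "1/2"]] pres[OF cube_sets[of n "1/2"]] emeasure_unit_cube[of n] by simp
  then have d1: "ennreal d = 1" by simp
  define f :: "(nat \<Rightarrow> real) \<Rightarrow> ennreal" where "f = indicator (cube n (1/2))"
  have f: "f \<in> borel_measurable (leb n)" unfolding f_def by measurable
  have f1: "(\<integral>\<^sup>+x. f x \<partial>leb n) = 1" using emeasure_unit_cube[of n] by (simp add: f_def)
  have fV: "(\<lambda>x. f (V x)) \<in> borel_measurable (leb n)" by (rule measurable_compose[OF GL_measurable[OF \<open>V \<in> GL n\<close>] f])
  \<comment> \<open>T is V after the triangular map. Both T and V preserve the integral of f, so the
    Jacobian of the triangular map, the product of its diagonal, is 1.\<close>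
  have "(\<Prod>j<n. ennreal \<bar>u j j\<bar>) * (\<integral>\<^sup>+x. f (V (tri_map n u 0 x)) \<partial>leb n) = (\<integral>\<^sup>+x. f (V x) \<partial>leb n)"
    by (rule nn_integral_leb_tri[OF fV]) (use upos in fastforce)
  also have "\<dots> = 1" using nn_integral_leb_orthogonal[OF n Vo f] f1 by simp
  also have "(\<integral>\<^sup>+x. f (V (tri_map n u 0 x)) \<partial>leb n) = (\<integral>\<^sup>+x. f (T x) \<partial>leb n)"
    by (intro nn_integral_cong) (simp add: Tx)
  also have "\<dots> = 1" using d(2)[OF f] f1 d1 by simp
  finally have "(\<Prod>j<n. ennreal \<bar>u j j\<bar>) = 1" by simp
  moreover have "(\<Prod>j<n. ennreal \<bar>u j j\<bar>) = ennreal (\<Prod>j<n. u j j)"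
    using upos by (subst prod_ennreal[symmetric]) (auto intro!: prod.cong simp: less_imp_le)
  ultimately have prod1: "(\<Prod>j<n. u j j) = 1" by (simp add: ennreal_eq_1)
  have "0 = ln (\<Prod>j<n. u j j)" by (simp add: prod1)
  also have "\<dots> = (\<Sum>j<n. ln (u j j))" using upos by (intro ln_prod) fastforce+
  also have "\<dots> \<le> (\<Sum>j<n. u j j - 1)" using upos by (intro sum_mono ln_le_minus_one) auto
  finally have "real n \<le> (\<Sum>j<n. u j j)" by (simp add: sum_subtractf)
  also have "\<dots> = (\<Sum>i<n. dot n (v i) (T (basis i)))"
  proof (rule sum.cong[OF refl])
    fix i assume i: "i \<in> {..<n}"
    have "dot n (v i) (T (basis i)) = (\<Sum>j<n. u j i * dot n (v i) (v j))" using Tu[of i] i by (simp add: dot_sum_right)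
    also have "\<dots> = (\<Sum>j<n. if i = j then u j i else 0)" using on i by (intro sum.cong) auto
    finally show "u i i = dot n (v i) (T (basis i))" using i by simp
  qed
  finally show ?thesis using that v by blast
qed

text \<open>Homogeneity extends the hypothesis from the sphere to all vectors and polarisation
  extends it to pairs: the covariance form of K is c times the inner product.\<close>

lemma isotropic_bilinear:
  assumes K: "sym_convex_body n K" and iso: "\<And>\<theta>. \<theta> \<in> unit_sphere n \<Longrightarrow> (LINT x:K|leb n. (dot n x \<theta>)\<^sup>2) = c"
    and y: "y \<in> Rn n" and z: "z \<in> Rn n"
  shows "(LINT x:K|leb n. (dot n x y)\<^sup>2) = c * (enorm n y)\<^sup>2"
    and "(LINT x:K|leb n. dot n x y * dot n x z) = c * dot n y z"
    and "set_integrable (leb n) K (\<lambda>x. dot n x y * dot n x z)"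
proof -
  obtain R where R: "R > 0" "\<And>x y. x \<in> K \<Longrightarrow> \<bar>dot n x y\<bar> \<le> R * enorm n y" using body_dot_bound[OF K] by blast
  have int: "set_integrable (leb n) K (\<lambda>x. dot n x y * dot n x z)" for y z
  proof (rule body_integrable[OF K])
    fix x assume "x \<in> K"
    then show "\<bar>dot n x y * dot n x z\<bar> \<le> (R * enorm n y) * (R * enorm n z)" unfolding abs_mult
      using R by (intro mult_mono) auto
  qed measurable
  then show "set_integrable (leb n) K (\<lambda>x. dot n x y * dot n x z)" .
  have sq: "(LINT x:K|leb n. (dot n x y)\<^sup>2) = c * (enorm n y)\<^sup>2" if y: "y \<in> Rn n" for y
  proof (cases "y = 0")
    case True
    then show ?thesis by (simp add: set_lebesgue_integral_def)
  next
    case False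
    then have y0: "enorm n y > 0" using enorm_eq_0[OF y] enorm_nonneg[of n y] by linarith
    define \<theta> where "\<theta> = (1 / enorm n y) *\<^sub>R y"
    have \<theta>: "\<theta> \<in> unit_sphere n" using y y0 by (simp add: \<theta>_def unit_sphere_iff)
    have "dot n x y = enorm n y * dot n x \<theta>" for x using y0 by (simp add: \<theta>_def)
    then have "(LINT x:K|leb n. (dot n x y)\<^sup>2) = (LINT x:K|leb n. (enorm n y)\<^sup>2 * (dot n x \<theta>)\<^sup>2)"
      by (simp add: power_mult_distrib)
    also have "\<dots> = (enorm n y)\<^sup>2 * c" using iso[OF \<theta>] by simp
    finally show ?thesis by (simp add: mult.commute)
  qed
  then show "(LINT x:K|leb n. (dot n x y)\<^sup>2) = c * (enorm n y)\<^sup>2" using y .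
  have "(LINT x:K|leb n. (dot n x (y + z))\<^sup>2) = (LINT x:K|leb n. (dot n x y)\<^sup>2 + (dot n x z)\<^sup>2 + 2 * (dot n x y * dot n x z))"
    by (simp add: dot_add_right power2_sum mult.assoc)
  also have "\<dots> = (LINT x:K|leb n. (dot n x y)\<^sup>2) + (LINT x:K|leb n. (dot n x z)\<^sup>2) + 2 * (LINT x:K|leb n. dot n x y * dot n x z)"
    using int[of y y] int[of z z] int[of y z]
    by (subst set_integral_add set_integral_add(1), simp_all add: power2_eq_square)+
  finally have "c * (enorm n (y + z))\<^sup>2 = c * (enorm n y)\<^sup>2 + c * (enorm n z)\<^sup>2 + 2 * (LINT x:K|leb n. dot n x y * dot n x z)"
    using sq[of "y + z"] sq[OF y] sq[OF z] y z by simp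
  then show "(LINT x:K|leb n. dot n x y * dot n x z) = c * dot n y z"
    by (simp add: enorm_add_sq algebra_simps)
qed

section \<open>Transposes and the value of the isotropic constant\<close>

definition transp :: "nat \<Rightarrow> ((nat \<Rightarrow> real) \<Rightarrow> nat \<Rightarrow> real) \<Rightarrow> (nat \<Rightarrow> real) \<Rightarrow> nat \<Rightarrow> real" where
  "transp n T y = (\<lambda>k. if k < n then dot n (T (basis k)) y else 0)"

lemma transp_Rn: "transp n T y \<in> Rn n"
  by (simp add: transp_def Rn_iff)

lemma transp_scaleR: "transp n T (a *\<^sub>R y) = a *\<^sub>R transp n T y"
proof
  have scale: "(a *\<^sub>R f) k = a * f k" for f :: "nat \<Rightarrow> real" and k by (simp add: scaleR_fun_def)
  show "transp n T (a *\<^sub>R y) k = (a *\<^sub>R transp n T y) k" for k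
    unfolding scale transp_def dot_scaleR_right by simp
qed

lemma dot_transp: "linear T \<Longrightarrow> x \<in> Rn n \<Longrightarrow> dot n (T x) y = dot n x (transp n T y)"
  unfolding linear_eq_sum[of T x n] dot_sum_left by (simp add: dot_def[of n x] transp_def)

text \<open>For g >= 0 both sides are \<open>enn2real\<close> of a non-negative integral, so the
  change of variables applies without a proof of integrability.\<close>

lemma set_integral_GL_image:
  assumes T: "T \<in> GL n" and d: "d > 0" "\<And>f. f \<in> borel_measurable (leb n) \<Longrightarrow> (\<integral>\<^sup>+x. f x \<partial>leb n) = ennreal d * (\<integral>\<^sup>+x. f (T x) \<partial>leb n)"
    and A: "A \<in> sets (leb n)" and g: "g \<in> borel_measurable (leb n)" "\<And>x. 0 \<le> g x"
  shows "(LINT x:T ` A|leb n. g x) = d * (LINT x:A|leb n. g (T x))"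
proof -
  have TA: "T ` A \<in> sets (leb n)" by (rule GL_image_sets[OF T A])
  have inj: "inj_on T (Rn n)" using T by (simp add: GL_def bij_betw_def)
  have A': "A \<subseteq> Rn n" using sets.sets_into_space[OF A] by simp
  have gT: "(\<lambda>x. g (T x)) \<in> borel_measurable (leb n)" by (rule measurable_compose[OF GL_measurable[OF T] g(1)])
  have m: "(\<lambda>x. indicator (T ` A) x * g x) \<in> borel_measurable (leb n)" "(\<lambda>x. indicator A x * g (T x)) \<in> borel_measurable (leb n)"
    using TA A g(1) gT by measurable
  have "(LINT x:T ` A|leb n. g x) = enn2real (\<integral>\<^sup>+x. ennreal (indicator (T ` A) x * g x) \<partial>leb n)"
    unfolding set_lebesgue_integral_def real_scaleR_def using m(1) g(2) by (intro integral_eq_nn_integral) auto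
  also have "(\<integral>\<^sup>+x. ennreal (indicator (T ` A) x * g x) \<partial>leb n) = ennreal d * (\<integral>\<^sup>+x. ennreal (indicator (T ` A) (T x) * g (T x)) \<partial>leb n)"
    by (rule d(2)) (use m(1) in measurable)
  also have "(\<integral>\<^sup>+x. ennreal (indicator (T ` A) (T x) * g (T x)) \<partial>leb n) = (\<integral>\<^sup>+x. ennreal (indicator A x * g (T x)) \<partial>leb n)"
  proof (rule nn_integral_cong)
    fix x assume "x \<in> space (leb n)"
    then have "T x \<in> T ` A \<longleftrightarrow> x \<in> A" using inj_on_image_mem_iff[OF inj _ A'] by simp
    then show "ennreal (indicator (T ` A) (T x) * g (T x)) = ennreal (indicator A x * g (T x))" by (simp add: indicator_def)
  qed
  also have "enn2real (ennreal d * (\<integral>\<^sup>+x. ennreal (indicator A x * g (T x)) \<partial>leb n)) = d * enn2real (\<integral>\<^sup>+x. ennreal (indicator A x * g (T x)) \<partial>leb n)"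
    using d(1) by (simp add: enn2real_mult)
  also have "enn2real (\<integral>\<^sup>+x. ennreal (indicator A x * g (T x)) \<partial>leb n) = (LINT x:A|leb n. g (T x))"
    unfolding set_lebesgue_integral_def real_scaleR_def using m(2) g(2) by (intro integral_eq_nn_integral[symmetric]) auto
  finally show ?thesis .
qed

text \<open>The definite description needs uniqueness. If T K is isotropic of volume 1 and c > 0,
  the length of T^t \<theta> is constant on the sphere, so T T^t = \<rho>^2 and T is a similarity;
  the volume forces \<rho> = r and with it the value. Existence is the homothety by r.\<close>

lemma isotropic_constant_eq:
  assumes n: "n \<ge> 1" and K: "sym_convex_body n K" and w: "vol n K = \<omega>" "\<omega> > 0" and c: "c \<ge> 0"
    and iso: "\<And>\<theta>. \<theta> \<in> unit_sphere n \<Longrightarrow> (LINT x:K|leb n. (dot n x \<theta>)\<^sup>2) = c"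
  shows "isotropic_constant n K = \<omega> powr (- 1 / n) * sqrt (c / \<omega>)"
proof -
  define r where "r = \<omega> powr (- 1 / n)"
  have r0: "r > 0" using w(2) by (simp add: r_def)
  then have "r ^ n = r powr real n" by (simp add: powr_realpow)
  also have "\<dots> = \<omega> powr (- 1 / n * n)" unfolding r_def by (rule powr_powr)
  also have "- 1 / n * n = - 1" using n by simp
  also have "\<omega> powr - 1 = 1 / \<omega>" by (rule powr_neg_one[OF w(2)])
  finally have r: "r > 0" "r ^ n = 1 / \<omega>" using r0 by auto
  define l where "l = r * sqrt (c / \<omega>)"
  have l: "l \<ge> 0" "l\<^sup>2 = r\<^sup>2 * (c / \<omega>)" using r c w(2) by (auto simp: l_def power_mult_distrib)
  have Ks: "K \<in> sets (leb n)" by (rule body_sets[OF K])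
  have m2: "(\<lambda>x. (dot n x \<theta>)\<^sup>2) \<in> borel_measurable (leb n)" for \<theta> by measurable
  have vol: "vol n (T ` K) = d * \<omega>" if "T \<in> GL n" "d > 0" "\<And>f. f \<in> borel_measurable (leb n) \<Longrightarrow> (\<integral>\<^sup>+x. f x \<partial>leb n) = ennreal d * (\<integral>\<^sup>+x. f (T x) \<partial>leb n)" for T d
    using emeasure_GL_image[OF that(1,3) Ks] that(2) w(1) by (simp add: vol_def measure_def enn2real_mult)
  have second: "(LINT x:T ` K|leb n. (dot n x \<theta>)\<^sup>2) = d * (c * (enorm n (transp n T \<theta>))\<^sup>2)"
    if "T \<in> GL n" "d > 0" "\<And>f. f \<in> borel_measurable (leb n) \<Longrightarrow> (\<integral>\<^sup>+x. f x \<partial>leb n) = ennreal d * (\<integral>\<^sup>+x. f (T x) \<partial>leb n)" for T d \<theta>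
  proof -
    have lin: "linear T" using that(1) by (simp add: GL_def)
    have "(LINT x:T ` K|leb n. (dot n x \<theta>)\<^sup>2) = d * (LINT x:K|leb n. (dot n (T x) \<theta>)\<^sup>2)"
      using set_integral_GL_image[OF that Ks m2] by simp
    also have "(LINT x:K|leb n. (dot n (T x) \<theta>)\<^sup>2) = (LINT x:K|leb n. (dot n x (transp n T \<theta>))\<^sup>2)"
      using K Ks by (intro set_lebesgue_integral_cong) (auto simp: dot_transp[OF lin] sym_convex_body_iff subset_iff)
    also have "\<dots> = c * (enorm n (transp n T \<theta>))\<^sup>2" by (rule isotropic_bilinear(1)[OF K iso transp_Rn transp_Rn])
    finally show ?thesis .
  qed
  have "isotropic_constant n K = l" unfolding isotropic_constant_def
  proof (rule the_equality)
    define T0 where "T0 = (\<lambda>x :: nat \<Rightarrow> real. r *\<^sub>R x)"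
    have "bij_betw T0 (Rn n) (Rn n)"
      by (rule bij_betw_byWitness[where f'="\<lambda>x. (1/r) *\<^sub>R x"]) (use r(1) in \<open>auto simp: T0_def\<close>)
    moreover have "linear T0" unfolding T0_def by (rule linear_scaleR)
    ultimately have T0: "T0 \<in> GL n" by (simp add: GL_def)
    have d: "(\<integral>\<^sup>+x. f x \<partial>leb n) = ennreal (r ^ n) * (\<integral>\<^sup>+x. f (T0 x) \<partial>leb n)" if "f \<in> borel_measurable (leb n)" for f
      using nn_integral_leb_affine[OF that, of r 0] r(1) by (simp add: T0_def)
    have rn: "r ^ n > 0" using r(1) by simp
    have t: "transp n T0 \<theta> = r *\<^sub>R \<theta>" if "\<theta> \<in> Rn n" for \<theta>
    proof
      fix k
      show "transp n T0 \<theta> k = (r *\<^sub>R \<theta>) k"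
      proof (cases "k < n")
        case True
        then have "transp n T0 \<theta> k = r * dot n (basis k) \<theta>" unfolding transp_def T0_def dot_scaleR_left by simp
        then show ?thesis using True by (simp add: dot_basis_left scaleR_fun_def)
      next
        case False
        then show ?thesis using that by (simp add: transp_def Rn_iff scaleR_fun_def)
      qed
    qed
    have "(LINT x:T0 ` K|leb n. (dot n x \<theta>)\<^sup>2) = l\<^sup>2" if "\<theta> \<in> unit_sphere n" for \<theta>
      using second[OF T0 rn d, of \<theta>] that r w(2) by (simp add: t unit_sphere_iff l(2) power_mult_distrib)
    moreover have "vol n (T0 ` K) = 1" using vol[OF T0 rn d] r w(2) by simp
    ultimately show "0 \<le> l \<and> (\<exists>T\<in>GL n. vol n (T ` K) = 1 \<and> (\<forall>\<theta>\<in>unit_sphere n. (LINT x:T ` K|leb n. (dot n x \<theta>)\<^sup>2) = l\<^sup>2))"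
      using T0 l(1) by blast
  next
    fix l' assume "0 \<le> l' \<and> (\<exists>T\<in>GL n. vol n (T ` K) = 1 \<and> (\<forall>\<theta>\<in>unit_sphere n. (LINT x:T ` K|leb n. (dot n x \<theta>)\<^sup>2) = l'\<^sup>2))"
    then obtain T where l': "0 \<le> l'" and T: "T \<in> GL n" and v1: "vol n (T ` K) = 1"
      and iso': "\<And>\<theta>. \<theta> \<in> unit_sphere n \<Longrightarrow> (LINT x:T ` K|leb n. (dot n x \<theta>)\<^sup>2) = l'\<^sup>2" by blast
    obtain d where d: "d > 0" "\<And>f. f \<in> borel_measurable (leb n) \<Longrightarrow> (\<integral>\<^sup>+x. f x \<partial>leb n) = ennreal d * (\<integral>\<^sup>+x. f (T x) \<partial>leb n)"
      using GL_change_of_variables[OF T] by metis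
    have dw: "d = 1 / \<omega>" using vol[OF T d] v1 w(2) by (simp add: field_simps)
    have lin: "linear T" and inj: "inj_on T (Rn n)" using T by (auto simp: GL_def bij_betw_def)
    have tl: "l'\<^sup>2 = d * (c * (enorm n (transp n T \<theta>))\<^sup>2)" if "\<theta> \<in> unit_sphere n" for \<theta>
      using iso'[OF that] second[OF T d, of \<theta>] by simp
    have b0: "basis 0 \<in> unit_sphere n" using n by (intro basis_unit_sphere) simp
    have "l'\<^sup>2 = l\<^sup>2"
    \<comment> \<open>\<rho> is defined through a division by c; for c = 0 both values are
      0.\<close>
    proof (cases "c = 0")
      case True
      then show ?thesis using tl[OF b0] l(2) by simp
    next
      case False
      then have c0: "c > 0" using c by simp
      define \<rho> where "\<rho> = sqrt (l'\<^sup>2 / (d * c))"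
      have \<rho>2: "\<rho>\<^sup>2 = l'\<^sup>2 / (d * c)" "\<rho> \<ge> 0" using d(1) c0 by (auto simp: \<rho>_def)
      have tn: "(enorm n (transp n T y))\<^sup>2 = \<rho>\<^sup>2 * (enorm n y)\<^sup>2" if y: "y \<in> Rn n" for y
      proof (cases "y = 0")
        case True
        then have "transp n T y = 0" by (auto simp: transp_def)
        then show ?thesis using True by simp
      next
        case False
        then have y0: "enorm n y > 0" using enorm_eq_0[OF y] enorm_nonneg[of n y] by linarith
        define \<theta> where "\<theta> = (1 / enorm n y) *\<^sub>R y"
        have \<theta>: "\<theta> \<in> unit_sphere n" using y y0 by (simp add: \<theta>_def unit_sphere_iff)
        have y\<theta>: "y = enorm n y *\<^sub>R \<theta>" using y0 by (simp add: \<theta>_def)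
        have "transp n T y = enorm n y *\<^sub>R transp n T \<theta>" by (subst y\<theta>) (rule transp_scaleR)
        then have "(enorm n (transp n T y))\<^sup>2 = (enorm n y)\<^sup>2 * (enorm n (transp n T \<theta>))\<^sup>2" by (simp add: power_mult_distrib)
        also have "(enorm n (transp n T \<theta>))\<^sup>2 = \<rho>\<^sup>2" using tl[OF \<theta>] d(1) c0 by (simp add: \<rho>2)
        finally show ?thesis by (simp add: mult.commute)
      qed
      have tadd: "transp n T (y + z) = transp n T y + transp n T z" for y z by (auto simp: transp_def dot_add_right)
      \<comment> \<open>Polarisation: T^t multiplies inner products, and not only lengths, by a
        constant.\<close>
      have td: "dot n (transp n T y) (transp n T z) = \<rho>\<^sup>2 * dot n y z" if "y \<in> Rn n" "z \<in> Rn n" for y z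
        using tn[of "y + z"] tn[of y] tn[of z] that unfolding tadd enorm_add_sq by (simp add: algebra_simps)
      have TT: "T (transp n T y) = \<rho>\<^sup>2 *\<^sub>R y" if y: "y \<in> Rn n" for y
      proof
        fix j
        show "T (transp n T y) j = (\<rho>\<^sup>2 *\<^sub>R y) j"
        proof (cases "j < n")
          case True
          have "T (transp n T y) j = dot n (T (transp n T y)) (basis j)" using True by (simp add: dot_basis_right)
          also have "\<dots> = dot n (transp n T y) (transp n T (basis j))" by (rule dot_transp[OF lin transp_Rn])
          also have "\<dots> = \<rho>\<^sup>2 * y j" using td[OF y basis_Rn[OF True]] True by (simp add: dot_basis_right)
          finally show ?thesis by (simp add: scaleR_fun_def)
        next
          case False
          then show ?thesis using GL_in_Rn[OF T transp_Rn[of n T y]] y by (simp add: Rn_iff scaleR_fun_def)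
        qed
      qed
      have sim: "enorm n (T x) = \<rho> * enorm n x" if x: "x \<in> Rn n" for x
      proof -
        have TxR: "T x \<in> Rn n" by (rule GL_in_Rn[OF T x])
        \<comment> \<open>Injectivity of T turns T T^t = \<rho>^2 into T^t T = \<rho>^2, which is
          the statement about the lengths of T x.\<close>
        have "T (transp n T (T x)) = T (\<rho>\<^sup>2 *\<^sub>R x)" using TT[OF TxR] by (simp add: linear_scale[OF lin])
        then have "transp n T (T x) = \<rho>\<^sup>2 *\<^sub>R x" using inj_onD[OF inj] transp_Rn x by simp
        then have "(enorm n (T x))\<^sup>2 = \<rho>\<^sup>2 * (enorm n x)\<^sup>2"
          using dot_transp[OF lin x, of "T x"] by (simp add: dot_self)
        then have "(enorm n (T x))\<^sup>2 = (\<rho> * enorm n x)\<^sup>2" by (simp add: power_mult_distrib)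
        then show ?thesis using \<rho>2(2) by (simp add: power2_eq_iff_nonneg)
      qed
      have "\<rho> > 0"
      proof (rule ccontr)
        assume "\<not> \<rho> > 0"
        then have "\<rho> = 0" using \<rho>2(2) by simp
        have b: "basis 0 \<in> Rn n" using n by (simp add: basis_Rn)
        then have "enorm n (T (basis 0)) = 0" using sim \<open>\<rho> = 0\<close> by simp
        then have "T (basis 0) = T 0" using enorm_eq_0[OF GL_in_Rn[OF T b]] linear_0[OF lin] by simp
        then have "basis 0 = 0" using inj_onD[OF inj _ b Rn_zero] by simp
        then show False by (simp add: basis_def fun_eq_iff) (metis one_neq_zero)
      qed
      then have "d = \<rho> ^ n" using similarity_jacobian[OF n T _ sim d] by simp
      then have "\<rho> ^ n = r ^ n" using dw r(2) by simp
      then have "\<rho> = r" using power_eq_imp_eq_base[of \<rho> n r] n \<rho>2(2) r(1) by simp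
      then have "l'\<^sup>2 / (d * c) = r\<^sup>2" using \<rho>2(1) by simp
      then have "l'\<^sup>2 = r\<^sup>2 * (d * c)" using d(1) c0 by (simp add: field_simps)
      then show ?thesis by (simp add: l(2) dw)
    qed
    then show "l' = l" using l' l(1) by (simp add: power2_eq_iff_nonneg)
  qed
  then show ?thesis by (simp add: l_def r_def)
qed

text \<open>s is the standard deviation of K in every unit direction. K has the volume of the unit
  ball, and the cube inscribed in the ball bounds the power -1/n of that volume by sqrt n /
  2.\<close>

lemma isotropic_constant_le:
  assumes n: "n \<ge> 1" and K: "sym_convex_body n K" and w: "vol n K = vol n (unit_ball n)" and s: "s \<ge> 0"
    and iso: "\<And>\<theta>. \<theta> \<in> unit_sphere n \<Longrightarrow> (LINT x:K|leb n. (dot n x \<theta>)\<^sup>2) = s\<^sup>2 * vol n K"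
  shows "isotropic_constant n K \<le> s * sqrt n / 2"
proof -
  define \<omega> where "\<omega> = vol n (unit_ball n)"
  have \<omega>: "\<omega> > 0" "(2 / sqrt n) ^ n \<le> \<omega>" using vol_unit_ball_pos[OF n] vol_unit_ball_ge[OF n] by (auto simp: \<omega>_def)
  have "isotropic_constant n K = \<omega> powr (- 1 / n) * sqrt (s\<^sup>2 * \<omega> / \<omega>)"
    by (rule isotropic_constant_eq[OF n K]) (use w iso \<omega> in \<open>auto simp: \<omega>_def\<close>)
  also have "\<dots> = \<omega> powr (- 1 / n) * s" using \<omega> s by simp
  also have "\<omega> powr (- 1 / n) \<le> ((2 / sqrt n) ^ n) powr (- 1 / n)"
    using \<omega> n by (intro powr_mono2') auto
  also have "((2 / sqrt n) ^ n) powr (- 1 / n) = sqrt n / 2"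
  proof -
    have "((2 / sqrt n) ^ n) powr (- 1 / n) = (2 / sqrt n) powr (real n * (- 1 / n))"
      using n by (simp add: powr_realpow[symmetric] powr_powr)
    also have "real n * (- 1 / n) = - 1" using n by simp
    also have "(2 / sqrt n) powr (- 1) = sqrt n / 2" using n by (simp add: powr_minus)
    finally show ?thesis .
  qed
  finally show ?thesis using s by (simp add: mult_right_mono mult.commute)
qed

lemma lq_quotient_GL_image:
  assumes "lq_quotient n q L \<pi>" and T: "T \<in> GL n"
  shows "lq_quotient n q (T ` L) (T \<circ> \<pi>)"
proof -
  interpret lq_quotient n q L \<pi> by fact
  have lT: "linear T" and inj: "inj_on T (Rn n)" using T by (auto simp: GL_def bij_betw_def)
  have LR: "L \<subseteq> Rn n" using body by (simp add: sym_convex_body_iff)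
  have bn: "body_norm (T ` L) (T x) = body_norm L x" if x: "x \<in> Rn n" for x
  proof -
    have "T x \<in> (\<lambda>y. t *\<^sub>R y) ` T ` L \<longleftrightarrow> x \<in> (\<lambda>y. t *\<^sub>R y) ` L" for t
    proof
      assume "T x \<in> (\<lambda>y. t *\<^sub>R y) ` T ` L"
      then obtain z where z: "z \<in> L" "T x = t *\<^sub>R T z" by blast
      then have "T x = T (t *\<^sub>R z)" by (simp add: linear_scale[OF lT])
      then have "x = t *\<^sub>R z" using inj_onD[OF inj] x z(1) LR by auto
      then show "x \<in> (\<lambda>y. t *\<^sub>R y) ` L" using z(1) by blast
    next
      assume "x \<in> (\<lambda>y. t *\<^sub>R y) ` L"
      then obtain z where "z \<in> L" "x = t *\<^sub>R z" by blast
      then show "T x \<in> (\<lambda>y. t *\<^sub>R y) ` T ` L" by (auto simp: linear_scale[OF lT])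
    qed
    then show ?thesis by (simp add: body_norm_def)
  qed
  show ?thesis
  proof (rule lq_quotient.intro[OF body_GL_image[OF body T] linear_compose[OF lin lT] q])
    fix f assume f: "f \<in> Lq_space q"
    show "(T \<circ> \<pi>) f \<in> Rn n" using GL_in_Rn[OF T range[OF f]] by simp
    show "body_norm (T ` L) ((T \<circ> \<pi>) f) \<le> Lq_norm q f" using bn[OF range[OF f]] norm_le[OF f] by simp
  next
    fix z assume "z \<in> T ` L"
    then obtain y where y: "y \<in> L" "z = T y" by blast
    then show "\<exists>f\<in>Lq_space q. (T \<circ> \<pi>) f = z \<and> Lq_norm q f < 2" using lift[OF y(1)] by auto
  qed
qed

text \<open>A linear majorant of the p-th root, used like Jensen's inequality: when a is an upper
  bound for the mean of t, integration costs only a factor 2.\<close>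

lemma powr_root_le:
  fixes a t p :: real assumes "a > 0" "t \<ge> 0" "p \<ge> 1"
  shows "t powr (1/p) \<le> a powr (1/p) * (1 + t / a)"
proof (cases "t \<le> a")
  case True
  then have "t powr (1/p) \<le> a powr (1/p)" using assms by (intro powr_mono2) auto
  also have "\<dots> \<le> a powr (1/p) * (1 + t / a)" using assms mult_left_mono[of 1 "1 + t / a" "a powr (1/p)"] by simp
  finally show ?thesis .
next
  case False
  then have ta: "t / a \<ge> 1" using assms by simp
  have "t powr (1/p) = a powr (1/p) * (t / a) powr (1/p)" using assms by (simp add: powr_mult[symmetric])
  also have "(t / a) powr (1/p) \<le> (t / a) powr 1" using ta assms by (intro powr_mono) auto
  also have "(t / a) powr 1 \<le> 1 + t / a" using assms by simp
  finally show ?thesis using assms by simp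
qed

text \<open>The covariance form of K is c times the inner product, so the integral equals c times
  the trace of V^t T. The frame from \<open>SL_frame\<close> makes this trace at least n.\<close>

lemma trace_integral_ge:
  assumes n: "n \<ge> 1" and K: "sym_convex_body n K" and T: "T \<in> SL n"
    and iso: "\<And>\<theta>. \<theta> \<in> unit_sphere n \<Longrightarrow> (LINT x:K|leb n. (dot n x \<theta>)\<^sup>2) = c" and c: "c \<ge> 0"
  obtains v where "orthonormal n v" "set_integrable (leb n) K (\<lambda>x. dot n (frame_map n v x) (T x))"
    "c * n \<le> (LINT x:K|leb n. dot n (frame_map n v x) (T x))"
proof -
  have lin: "linear T" using T by (simp add: SL_def GL_def)
  obtain v where v: "orthonormal n v" "real n \<le> (\<Sum>i<n. dot n (v i) (T (basis i)))" by (rule SL_frame[OF n T])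
  define g where "g i x = dot n x (basis i) * dot n x (transp n T (v i))" for i x
  have Ks: "K \<in> sets (leb n)" "K \<subseteq> Rn n" using body_sets[OF K] K by (auto simp: sym_convex_body_iff)
  have eq: "dot n (frame_map n v x) (T x) = (\<Sum>i<n. g i x)" if "x \<in> K" for x
  proof -
    have "x \<in> Rn n" using that Ks by blast
    then have "dot n (v i) (T x) = dot n x (transp n T (v i))" for i
      using dot_transp[OF lin, of x n "v i"] by (simp add: dot_commute[of n "v i"])
    then show ?thesis unfolding frame_map_dot_left g_def by (intro sum.cong) (auto simp: dot_basis_right)
  qed
  have gi: "set_integrable (leb n) K (g i)" "(LINT x:K|leb n. g i x) = c * dot n (v i) (T (basis i))" if "i < n" for i
  proof -
    note B = isotropic_bilinear[OF K iso basis_Rn[OF that] transp_Rn[of n T "v i"]]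
    show "set_integrable (leb n) K (g i)" unfolding g_def[abs_def] by (rule B(3))
    have "(LINT x:K|leb n. g i x) = c * dot n (basis i) (transp n T (v i))" unfolding g_def by (rule B(2))
    also have "dot n (basis i) (transp n T (v i)) = transp n T (v i) i" by (rule dot_basis_left[OF that])
    also have "\<dots> = dot n (v i) (T (basis i))" using that by (simp add: transp_def dot_commute[of n "v i"])
    finally show "(LINT x:K|leb n. g i x) = c * dot n (v i) (T (basis i))" .
  qed
  have si: "set_integrable (leb n) K (\<lambda>x. \<Sum>i<n. g i x)"
    using gi(1) unfolding set_integrable_def scaleR_sum_right by (intro Bochner_Integration.integrable_sum) auto
  have int: "set_integrable (leb n) K (\<lambda>x. dot n (frame_map n v x) (T x))"
    using si eq by (subst set_integrable_cong[OF refl refl, of _ _ "\<lambda>x. \<Sum>i<n. g i x"]) auto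
  have "c * n \<le> c * (\<Sum>i<n. dot n (v i) (T (basis i)))" using v(2) c by (rule mult_left_mono)
  also have "\<dots> = (\<Sum>i<n. LINT x:K|leb n. g i x)" by (simp add: sum_distrib_left gi(2))
  also have "\<dots> = (LINT x:K|leb n. \<Sum>i<n. g i x)"
    using gi(1) unfolding set_lebesgue_integral_def set_integrable_def scaleR_sum_right
    by (intro Bochner_Integration.integral_sum[symmetric]) auto
  also have "\<dots> = (LINT x:K|leb n. dot n (frame_map n v x) (T x))"
    using eq Ks(1) by (intro set_lebesgue_integral_cong) auto
  finally show ?thesis using that v(1) int by blast
qed

section \<open>Two bounds for the standard deviation of K\<close>

lemma set_integral_const: "A \<in> sets (leb n) \<Longrightarrow> (LINT x:A|leb n. (a :: real)) = a * measure (leb n) A"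
  unfolding set_lebesgue_integral_def using sets_leb_Int[of A n] by simp

text \<open>Pointwise the trace integrand is at most R |x|, and the mean of |x| over K is at most s
  sqrt n.\<close>

lemma deviation_le_circumradius:
  assumes n: "n \<ge> 1" and K: "sym_convex_body n K" and T: "T \<in> SL n" and s: "s > 0" and V: "measure (leb n) K > 0"
    and iso: "\<And>\<theta>. \<theta> \<in> unit_sphere n \<Longrightarrow> (LINT x:K|leb n. (dot n x \<theta>)\<^sup>2) = s\<^sup>2 * measure (leb n) K"
    and R: "\<And>x. x \<in> K \<Longrightarrow> enorm n (T x) \<le> R"
  shows "s * sqrt n \<le> R"
proof -
  define V where "V = measure (leb n) K"
  have V0: "V > 0" using V by (simp add: V_def)
  have Ks: "K \<in> sets (leb n)" by (rule body_sets[OF K])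
  have iso': "\<And>\<theta>. \<theta> \<in> unit_sphere n \<Longrightarrow> (LINT x:K|leb n. (dot n x \<theta>)\<^sup>2) = s\<^sup>2 * V" using iso by (simp add: V_def)
  have c0: "0 \<le> s\<^sup>2 * V" using V0 by simp
  obtain v where v: "orthonormal n v" "set_integrable (leb n) K (\<lambda>x. dot n (frame_map n v x) (T x))"
    "(s\<^sup>2 * V) * n \<le> (LINT x:K|leb n. dot n (frame_map n v x) (T x))"
    by (rule trace_integral_ge[OF n K T iso' c0])
  have R0: "R \<ge> 0" using R[OF body_zero[OF K]] enorm_nonneg[of n "T 0"] by linarith
  \<comment> \<open>The mean of |x| is bounded through |x| <= |x|^2 / (2 \<tau>) + \<tau>/2. Since
    \<tau>^2 is the mean of |x|^2, the right-hand side has mean exactly \<tau>.\<close>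
  define \<tau> where "\<tau> = s * sqrt n"
  have \<tau>: "\<tau> > 0" "\<tau>\<^sup>2 = s\<^sup>2 * n" using s n by (auto simp: \<tau>_def power_mult_distrib)
  define g where "g x = (\<Sum>i<n. dot n x (basis i) * dot n x (basis i))" for x
  have gx: "g x = (enorm n x)\<^sup>2" for x
  proof -
    have "g x = (\<Sum>i<n. x i * x i)" unfolding g_def by (intro sum.cong) (auto simp: dot_basis_right)
    then show ?thesis by (simp add: dot_self[symmetric] dot_def)
  qed
  have gi: "set_integrable (leb n) K (\<lambda>x. dot n x (basis i) * dot n x (basis i))"
     "(LINT x:K|leb n. dot n x (basis i) * dot n x (basis i)) = s\<^sup>2 * V" if "i < n" for i
    using isotropic_bilinear(2,3)[OF K iso' basis_Rn[OF that] basis_Rn[OF that]] that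
    by (auto simp: dot_basis_left) (simp add: basis_def)
  have gint: "set_integrable (leb n) K g" unfolding g_def[abs_def]
    using gi(1) unfolding set_integrable_def scaleR_sum_right by (intro Bochner_Integration.integrable_sum) auto
  have gval: "(LINT x:K|leb n. g x) = n * (s\<^sup>2 * V)"
  proof -
    have "(LINT x:K|leb n. g x) = (\<Sum>i<n. LINT x:K|leb n. dot n x (basis i) * dot n x (basis i))"
      using gi(1) unfolding g_def set_lebesgue_integral_def set_integrable_def scaleR_sum_right
      by (intro Bochner_Integration.integral_sum) auto
    then show ?thesis by (simp add: gi(2))
  qed
  have cint: "set_integrable (leb n) K (\<lambda>x. \<tau> / 2)" by (rule body_integrable[OF K, of _ "\<bar>\<tau> / 2\<bar>"]) auto
  have gint': "set_integrable (leb n) K (\<lambda>x. 1 / (2 * \<tau>) * g x)" using gint by (rule set_integrable_mult_right)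
  have "(s\<^sup>2 * V) * n \<le> (LINT x:K|leb n. dot n (frame_map n v x) (T x))" by (rule v(3))
  also have "\<dots> \<le> (LINT x:K|leb n. R * (1 / (2 * \<tau>) * g x + \<tau> / 2))"
  proof (rule set_integral_mono[OF v(2)])
    show "set_integrable (leb n) K (\<lambda>x. R * (1 / (2 * \<tau>) * g x + \<tau> / 2))"
      by (intro set_integrable_mult_right set_integral_add(1) gint' cint)
    fix x assume x: "x \<in> K"
    have "dot n (frame_map n v x) (T x) \<le> enorm n x * enorm n (T x)"
      using dot_le[of n "frame_map n v x" "T x"] frame_map_enorm[OF v(1), of x] by simp
    also have "\<dots> \<le> enorm n x * R" using R[OF x] by (intro mult_left_mono) auto
    also have "enorm n x \<le> 1 / (2 * \<tau>) * g x + \<tau> / 2"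
    proof -
      have "0 \<le> (enorm n x - \<tau>)\<^sup>2" by simp
      then have "2 * \<tau> * enorm n x \<le> g x + \<tau>\<^sup>2" by (simp add: gx power2_diff algebra_simps)
      then have "enorm n x \<le> (g x + \<tau>\<^sup>2) / (2 * \<tau>)" using \<tau>(1) by (simp add: pos_le_divide_eq mult.commute)
      also have "\<dots> = 1 / (2 * \<tau>) * g x + \<tau> / 2" using \<tau>(1) by (simp add: field_simps power2_eq_square)
      finally show ?thesis .
    qed
    then have "enorm n x * R \<le> (1 / (2 * \<tau>) * g x + \<tau> / 2) * R" using R0 by (rule mult_right_mono)
    finally show "dot n (frame_map n v x) (T x) \<le> R * (1 / (2 * \<tau>) * g x + \<tau> / 2)" by (simp add: mult.commute)
  qed
  also have "\<dots> = R * ((LINT x:K|leb n. 1 / (2 * \<tau>) * g x) + (LINT x:K|leb n. \<tau> / 2))"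
    using set_integral_add(2)[OF gint' cint] by simp
  also have "\<dots> = R * (1 / (2 * \<tau>) * (n * (s\<^sup>2 * V)) + \<tau> / 2 * V)"
    using set_integral_const[OF Ks, of "\<tau>/2"] gval by (simp add: V_def)
  also have "n * (s\<^sup>2 * V) = \<tau>\<^sup>2 * V" by (simp add: \<tau>)
  also have "R * (1 / (2 * \<tau>) * (\<tau>\<^sup>2 * V) + \<tau> / 2 * V) = R * \<tau> * V" using \<tau>(1) by (simp add: field_simps power2_eq_square)
  finally have "\<tau>\<^sup>2 * V \<le> R * \<tau> * V" by (simp add: \<tau>(2) ac_simps)
  then have "(\<tau> * \<tau>) * V \<le> (R * \<tau>) * V" by (simp only: power2_eq_square)
  then have "\<tau> * \<tau> \<le> R * \<tau>" using V0 by (rule mult_right_le_imp_le)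
  then have "\<tau> \<le> R" using \<tau>(1) by (rule mult_right_le_imp_le)
  then show ?thesis by (simp add: \<tau>_def)
qed

text \<open>At y = V x the assumption on J bounds the trace integrand by 10 times the p-norm of the
  numbers <x, V^t w j>, where V^t does not increase lengths. Khinchine bounds the mean of each p-th
  power by (12 p s |w j|)^p; with the 2 from \<open>powr_root_le\<close> this makes 10 * 2 * 12 =
  240.\<close>

lemma deviation_le_frame_norm:
  assumes n: "n \<ge> 1" and K: "sym_convex_body n K" and T: "T \<in> SL n" and s: "s > 0" and V: "measure (leb n) K > 0"
    and iso: "\<And>\<theta>. \<theta> \<in> unit_sphere n \<Longrightarrow> (LINT x:K|leb n. (dot n x \<theta>)\<^sup>2) = s\<^sup>2 * measure (leb n) K"
    and p: "p \<ge> 1" and J: "finite J" "\<And>j. j \<in> J \<Longrightarrow> w j \<in> Rn n"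
    and G: "\<And>x y. x \<in> K \<Longrightarrow> y \<in> Rn n \<Longrightarrow> \<bar>dot n y (T x)\<bar> \<le> 10 * (\<Sum>j\<in>J. \<bar>dot n y (w j)\<bar> powr p) powr (1/p)"
  shows "s * n \<le> 240 * p * (\<Sum>j\<in>J. enorm n (w j) powr p) powr (1/p)"
proof -
  define V where "V = measure (leb n) K"
  have V0: "V > 0" using V by (simp add: V_def)
  have Ks: "K \<in> sets (leb n)" by (rule body_sets[OF K])
  have iso': "\<And>\<theta>. \<theta> \<in> unit_sphere n \<Longrightarrow> (LINT x:K|leb n. (dot n x \<theta>)\<^sup>2) = s\<^sup>2 * V" using iso by (simp add: V_def)
  have c0: "0 \<le> s\<^sup>2 * V" using V0 by simp
  obtain v where v: "orthonormal n v" "set_integrable (leb n) K (\<lambda>x. dot n (frame_map n v x) (T x))"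
    "(s\<^sup>2 * V) * n \<le> (LINT x:K|leb n. dot n (frame_map n v x) (T x))"
    by (rule trace_integral_ge[OF n K T iso' c0])
  define y where "y j = transp n (frame_map n v) (w j)" for j
  have flin: "linear (frame_map n v)" unfolding frame_map_def[abs_def] by (rule linear_sum_scaleR)
  have yR: "y j \<in> Rn n" for j by (simp add: y_def transp_Rn)
  have dy: "dot n (frame_map n v x) (w j) = dot n x (y j)" if "x \<in> Rn n" for x j
    unfolding y_def by (rule dot_transp[OF flin that])
  have ye: "enorm n (y j) \<le> enorm n (w j)" for j
  proof -
    have "(enorm n (y j))\<^sup>2 = dot n (frame_map n v (y j)) (w j)" using dy[OF yR, of j j] by (simp add: dot_self)
    also have "\<dots> \<le> enorm n (y j) * enorm n (w j)"
      using dot_le[of n "frame_map n v (y j)" "w j"] frame_map_enorm[OF v(1), of "y j"] by simp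
    finally show ?thesis using enorm_nonneg[of n "y j"] enorm_nonneg[of n "w j"]
      by (cases "enorm n (y j) = 0") (auto simp: power2_eq_square)
  qed
  define N where "N x = (\<Sum>j\<in>J. \<bar>dot n x (y j)\<bar> powr p)" for x
  define W where "W = (\<Sum>j\<in>J. enorm n (w j) powr p)"
  \<comment> \<open>Khinchine's bound for the mean of N over K, and the point at which the p-th root
    is linearised.\<close>
  define a where "a = (12 * p * s) powr p * W"
  obtain R where R: "R > 0" "\<And>x y. x \<in> K \<Longrightarrow> \<bar>dot n x y\<bar> \<le> R * enorm n y" using body_dot_bound[OF K] by blast
  have ji: "set_integrable (leb n) K (\<lambda>x. \<bar>dot n x (y j)\<bar> powr p)" for j
    by (rule body_integrable[OF K, of _ "(R * enorm n (y j)) powr p"]) (use R p in \<open>auto intro: powr_mono2\<close>)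
  have Ni: "set_integrable (leb n) K N" unfolding N_def[abs_def]
    using ji unfolding set_integrable_def scaleR_sum_right by (intro Bochner_Integration.integrable_sum)
  have Nn: "N x \<ge> 0" for x by (auto simp: N_def intro: sum_nonneg)
  have jb: "(LINT x:K|leb n. \<bar>dot n x (y j)\<bar> powr p) \<le> V * (12 * p * s * enorm n (w j)) powr p" for j
  proof (cases "y j = 0")
    case True
    then show ?thesis using V0 by (simp add: set_lebesgue_integral_def)
  next
    case False
    then have y0: "enorm n (y j) > 0" using enorm_eq_0[OF yR, of j] enorm_nonneg[of n "y j"] by linarith
    have "(LINT x:K|leb n. \<bar>dot n x (y j)\<bar> powr p) \<le> V * (12 * p * (s * enorm n (y j))) powr p"
    proof (rule body_khinchine[OF K p _ V_def V0])
      show "s * enorm n (y j) > 0" using s y0 by simp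
      show "(LINT x:K|leb n. (dot n x (y j))\<^sup>2) \<le> (s * enorm n (y j))\<^sup>2 * V"
        using isotropic_bilinear(1)[OF K iso' yR yR, of j] by (simp add: power_mult_distrib)
    qed
    also have "\<dots> \<le> V * (12 * p * s * enorm n (w j)) powr p"
      using ye[of j] V0 p s y0 by (intro mult_left_mono powr_mono2) auto
    finally show ?thesis .
  qed
  have Nb: "(LINT x:K|leb n. N x) \<le> V * a"
  proof -
    have "(LINT x:K|leb n. N x) = (\<Sum>j\<in>J. LINT x:K|leb n. \<bar>dot n x (y j)\<bar> powr p)"
      using ji unfolding N_def set_lebesgue_integral_def set_integrable_def scaleR_sum_right
      by (intro Bochner_Integration.integral_sum)
    also have "\<dots> \<le> (\<Sum>j\<in>J. V * (12 * p * s * enorm n (w j)) powr p)" by (intro sum_mono jb)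
    also have "\<dots> = V * a" unfolding a_def W_def using p s by (simp add: powr_mult sum_distrib_left ac_simps)
    finally show ?thesis .
  qed
  have up: "dot n (frame_map n v x) (T x) \<le> 10 * N x powr (1/p)" if x: "x \<in> K" for x
  proof -
    have xR: "x \<in> Rn n" using x K by (auto simp: sym_convex_body_iff)
    have "\<bar>dot n (frame_map n v x) (T x)\<bar> \<le> 10 * N x powr (1/p)"
      using G[OF x frame_map_Rn[OF v(1), of x]] by (simp add: N_def dy[OF xR])
    then show ?thesis by simp
  qed
  have W0: "W \<ge> 0" by (auto simp: W_def intro: sum_nonneg)
  \<comment> \<open>If W were 0, the trace integrand would be at most 0, against its lower bound.
    The linearisation divides by a, which is thus positive.\<close>
  have "W \<noteq> 0"
  proof
    assume "W = 0"
    then have "\<forall>j\<in>J. enorm n (w j) powr p = 0" using J(1) by (simp add: W_def sum_nonneg_eq_0_iff)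
    then have wj: "enorm n (w j) = 0" if "j \<in> J" for j using that by simp
    have "y j = 0" if "j \<in> J" for j
      using ye[of j] wj[OF that] enorm_eq_0[OF yR, of j] enorm_nonneg[of n "y j"] by simp
    then have N0: "N x = 0" for x unfolding N_def using p by (intro sum.neutral ballI) simp
    have "(LINT x:K|leb n. dot n (frame_map n v x) (T x)) \<le> (LINT x:K|leb n. 0)"
    proof (rule set_integral_mono[OF v(2)])
      show "set_integrable (leb n) K (\<lambda>x. 0 :: real)" by (simp add: set_integrable_def)
      show "dot n (frame_map n v x) (T x) \<le> 0" if "x \<in> K" for x using up[OF that] by (simp add: N0)
    qed
    then have "(s\<^sup>2 * V) * n \<le> 0" using v(3) by (simp add: set_lebesgue_integral_def)
    moreover have "0 < (s\<^sup>2 * V) * n" using s V0 n by simp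
    ultimately show False by linarith
  qed
  then have a0: "a > 0" using W0 p s by (simp add: a_def)
  have cint: "set_integrable (leb n) K (\<lambda>x. 1 :: real)" by (rule body_integrable[OF K, of _ 1]) auto
  have Ni': "set_integrable (leb n) K (\<lambda>x. 1 / a * N x)" using Ni by (rule set_integrable_mult_right)
  have "(s\<^sup>2 * V) * n \<le> (LINT x:K|leb n. dot n (frame_map n v x) (T x))" by (rule v(3))
  also have "\<dots> \<le> (LINT x:K|leb n. 10 * a powr (1/p) * (1 + 1 / a * N x))"
  proof (rule set_integral_mono[OF v(2)])
    show "set_integrable (leb n) K (\<lambda>x. 10 * a powr (1/p) * (1 + 1 / a * N x))"
      by (intro set_integrable_mult_right set_integral_add(1) Ni' cint)
    fix x assume x: "x \<in> K"
    show "dot n (frame_map n v x) (T x) \<le> 10 * a powr (1/p) * (1 + 1 / a * N x)"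
      using up[OF x] powr_root_le[OF a0 Nn p, of x] by simp
  qed
  also have "\<dots> = 10 * a powr (1/p) * ((LINT x:K|leb n. 1) + (LINT x:K|leb n. 1 / a * N x))"
    using set_integral_add(2)[OF cint Ni'] by simp
  also have "\<dots> = 10 * a powr (1/p) * (V + 1 / a * (LINT x:K|leb n. N x))"
    using set_integral_const[OF Ks, of 1] by (simp add: V_def)
  also have "\<dots> \<le> 10 * a powr (1/p) * (V + 1 / a * (V * a))"
    using Nb a0 by (intro mult_left_mono add_left_mono) auto
  also have "\<dots> = 20 * V * a powr (1/p)" using a0 by simp
  also have "a powr (1/p) = 12 * p * s * W powr (1/p)" using p s W0 by (simp add: a_def powr_mult powr_powr)
  finally have "V * s * (s * n) \<le> V * s * (240 * p * W powr (1/p))" by (simp add: power2_eq_square ac_simps)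
  then show ?thesis using V0 s by (simp add: W_def)
qed

text \<open>In the constant 240 comes from \<open>deviation_le_frame_norm\<close>, 4^33 from the
  moments on the sphere and the division by 2 from the volume of the ball.\<close>

lemma isotropic_constant_le_M_star:
  assumes n: "n \<ge> 1" and \<sigma>: "haar_sphere n \<sigma>" and K: "sym_convex_body n K" "isotropic n K" "vol n K = vol n (unit_ball n)"
    and L: "K \<subseteq> L" "L \<in> QL n q" and T: "T \<in> SL n" and q: "1 \<le> q" and pq: "1 / p + 1 / q = 1"
  shows "isotropic_constant n K \<le> 120 * 4 ^ 33 * (sqrt (p0 n p) * M_star n \<sigma> p (T ` L))"
proof -
  define V where "V = measure (leb n) K"
  have V: "V > 0" using vol_unit_ball_pos[OF n] K(3) by (simp add: V_def vol_def)
  obtain c where c: "\<And>\<theta>. \<theta> \<in> unit_sphere n \<Longrightarrow> (LINT x:K|leb n. (dot n x \<theta>)\<^sup>2) = c"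
    using K(2) unfolding isotropic_def by blast
  have b0: "basis 0 \<in> unit_sphere n" using n by (intro basis_unit_sphere) simp
  have "0 \<le> (LINT x:K|leb n. (dot n x (basis 0))\<^sup>2)"
    unfolding set_lebesgue_integral_def by (rule Bochner_Integration.integral_nonneg) simp
  then have c0: "c \<ge> 0" unfolding c[OF b0] .
  define s where "s = sqrt (c / V)"
  have s: "s \<ge> 0" "c = s\<^sup>2 * V" using c0 V by (auto simp: s_def)
  have LK: "isotropic_constant n K \<le> s * sqrt n / 2"
    using isotropic_constant_le[OF n K(1,3) s(1)] c s(2) by (simp add: V_def vol_def)
  have G: "T \<in> GL n" using T by (simp add: SL_def)
  obtain \<pi> where \<pi>: "lq_quotient n q L \<pi>" by (rule QL_lq_quotient[OF L(2) q])
  interpret Q: lq_quotient n q "T ` L" "T \<circ> \<pi>" by (rule lq_quotient_GL_image[OF \<pi> G])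
  have TL: "sym_convex_body n (T ` L)" by (rule Q.body)
  \<comment> \<open>The duality relation gives 1 / p <= 1. The value p = 0 is excluded because 1 / 0
    = \<infinity> in ennreal.\<close>
  have p1: "1 \<le> p"
  proof (rule ccontr)
    assume "\<not> 1 \<le> p"
    then obtain r where r: "p = ennreal r" "0 \<le> r" "r < 1" by (cases p) (auto simp: not_le ennreal_less_one_iff)
    show False
    proof (cases "r = 0")
      case True
      then show False using pq r by (simp add: ennreal_divide_top)
    next
      case False
      then have "1 / p = ennreal (1 / r)" using r divide_ennreal[of 1 r] by simp
      moreover have "1 < 1 / r" using r False by simp
      ultimately have "1 < 1 / p" by simp
      also have "1 / p \<le> 1 / p + 1 / q" by simp
      finally show False using pq by simp
    qed
  qed
  have p0: "1 \<le> p0 n p" unfolding p0_def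
  proof -
    have "max 1 (min p (of_nat n)) < top" by (simp add: of_nat_less_top min_less_iff_disj)
    then show "1 \<le> enn2real (max 1 (min p (of_nat n)))"
      using enn2real_mono[of 1 "max 1 (min p (of_nat n))"] by simp
  qed
  have iso: "\<And>\<theta>. \<theta> \<in> unit_sphere n \<Longrightarrow> (LINT x:K|leb n. (dot n x \<theta>)\<^sup>2) = s\<^sup>2 * measure (leb n) K"
    using c s(2) by (simp add: V_def)
  have "s * sqrt n / 2 \<le> 120 * 4 ^ 33 * (sqrt (p0 n p) * M_star n \<sigma> p (T ` L))"
  \<comment> \<open>For s = 0 it remains to see that \<open>M_star\<close> is not negative. When p
    >= n, where it may be a supremum, this follows from the point 0 of the body.\<close>
  proof (cases "s = 0")
    case True
    have "0 \<le> M_star n \<sigma> p (T ` L)"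
    proof (cases "of_nat n \<le> p")
      case True
      then show ?thesis using M_star_ge_radius[OF n \<sigma> TL _ body_zero[OF TL]] by simp
    next
      case False
      then have "p \<noteq> \<infinity>" by auto
      then show ?thesis by (simp add: M_star_def M_mean_def)
    qed
    then show ?thesis using True p0 by simp
  next
    case False
    then have s0: "s > 0" using s(1) by simp
    have Vm: "measure (leb n) K > 0" using V by (simp add: V_def)
    show ?thesis
    proof (cases "of_nat n \<le> p")
      case True
      obtain z where z: "z \<in> T ` L" "\<And>y. y \<in> T ` L \<Longrightarrow> enorm n y \<le> enorm n z" using body_farthest[OF TL] by blast
      have "s * sqrt n \<le> enorm n z"
        by (rule deviation_le_circumradius[OF n K(1) T s0 Vm iso]) (use z(2) L(1) in auto)
      also have "enorm n z \<le> 4 ^ 33 * M_star n \<sigma> p (T ` L)"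
        using M_star_ge_radius[OF n \<sigma> TL True z(1)] by (simp add: divide_le_eq)
      finally have 1: "s * sqrt n \<le> 4 ^ 33 * M_star n \<sigma> p (T ` L)" .
      moreover have "0 \<le> s * sqrt n" using s0 by simp
      ultimately have M0: "0 \<le> M_star n \<sigma> p (T ` L)" by simp
      have "1 \<le> sqrt (p0 n p)" using p0 by simp
      then have "1 * M_star n \<sigma> p (T ` L) \<le> sqrt (p0 n p) * M_star n \<sigma> p (T ` L)" using M0 by (rule mult_right_mono)
      then show ?thesis using 1 M0 by simp
    next
      case False
      then obtain r where r: "p = ennreal r" "r \<ge> 0" by (cases p) auto
      have r1: "r \<ge> 1" using p1 r by simp
      have rn: "r < n" using False r by (simp add: ennreal_of_nat_eq_real_of_nat not_le)
      have pr: "p0 n p = r"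
        using r1 rn r by (simp add: p0_def ennreal_of_nat_eq_real_of_nat min_def max_def)
      obtain J :: "((nat \<Rightarrow> real) \<Rightarrow> real) set" and w where J: "finite J" "\<And>j. j \<in> J \<Longrightarrow> w j \<in> Rn n"
        "\<And>x. (\<Sum>j\<in>J. \<bar>dot n x (w j)\<bar> powr r) \<le> hs n (T ` L) x powr r"
        "\<And>x. hs n (T ` L) x \<le> 10 * (\<Sum>j\<in>J. \<bar>dot n x (w j)\<bar> powr r) powr (1/r)"
        by (rule Q.support_function_discretization[OF r1 pq[unfolded r(1)]]) (rule that; simp)
      define W where "W = (\<Sum>j\<in>J. enorm n (w j) powr r)"
      have W0: "W \<ge> 0" by (auto simp: W_def intro: sum_nonneg)
      have "s * n \<le> 240 * r * W powr (1/r)" unfolding W_def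
      proof (rule deviation_le_frame_norm[OF n K(1) T s0 Vm iso r1 J(1,2)])
        fix x y assume "x \<in> K"
        then have "T x \<in> T ` L" using L(1) by blast
        then show "\<bar>dot n y (T x)\<bar> \<le> 10 * (\<Sum>j\<in>J. \<bar>dot n y (w j)\<bar> powr r) powr (1/r)"
          using dot_le_hs[OF TL, of "T x" y] J(4)[of y] by linarith
      qed
      \<comment> \<open>Integrating \<Sum> |<x, w j>|^r <= h(x)^r over the sphere bounds the r-th
        moment of h below by \<kappa>^r W, which is X^r; so X is a lower bound for
        \<open>M_star\<close>.\<close>
      define \<kappa> where "\<kappa> = 1 / 4 ^ 33 * sqrt (r / n)"
      define X where "X = \<kappa> * W powr (1/r)"
      have mn: "1 / 4 ^ 33 * sqrt (min r n / n) = \<kappa>" using rn by (simp add: \<kappa>_def min_def)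
      have XM: "X \<le> M_star n \<sigma> (ennreal r) (T ` L)"
      proof (rule M_star_finite_ge[OF \<sigma> TL r1])
        show "X \<ge> 0" using r1 by (simp add: X_def \<kappa>_def)
        have "X powr r = \<kappa> powr r * (W powr (1/r)) powr r" unfolding X_def by (rule powr_mult)
        also have "(W powr (1/r)) powr r = W" using r1 W0 by (simp add: powr_powr)
        also have "\<kappa> powr r * W = (\<Sum>j\<in>J. \<kappa> powr r * enorm n (w j) powr r)" unfolding W_def by (rule sum_distrib_left)
        also have "\<dots> = (\<Sum>j\<in>J. (1 / 4 ^ 33 * sqrt (min r n / n) * enorm n (w j)) powr r)"
          unfolding mn powr_mult[of \<kappa>] ..
        finally have "ennreal (X powr r) = (\<Sum>j\<in>J. ennreal ((1 / 4 ^ 33 * sqrt (min r n / n) * enorm n (w j)) powr r))"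
          by (simp add: sum_ennreal)
        also have "\<dots> \<le> (\<Sum>j\<in>J. dot_moment n r \<sigma> (w j))" by (intro sum_mono dot_moment_ge[OF n \<sigma> r1] J(2))
        also have "\<dots> = (\<integral>\<^sup>+x. (\<Sum>j\<in>J. ennreal (\<bar>dot n x (w j)\<bar> powr r)) \<partial>\<sigma>)"
          unfolding dot_moment_def by (intro nn_integral_sum[symmetric] haar_measurable[OF \<sigma>] borel_dot_powr)
        also have "\<dots> \<le> (\<integral>\<^sup>+x. ennreal (hs n (T ` L) x powr r) \<partial>\<sigma>)"
          using J(3) by (intro nn_integral_mono) (simp add: sum_ennreal ennreal_leI)
        finally show "ennreal (X powr r) \<le> (\<integral>\<^sup>+x. ennreal (hs n (T ` L) x powr r) \<partial>\<sigma>)" .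
      qed
      \<comment> \<open>As W^(1/r) is X / \<kappa>, one factor sqrt r of Khinchine's r cancels
        against \<kappa>, and the sqrt n from \<kappa> cancels one of the two on the left.\<close>
      have sq: "sqrt r * sqrt r = r" "sqrt n * sqrt n = n" using r1 by auto
      have "s * sqrt n * sqrt n \<le> 240 * r * W powr (1/r)" using \<open>s * n \<le> _\<close> sq(2) by (simp add: mult.assoc)
      also have "\<dots> = 240 * 4 ^ 33 * sqrt r * X * sqrt n"
      proof -
        have "sqrt r * X * sqrt n = 1 / 4 ^ 33 * (sqrt r * sqrt r) * W powr (1/r)"
          using n by (simp add: X_def \<kappa>_def real_sqrt_divide)
        then show ?thesis unfolding sq(1) by (simp add: ac_simps)
      qed
      finally have "s * sqrt n \<le> 240 * 4 ^ 33 * sqrt r * X" using n by simp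
      also have "\<dots> \<le> 240 * 4 ^ 33 * sqrt r * M_star n \<sigma> p (T ` L)" using XM r(1) r1 by (intro mult_left_mono) auto
      finally show ?thesis unfolding pr by simp
    qed
  qed
  then show ?thesis using LK by linarith
qed

theorem theorem3:
  shows "\<exists>C::real. C > 0 \<and>
    (\<forall>n::nat. n \<ge> 1 \<longrightarrow>
      (\<forall>\<sigma>. haar_sphere n \<sigma> \<longrightarrow>
        (\<forall>K. sym_convex_body n K \<and> isotropic n K \<and> vol n K = vol n (unit_ball n) \<longrightarrow>
          ereal (isotropic_constant n K) \<le>
            ereal C * Inf {ereal (sqrt (p0 n p) * M_star n \<sigma> p (T ` L)) | L T p q.
                             K \<subseteq> L \<and> L \<in> QL n q \<and> T \<in> SL n \<and> 1 \<le> q \<and> 1 / p + 1 / q = 1})))"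
proof (intro exI conjI allI impI)
  define C :: real where "C = 120 * 4 ^ 33"
  show C: "(120 * 4 ^ 33 :: real) > 0" by simp
  fix n \<sigma> K
  assume n: "1 \<le> (n::nat)" and \<sigma>: "haar_sphere n \<sigma>" and K: "sym_convex_body n K \<and> isotropic n K \<and> vol n K = vol n (unit_ball n)"
  define S where "S = {ereal (sqrt (p0 n p) * M_star n \<sigma> p (T ` L)) | L T p q.
                             K \<subseteq> L \<and> L \<in> QL n q \<and> T \<in> SL n \<and> 1 \<le> q \<and> 1 / p + 1 / q = 1}"
  have "ereal (isotropic_constant n K / C) \<le> Inf S"
  proof (rule Inf_greatest)
    fix e assume "e \<in> S"
    then obtain L T p q where e: "e = ereal (sqrt (p0 n p) * M_star n \<sigma> p (T ` L))"
      and h: "K \<subseteq> L" "L \<in> QL n q" "T \<in> SL n" "1 \<le> q" "1 / p + 1 / q = 1" unfolding S_def by blast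
    have "isotropic_constant n K \<le> C * (sqrt (p0 n p) * M_star n \<sigma> p (T ` L))"
      using isotropic_constant_le_M_star[OF n \<sigma> _ _ _ h] K by (simp add: C_def)
    then show "ereal (isotropic_constant n K / C) \<le> e" using C by (simp add: e divide_le_eq C_def mult.commute)
  qed
  then have "ereal C * ereal (isotropic_constant n K / C) \<le> ereal C * Inf S"
    by (rule ereal_mult_left_mono) (simp add: C_def)
  then show "ereal (isotropic_constant n K) \<le> ereal (120 * 4 ^ 33) * Inf {ereal (sqrt (p0 n p) * M_star n \<sigma> p (T ` L)) | L T p q.
                             K \<subseteq> L \<and> L \<in> QL n q \<and> T \<in> SL n \<and> 1 \<le> q \<and> 1 / p + 1 / q = 1}"
    by (simp add: C_def S_def)
qed

end
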